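(* Let $d\in\mathbb N$, $\alpha\in\mathbb R$, $\alpha\ne0$, let $\mathcal H_X,\mathcal H_Y$ be (finite- or infinite-dimensional) separable complex Hilbert spaces, and let $X_n=\mathcal H_X$, $Y_n=\mathcal H_Y$ for all $n\in\mathbb Z^d$. Let $\omega(j)=(1+|j|)^s$, $j\in\mathbb Z^d$, with $s>(d+1)^2$, let $\mathbb A=(a_{mn})$, $a_{mn}:\mathcal H_X\to\mathcal H_Y$, be an operator matrix in $\Sigma^\omega_\alpha$, and let $p\in[1,\infty]$. (i) If $\mathbb A$ is bounded below in $\ell^p$, then $\mathbb A:\ell^q(\mathbb Z^d,\mathcal H_X)\to\ell^q(\mathbb Z^d,\mathcal H_Y)$ is left invertible for all $q\in[1,\infty]$ and a left inverse is given by $\mathbb A^\sharp=(\mathbb A^\star\mathbb A)^{-1}\mathbb A^\star\in\Sigma^\omega_{\alpha^{-1}}$. (ii) If $\mathbb A^\star$ is bounded below in $\ell^p$, then $\mathbb A:\ell^q(\mathbb Z^d,\mathcal H_X)\to\ell^q(\mathbb Z^d,\mathcal H_Y)$ is right invertible for all $q\in[1,\infty]$ and a right inverse is given by $\mathbb A^\flat=\mathbb A^\star(\mathbb A\mathbb A^\star)^{-1}\in\Sigma^\omega_{\alpha^{-1}}$.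
   Context: For $n\in\mathbb Z^d$, $|n|=\max_{1\le k\le d}|n_k|$. For a Hilbert space $\mathcal H$, $\ell^p(\mathbb Z^d,\mathcal H)$ is the Banach space of sequences $x=(x_n)_{n\in\mathbb Z^d}$ in $\mathcal H$ with norm $\|x\|_p=(\sum_n\|x_n\|^p)^{1/p}$ ($1\le p<\infty$), $\|x\|_\infty=\sup_n\|x_n\|$. An operator matrix $\mathbb A=(a_{mn})_{m,n\in\mathbb Z^d}$ consists of bounded linear operators $a_{mn}:\mathcal H_X\to\mathcal H_Y$; $\|\mathbb A\|_{\sup}=\sup_{m,n}\|a_{mn}\|$. For $\alpha\ne0$ and $j\in\mathbb Z^d$ the $j$-th $\alpha$-slant of $\mathbb A$ is $A_j=(a^{(j)}_{mn})$ with $a^{(j)}_{mn}=a_{mn}\prod_{k=1}^d\chi_{[j_k,j_k+1)}(\alpha m_k-n_k)$. Let $K=\lceil|\alpha|^{-1}\rceil^d$. $\Sigma^\omega_\alpha$ is the class of matrices with $\|\mathbb A\|_{\Sigma^\omega_\alpha}=K\sum_{j}\|A_j\|_{\sup}\omega(j)<\infty$; the same definition applies with $\alpha^{-1}$ in place of $\alpha$ and with $\mathcal H_X$, $\mathcal H_Y$ interchanged. Every $\mathbb A\in\Sigma^\omega_\alpha$ defines, by $(\mathbb Ax)_m=\sum_na_{mn}x_n$, a bounded operator $\ell^p(\mathbb Z^d,\mathcal H_X)\to\ell^p(\mathbb Z^d,\mathcal H_Y)$ for all $p\in[1,\infty]$. Operators are identified with their matrices. The matrix $\mathbb A^\star=(a_{mn}^\star)$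 is defined by $a_{mn}^\star=a_{nm}^*$ (Hilbert adjoint of $a_{nm}$), and it defines bounded operators $\ell^p(\mathbb Z^d,\mathcal H_Y)\to\ell^p(\mathbb Z^d,\mathcal H_X)$. A matrix $\mathbb B$ is bounded below in $\ell^p$ if there is $\kappa_p>0$ with $\|\mathbb Bx\|_p\ge\kappa_p\|x\|_p$ for all $x$ in the $\ell^p$ space on which it acts. *)

theory Defs
  imports "HOL-Analysis.Analysis"
begin

section \<open>Complex Hilbert spaces\<close>

text \<open>The complex inner product is linear in its first argument.\<close>

class complex_hilbert = banach +
  fixes scaleC :: "complex \<Rightarrow> 'a \<Rightarrow> 'a"  (infixr \<open>*\<^sub>C\<close> 75)
    and cinner :: "'a \<Rightarrow> 'a \<Rightarrow> complex"
  assumes scaleR_scaleC: "r *\<^sub>R x = complex_of_real r *\<^sub>C x"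
    and scaleC_add_right: "c *\<^sub>C (x + y) = c *\<^sub>C x + c *\<^sub>C y"
    and scaleC_add_left: "(b + c) *\<^sub>C x = b *\<^sub>C x + c *\<^sub>C x"
    and scaleC_scaleC: "b *\<^sub>C c *\<^sub>C x = (b * c) *\<^sub>C x"
    and scaleC_one: "1 *\<^sub>C x = x"
    and cinner_commute: "cinner x y = cnj (cinner y x)"
    and cinner_add_left: "cinner (x + y) z = cinner x z + cinner y z"
    and cinner_scaleC_left: "cinner (c *\<^sub>C x) y = c * cinner x y"
    and cinner_self: "cinner x x = complex_of_real ((norm x)\<^sup>2)"

instantiation complex :: complex_hilbert
begin

definition scaleC_complex :: "complex \<Rightarrow> complex \<Rightarrow> complex"
  where "scaleC_complex c x = c * x"

definition cinner_complex :: "complex \<Rightarrow> complex \<Rightarrow> complex"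
  where "cinner_complex x y = x * cnj y"

instance
  by standard
    (simp_all add: scaleC_complex_def cinner_complex_def scaleR_conv_of_real algebra_simps
      complex_norm_square[symmetric])

end

text \<open>
  The type \<open>'a \<Rightarrow>\<^sub>L 'b\<close> consists of the bounded real-linear maps, with the operator norm;
  complex linearity is imposed separately.
\<close>

definition complex_linear :: "('a::complex_hilbert \<Rightarrow>\<^sub>L 'b::complex_hilbert) \<Rightarrow> bool"
  where "complex_linear a \<longleftrightarrow> (\<forall>c x. blinfun_apply a (c *\<^sub>C x) = c *\<^sub>C blinfun_apply a x)"

definition hilbert_adjoint ::
  "('a::complex_hilbert \<Rightarrow>\<^sub>L 'b::complex_hilbert) \<Rightarrow> ('b \<Rightarrow>\<^sub>L 'a)"
  where "hilbert_adjoint a =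
    (THE b. \<forall>x y. cinner (blinfun_apply a x) y = cinner x (blinfun_apply b y))"


section \<open>Vector-valued sequence spaces\<close>

type_synonym 'd index = "int ^ 'd"

definition sup_abs :: "'d::finite index \<Rightarrow> int"
  where "sup_abs n = Max (range (\<lambda>k. \<bar>n $ k\<bar>))"

definition lp :: "ennreal \<Rightarrow> ('d::finite index \<Rightarrow> 'a::real_normed_vector) set"
  where "lp p = (if p = \<infinity> then {x. bdd_above (range (\<lambda>n. norm (x n)))}
                 else {x. (\<lambda>n. norm (x n) powr enn2real p) summable_on UNIV})"

definition lp_norm :: "ennreal \<Rightarrow> ('d::finite index \<Rightarrow> 'a::real_normed_vector) \<Rightarrow> real"
  where "lp_norm p x = (if p = \<infinity> then (SUP n. norm (x n))
                        else (\<Sum>\<^sub>\<infinity>n. norm (x n) powr enn2real p) powr (1 / enn2real p))"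

definition lp_operator :: "ennreal \<Rightarrow>
    (('d::finite index \<Rightarrow> 'a::complex_hilbert) \<Rightarrow> ('d index \<Rightarrow> 'b::complex_hilbert)) \<Rightarrow> bool"
  where "lp_operator p T \<longleftrightarrow>
    (\<forall>x\<in>lp p. T x \<in> lp p) \<and>
    (\<forall>x\<in>lp p. \<forall>y\<in>lp p. T (\<lambda>n. x n + y n) = (\<lambda>m. T x m + T y m)) \<and>
    (\<forall>c. \<forall>x\<in>lp p. T (\<lambda>n. c *\<^sub>C x n) = (\<lambda>m. c *\<^sub>C T x m)) \<and>
    (\<exists>C. \<forall>x\<in>lp p. lp_norm p (T x) \<le> C * lp_norm p x)"

definition lp_left_inverse :: "ennreal \<Rightarrow>
    (('d::finite index \<Rightarrow> 'a::complex_hilbert) \<Rightarrow> ('d index \<Rightarrow> 'b::complex_hilbert)) \<Rightarrow>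
    (('d index \<Rightarrow> 'b) \<Rightarrow> ('d index \<Rightarrow> 'a)) \<Rightarrow> bool"
  where "lp_left_inverse p T L \<longleftrightarrow>
    lp_operator p T \<and> lp_operator p L \<and> (\<forall>x\<in>lp p. L (T x) = x)"

definition lp_right_inverse :: "ennreal \<Rightarrow>
    (('d::finite index \<Rightarrow> 'a::complex_hilbert) \<Rightarrow> ('d index \<Rightarrow> 'b::complex_hilbert)) \<Rightarrow>
    (('d index \<Rightarrow> 'b) \<Rightarrow> ('d index \<Rightarrow> 'a)) \<Rightarrow> bool"
  where "lp_right_inverse p T R \<longleftrightarrow>
    lp_operator p T \<and> lp_operator p R \<and> (\<forall>y\<in>lp p. T (R y) = y)"

definition lp_left_invertible :: "ennreal \<Rightarrow>
    (('d::finite index \<Rightarrow> 'a::complex_hilbert) \<Rightarrow> ('d index \<Rightarrow> 'b::complex_hilbert)) \<Rightarrow> bool"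
  where "lp_left_invertible p T \<longleftrightarrow> (\<exists>L. lp_left_inverse p T L)"

definition lp_right_invertible :: "ennreal \<Rightarrow>
    (('d::finite index \<Rightarrow> 'a::complex_hilbert) \<Rightarrow> ('d index \<Rightarrow> 'b::complex_hilbert)) \<Rightarrow> bool"
  where "lp_right_invertible p T \<longleftrightarrow> (\<exists>R. lp_right_inverse p T R)"

definition lp_inverse :: "ennreal \<Rightarrow>
    (('d::finite index \<Rightarrow> 'a::complex_hilbert) \<Rightarrow> ('d index \<Rightarrow> 'b::complex_hilbert)) \<Rightarrow>
    (('d index \<Rightarrow> 'b) \<Rightarrow> ('d index \<Rightarrow> 'a)) \<Rightarrow> bool"
  where "lp_inverse p T S \<longleftrightarrow> lp_left_inverse p T S \<and> lp_right_inverse p T S"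


section \<open>Operator matrices\<close>

type_synonym ('a, 'b, 'd) op_matrix = "'d index \<Rightarrow> 'd index \<Rightarrow> 'a \<Rightarrow>\<^sub>L 'b"

definition operator_matrix ::
  "('a::complex_hilbert, 'b::complex_hilbert, 'd::finite) op_matrix \<Rightarrow> bool"
  where "operator_matrix A \<longleftrightarrow> (\<forall>m n. complex_linear (A m n))"

definition mat_op :: "('a::complex_hilbert, 'b::complex_hilbert, 'd::finite) op_matrix \<Rightarrow>
    ('d index \<Rightarrow> 'a) \<Rightarrow> ('d index \<Rightarrow> 'b)"
  where "mat_op A x = (\<lambda>m. \<Sum>\<^sub>\<infinity>n. blinfun_apply (A m n) (x n))"

definition mat_star :: "('a::complex_hilbert, 'b::complex_hilbert, 'd::finite) op_matrix \<Rightarrow>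
    ('b, 'a, 'd) op_matrix"
  where "mat_star A = (\<lambda>m n. hilbert_adjoint (A n m))"

definition bounded_below :: "ennreal \<Rightarrow>
    ('a::complex_hilbert, 'b::complex_hilbert, 'd::finite) op_matrix \<Rightarrow> bool"
  where "bounded_below p B \<longleftrightarrow>
    (\<exists>\<kappa>>0. \<forall>x\<in>lp p. lp_norm p (mat_op B x) \<ge> \<kappa> * lp_norm p x)"

text \<open>The matrix norms below take values in \<^typ>\<open>ennreal\<close>, so that they may be infinite.\<close>

definition sup_norm ::
  "('a::complex_hilbert, 'b::complex_hilbert, 'd::finite) op_matrix \<Rightarrow> ennreal"
  where "sup_norm A = (SUP m. SUP n. ennreal (norm (A m n)))"

definition slant :: "real \<Rightarrow> 'd::finite index \<Rightarrow>
    ('a::complex_hilbert, 'b::complex_hilbert, 'd) op_matrix \<Rightarrow> ('a, 'b, 'd) op_matrix"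
  where "slant \<alpha> j A = (\<lambda>m n.
    (\<Prod>k\<in>UNIV. indicat_real {real_of_int (j $ k) ..< real_of_int (j $ k) + 1}
                  (\<alpha> * real_of_int (m $ k) - real_of_int (n $ k))) *\<^sub>R A m n)"

definition Sigma_norm :: "real \<Rightarrow> ('d::finite index \<Rightarrow> real) \<Rightarrow>
    ('a::complex_hilbert, 'b::complex_hilbert, 'd) op_matrix \<Rightarrow> ennreal"
  where "Sigma_norm \<alpha> \<omega> A =
    of_nat (nat \<lceil>1 / \<bar>\<alpha>\<bar>\<rceil> ^ CARD('d)) *
      (\<Sum>\<^sub>\<infinity>j. sup_norm (slant \<alpha> j A) * ennreal (\<omega> j))"

definition Sigma_class :: "real \<Rightarrow> ('d::finite index \<Rightarrow> real) \<Rightarrow>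
    ('a::complex_hilbert, 'b::complex_hilbert, 'd) op_matrix set"
  where "Sigma_class \<alpha> \<omega> = {A. operator_matrix A \<and> Sigma_norm \<alpha> \<omega> A < \<infinity>}"

definition poly_weight :: "real \<Rightarrow> 'd::finite index \<Rightarrow> real"
  where "poly_weight s j = (1 + real_of_int (sup_abs j)) powr s"

text \<open>
  A matrix is an inverse of an operator if it represents the bounded two-sided inverse of that
  operator on every \<open>\<ell>\<^sup>q\<close>, \<open>1 \<le> q \<le> \<infinity>\<close>.  Such a matrix is unique, since its entries are
  determined by the values of the inverse on sequences supported at a single index.
\<close>

definition inverse_matrix :: "(('d::finite index \<Rightarrow> 'a::complex_hilbert) \<Rightarrow> ('d index \<Rightarrow> 'a)) \<Rightarrow>
    ('a, 'a, 'd) op_matrix \<Rightarrow> bool"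
  where "inverse_matrix T G \<longleftrightarrow>
    operator_matrix G \<and> (\<forall>q\<ge>1. lp_inverse q T (mat_op G))"

definition represents :: "('a::complex_hilbert, 'b::complex_hilbert, 'd::finite) op_matrix \<Rightarrow>
    (('d index \<Rightarrow> 'a) \<Rightarrow> ('d index \<Rightarrow> 'b)) \<Rightarrow> bool"
  where "represents B T \<longleftrightarrow> (\<forall>q\<ge>1. \<forall>x\<in>lp q. mat_op B x = T x)"

end

theory Submission
  imports Defs
begin

text \<open>
  Write \<open>\<phi> m = \<lfloor>\<alpha> m\<rfloor>\<close>, componentwise.  Membership of \<open>A\<close> in the weighted class means that the entry at
  \<open>(m, n)\<close> is bounded in norm by \<open>a (\<phi> m - n)\<close>, where \<open>\<Sum>j. a j * \<omega> j\<close> is finite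
  (\<open>Sigma_class_iff_slanted\<close>), and \<open>\<phi>\<close> takes each value at most \<open>K\<close> times.  Suppose that \<open>B\<close>, which
  will be \<open>A\<close> or \<open>A\<^sup>\<star>\<close>, is such a matrix and is bounded below on one \<open>\<ell>\<^sup>p\<close>.  The two cases are symmetric:
  for \<open>B = A\<close> the left inverse is \<open>(B\<^sup>\<star>B)\<^sup>-\<^sup>1B\<^sup>\<star>\<close>, and for \<open>B = A\<^sup>\<star>\<close> the right inverse is \<open>B (B\<^sup>\<star>B)\<^sup>-\<^sup>1\<close>.
  Everything rests on inverting \<open>B\<^sup>\<star>B\<close>, a matrix with entries bounded by a function of \<open>m - n\<close>, within
  the weighted class (\<open>gram_inverse\<close>).  Three ideas carry this.

  The lower bound passes from \<open>\<ell>\<^sup>p\<close> to \<open>\<ell>\<^sup>2\<close>.  Multiply a sequence by a weight \<open>w\<close> that decays polynomially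
  away from a point \<open>u\<close> at scale \<open>R\<close>.  When \<open>R\<close> is large the weight varies so slowly that its
  commutator with \<open>B\<close> is small on the weighted space, uniformly in \<open>u\<close>, and can be absorbed into the
  lower bound (\<open>commutator_bound\<close>).  Hence the value of \<open>x\<close> at \<open>u\<close> is bounded by a localised supremum
  of \<open>B x\<close> near \<open>u\<close> (\<open>bounded_below_pointwise\<close>).  This no longer mentions \<open>p\<close>; squaring and summing
  over \<open>u\<close> gives a lower bound on \<open>\<ell>\<^sup>2\<close> (\<open>bounded_below_energy\<close>).  The exponent \<open>2 (d + 1)\<close> needed for
  the weight is at most \<open>(d + 1)\<^sup>2 < s\<close>.

  On \<open>\<ell>\<^sup>2\<close> the lower bound makes \<open>T = 1 - B\<^sup>\<star>B / M\<close> a strict contraction for large \<open>M\<close>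
  (\<open>gram_contraction\<close>).

  The Neumann series of such a \<open>T\<close> converges even in the weighted class
  (\<open>resolvent_of_contraction\<close>).  The entries of \<open>T ^ (2 ^ k)\<close> are at most \<open>r ^ (2 ^ k)\<close>, with \<open>r < 1\<close> the
  bound on \<open>\<ell>\<^sup>2\<close>.  For a polynomial weight the weighted norm of a square is at most a constant times
  the product of the weighted and the unweighted norm, and the unweighted norm is controlled by the
  entries close to the diagonal and by a small multiple of the weighted norm.  Repeated squaring
  therefore drives the weighted norm of \<open>T ^ (2 ^ k)\<close> below \<open>1\<close> for some \<open>k\<close>, so that \<open>1 - T ^ (2 ^ k)\<close> is
  invertible, and the factorisation \<open>1 - U\<^sup>2 = (1 - U) (1 + U)\<close> leads back to \<open>1 - T\<close>.

  The resulting matrix acts on bounded sequences, hence on every \<open>\<ell>\<^sup>q\<close> at once, and products with \<open>A\<^sup>\<star>\<close>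
  stay in the class of slope \<open>1 / \<alpha>\<close> because transposition exchanges the slopes \<open>\<alpha>\<close> and \<open>1 / \<alpha>\<close>
  (\<open>slanted_transpose\<close>).
\<close>

section \<open>Sums of extended nonnegative numbers and absolutely convergent sums\<close>

abbreviation esum :: "('i \<Rightarrow> ennreal) \<Rightarrow> ennreal"  (binder \<open>ESUM \<close> 10)
  where "esum f \<equiv> (\<integral>\<^sup>+ i. f i \<partial>count_space UNIV)"

abbreviation enorm :: "'b::real_normed_vector \<Rightarrow> ennreal"
  where "enorm x \<equiv> ennreal (norm x)"

lemma esum_swap:
  fixes f :: "'i::countable \<Rightarrow> 'j \<Rightarrow> ennreal"
  shows "(ESUM i. (ESUM j. f i j)) = (ESUM j. (ESUM i. f i j))"
  by (rule nn_integral_count_space_nn_integral[symmetric]) auto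

lemma esum_ge_term: "f i \<le> esum f"
proof -
  have "f i = (\<integral>\<^sup>+ j. f j * indicator {i} j \<partial>count_space UNIV)"
    by (subst nn_integral_indicator_singleton) auto
  also have "\<dots> \<le> esum f"
    by (intro nn_integral_mono) (auto simp: indicator_def)
  finally show ?thesis .
qed

lemma sum_le_esum: "finite F \<Longrightarrow> sum f F \<le> esum f"
proof -
  assume F: "finite F"
  have "sum f F = (\<integral>\<^sup>+ j. f j * indicator F j \<partial>count_space UNIV)"
    using F by (subst nn_integral_indicator_finite) auto
  also have "\<dots> \<le> esum f"
    by (intro nn_integral_mono) (auto simp: indicator_def)
  finally show ?thesis .
qed

lemma infsum_eq_esum:
  fixes f :: "'i::countable \<Rightarrow> ennreal"
  shows "infsum f UNIV = esum f"
proof (rule antisym)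
  show "infsum f UNIV \<le> esum f"
    by (subst nonneg_infsum_complete) (auto intro!: SUP_least sum_le_esum)
  show "esum f \<le> infsum f UNIV"
  proof (cases "finite (UNIV :: 'i set)")
    case True
    then show ?thesis by (simp add: nn_integral_count_space_finite)
  next
    case False
    then have g: "bij_betw (from_nat_into (UNIV::'i set)) UNIV UNIV"
      by (intro bij_betw_from_nat_into) auto
    have "esum f = (\<Sum>n. f (from_nat_into UNIV n))"
      using nn_integral_bij_count_space[OF g, of f] by (simp add: nn_integral_count_space_nat)
    also have "\<dots> = (SUP n. \<Sum>i<n. f (from_nat_into UNIV i))"
      by (rule suminf_eq_SUP)
    also have "\<dots> \<le> infsum f UNIV"
    proof (rule SUP_least)
      fix n
      have inj: "inj_on (from_nat_into (UNIV::'i set)) {..<n}"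
        using g by (auto simp: bij_betw_def intro: inj_on_subset)
      have "(\<Sum>i<n. f (from_nat_into UNIV i)) = sum f (from_nat_into UNIV ` {..<n})"
        by (simp add: sum.reindex[OF inj])
      also have "\<dots> \<le> infsum f UNIV"
        by (subst nonneg_infsum_complete) (auto intro!: SUP_upper)
      finally show "(\<Sum>i<n. f (from_nat_into UNIV i)) \<le> infsum f UNIV" .
    qed
    finally show ?thesis .
  qed
qed

lemma esum_ennreal:
  assumes "f summable_on UNIV" "\<And>i. 0 \<le> f i"
  shows "(ESUM i. ennreal (f i)) = ennreal (infsum f UNIV)"
proof -
  have "(\<lambda>i. norm (f i)) summable_on UNIV"
    using assms by simp
  then have f: "Infinite_Set_Sum.abs_summable_on f UNIV"
    by (simp only: abs_summable_equivalent)
  then show ?thesis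
    using nn_integral_conv_infsetsum[OF f] infsetsum_infsum[OF f] assms(2) by simp
qed

lemma abs_summable_iff_esum:
  fixes f :: "'i \<Rightarrow> 'b::real_normed_vector"
  shows "f abs_summable_on UNIV \<longleftrightarrow> (ESUM i. enorm (f i)) < top"
proof -
  have "f abs_summable_on UNIV \<longleftrightarrow> (\<lambda>i. norm (norm (f i))) summable_on UNIV" by simp
  also have "\<dots> \<longleftrightarrow> Infinite_Set_Sum.abs_summable_on (\<lambda>i. norm (f i)) UNIV"
    by (rule abs_summable_equivalent)
  also have "\<dots> \<longleftrightarrow> (ESUM i. enorm (f i)) < top"
    by (simp add: Infinite_Set_Sum.abs_summable_on_def integrable_iff_bounded)
  finally show ?thesis .
qed

lemma norm_infsum_le_esum:
  fixes f :: "'i \<Rightarrow> 'b::banach"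
  shows "enorm (infsum f UNIV) \<le> (ESUM i. enorm (f i))"
proof (cases "f abs_summable_on UNIV")
  case True
  then show ?thesis
    using norm_infsum_bound[OF True] by (simp add: esum_ennreal ennreal_leI)
next
  case False
  then have "(ESUM i. enorm (f i)) = \<infinity>"
    unfolding abs_summable_iff_esum by (metis infinity_ennreal_def top.not_eq_extremum)
  then show ?thesis by simp
qed

lemma summable_on_of_esum:
  fixes f :: "'i \<Rightarrow> 'b::banach"
  shows "(ESUM i. enorm (f i)) < top \<Longrightarrow> f summable_on UNIV"
  using abs_summable_iff_esum abs_summable_summable by blast

lemma infsum_swap_of_esum:
  fixes f :: "'i::countable \<Rightarrow> 'j::countable \<Rightarrow> 'b::banach"
  assumes "(ESUM i. (ESUM j. enorm (f i j))) < top"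
  shows "(\<Sum>\<^sub>\<infinity>i. \<Sum>\<^sub>\<infinity>j. f i j) = (\<Sum>\<^sub>\<infinity>j. \<Sum>\<^sub>\<infinity>i. f i j)"
    and "\<And>i. (\<lambda>j. f i j) summable_on UNIV"
    and "\<And>j. (\<lambda>i. f i j) summable_on UNIV"
    and "(\<lambda>i. \<Sum>\<^sub>\<infinity>j. f i j) summable_on UNIV"
    and "(\<lambda>j. \<Sum>\<^sub>\<infinity>i. f i j) summable_on UNIV"
proof -
  have row: "(\<lambda>j. f i j) abs_summable_on UNIV" for i
    unfolding abs_summable_iff_esum
    using esum_ge_term[of "\<lambda>i. (ESUM j. enorm (f i j))" i] assms
    by (rule le_less_trans)
  have "(ESUM i. enorm (\<Sum>\<^sub>\<infinity>j. norm (f i j)))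
      = (ESUM i. (ESUM j. enorm (f i j)))"
    using row by (intro nn_integral_cong) (simp add: esum_ennreal infsum_nonneg)
  then have "(\<lambda>i. norm (\<Sum>\<^sub>\<infinity>j. norm (f i j))) summable_on UNIV"
    unfolding abs_summable_iff_esum using assms by (simp only:)
  then have "(\<lambda>(i,j). f i j) abs_summable_on (UNIV \<times> UNIV)"
    unfolding Infinite_Sum.abs_summable_on_Sigma_iff split_conv using row by blast
  then have *: "(\<lambda>(i,j). f i j) summable_on (UNIV \<times> UNIV)"
    by (rule abs_summable_summable)
  show "(\<Sum>\<^sub>\<infinity>i. \<Sum>\<^sub>\<infinity>j. f i j) = (\<Sum>\<^sub>\<infinity>j. \<Sum>\<^sub>\<infinity>i. f i j)"
    by (rule infsum_swap_banach[OF *])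
  show "(\<lambda>j. f i j) summable_on UNIV" for i
    by (rule abs_summable_summable[OF row])
  have swapped: "(ESUM j. (ESUM i. enorm (f i j))) < top"
    using assms by (simp only: esum_swap[of "\<lambda>i j. enorm (f i j)"])
  have "(ESUM i. enorm (f i j)) < top" for j
    using esum_ge_term[of "\<lambda>j. (ESUM i. enorm (f i j))" j] swapped
    by (meson le_less_trans)
  then show "(\<lambda>i. f i j) summable_on UNIV" for j
    by (rule summable_on_of_esum)
  show "(\<lambda>i. \<Sum>\<^sub>\<infinity>j. f i j) summable_on UNIV"
    by (rule summable_on_of_esum, rule le_less_trans[OF _ assms])
       (intro nn_integral_mono norm_infsum_le_esum)
  show "(\<lambda>j. \<Sum>\<^sub>\<infinity>i. f i j) summable_on UNIV"
    by (rule summable_on_of_esum, rule le_less_trans[OF _ swapped])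
       (intro nn_integral_mono norm_infsum_le_esum)
qed

lemma infsum_bounded_linear_of_esum:
  fixes f :: "'i \<Rightarrow> 'b::banach" and h :: "'b \<Rightarrow> 'c::banach"
  assumes "(ESUM i. enorm (f i)) < top" "bounded_linear h"
  shows "h (\<Sum>\<^sub>\<infinity>i. f i) = (\<Sum>\<^sub>\<infinity>i. h (f i))"
  using summable_on_of_esum[OF assms(1)] assms(2)
  by (metis infsum_bounded_linear_strong summable_on_bounded_linear)

lemma esum_fibres_le:
  fixes \<phi> :: "'i::countable \<Rightarrow> 'j::countable"
  assumes "\<And>j. finite {i. \<phi> i = j}" "\<And>j. card {i. \<phi> i = j} \<le> K"
  shows "(ESUM i. g (\<phi> i)) \<le> of_nat K * esum g"
proof -
  have "(ESUM i. g (\<phi> i)) = (ESUM i. (ESUM j. g j * indicator {\<phi> i} j))"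
    by (intro nn_integral_cong, subst nn_integral_indicator_singleton) auto
  also have "\<dots> = (ESUM j. (ESUM i. g j * indicator {\<phi> i} j))"
    by (rule esum_swap)
  also have "\<dots> = (ESUM j. g j * (ESUM i. indicator {i. \<phi> i = j} i))"
    by (subst nn_integral_cmult[symmetric]) (auto intro!: nn_integral_cong simp: indicator_def)
  also have "\<dots> \<le> (ESUM j. g j * of_nat K)"
  proof (intro nn_integral_mono mult_left_mono)
    fix j
    have "(ESUM i. indicator {i. \<phi> i = j} i) = of_nat (card {i. \<phi> i = j})"
      using assms(1) by simp
    also have "\<dots> \<le> (of_nat K :: ennreal)"
      using assms(2)[of j] by (simp add: of_nat_mono)
    finally show "(ESUM i. indicator {i. \<phi> i = j} i) \<le> of_nat K" .
  qed auto
  also have "\<dots> = of_nat K * esum g"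
    by (subst nn_integral_multc) (auto simp: mult.commute)
  finally show ?thesis .
qed

lemma esum_reflect:
  fixes g :: "'i::ab_group_add \<Rightarrow> ennreal"
  shows "(ESUM i. g (c - i)) = esum g"
  by (rule nn_integral_bij_count_space) (auto intro!: bij_betwI[where g="\<lambda>i. c - i"])

lemma esum_shift:
  fixes g :: "'i::ab_group_add \<Rightarrow> ennreal"
  shows "(ESUM i. g (i - c)) = esum g" and "(ESUM i. g (i + c)) = esum g"
proof -
  show "(ESUM i. g (i - c)) = esum g"
    by (rule nn_integral_bij_count_space) (auto intro!: bij_betwI[where g="\<lambda>i. i + c"])
  show "(ESUM i. g (i + c)) = esum g"
    by (rule nn_integral_bij_count_space) (auto intro!: bij_betwI[where g="\<lambda>i. i - c"])
qed


section \<open>The index lattice and polynomial weights\<close>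

lemma sup_abs_nth: "\<bar>n $ k\<bar> \<le> sup_abs n"
  unfolding sup_abs_def by (rule Max_ge) auto

lemma sup_abs_le_iff: "sup_abs n \<le> c \<longleftrightarrow> (\<forall>k. \<bar>n $ k\<bar> \<le> c)"
  unfolding sup_abs_def by (subst Max_le_iff) auto

lemma sup_abs_nonneg [simp]: "0 \<le> sup_abs n"
  using sup_abs_nth[of n undefined] by linarith

lemma sup_abs_zero [simp]: "sup_abs 0 = 0"
  by (rule antisym) (auto simp: sup_abs_le_iff)

lemma sup_abs_triangle: "sup_abs (m + n) \<le> sup_abs m + sup_abs n"
proof -
  have "\<bar>m $ k + n $ k\<bar> \<le> sup_abs m + sup_abs n" for k
    using sup_abs_nth[of m k] sup_abs_nth[of n k] by linarith
  then show ?thesis by (simp add: sup_abs_le_iff)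
qed

lemma sup_abs_minus [simp]: "sup_abs (- n) = sup_abs n"
  by (simp add: sup_abs_def)

lemma sup_abs_triangle_diff: "sup_abs (m - n) \<le> sup_abs m + sup_abs n"
  using sup_abs_triangle[of m "- n"] by simp

definition cube :: "nat \<Rightarrow> 'd::finite index set"
  where "cube N = {l. sup_abs l \<le> int N}"

lemma cube_image_PiE:
  "cube N = (\<lambda>f. \<chi> k. f k) ` (PiE UNIV (\<lambda>_. {- int N..int N}))"
proof -
  have "l \<in> (\<lambda>f. \<chi> k. f k) ` (PiE UNIV (\<lambda>_. {- int N..int N}))" if "\<forall>k. \<bar>l $ k\<bar> \<le> int N" for l
    using that by (intro image_eqI[where x="\<lambda>k. l $ k"]) (auto simp: abs_le_iff minus_le_iff)
  moreover have "sup_abs (\<chi> k. f k) \<le> int N" if "f \<in> PiE (UNIV :: 'd::finite set) (\<lambda>_. {- int N..int N})" for f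
  proof -
    have "\<bar>f k\<bar> \<le> int N" for k
      using PiE_mem[OF that, of k] by auto
    then show ?thesis by (simp add: sup_abs_le_iff)
  qed
  ultimately show ?thesis
    unfolding cube_def by (auto simp: sup_abs_le_iff simp del: vec_lambda_beta)
qed

lemma finite_cube [simp]: "finite (cube N)"
  unfolding cube_image_PiE by (intro finite_imageI finite_PiE) auto

lemma card_cube_le: "card (cube N :: 'd::finite index set) \<le> (2 * N + 1) ^ CARD('d)"
proof -
  have "card (cube N :: 'd index set) \<le> card (PiE (UNIV :: 'd set) (\<lambda>_. {- int N..int N}))"
    unfolding cube_image_PiE by (intro card_image_le finite_PiE) auto
  also have "\<dots> = (2 * N + 1) ^ CARD('d)"
    by (simp add: card_PiE nat_add_distrib nat_mult_distrib)
  finally show ?thesis .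
qed

lemma poly_weight_pos [simp]: "0 < poly_weight s j"
proof -
  have "0 < 1 + real_of_int (sup_abs j)" by (simp add: add_pos_nonneg)
  then show ?thesis unfolding poly_weight_def by simp
qed

lemma poly_weight_nonneg [simp]: "0 \<le> poly_weight s j"
  by (simp add: less_imp_le)

lemma poly_weight_ge_1: "0 \<le> s \<Longrightarrow> 1 \<le> poly_weight s j"
  unfolding poly_weight_def by (rule ge_one_powr_ge_zero) auto

lemma poly_weight_zero [simp]: "poly_weight s 0 = 1"
  by (simp add: poly_weight_def)

lemma poly_weight_mono_exponent: "s \<le> t \<Longrightarrow> poly_weight s j \<le> poly_weight t j"
  unfolding poly_weight_def by (rule powr_mono) auto

lemma poly_weight_minus [simp]: "poly_weight s (- j) = poly_weight s j"
  by (simp add: poly_weight_def)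

lemma poly_weight_submult:
  assumes "0 \<le> s" shows "poly_weight s (i + j) \<le> poly_weight s i * poly_weight s j"
proof -
  have "real_of_int (sup_abs (i + j)) \<le> sup_abs i + sup_abs j"
    using sup_abs_triangle by (simp only: of_int_le_iff flip: of_int_add)
  moreover have "0 \<le> real_of_int (sup_abs i) * real_of_int (sup_abs j)"
    by (intro mult_nonneg_nonneg) auto
  ultimately have "1 + real_of_int (sup_abs (i + j))
      \<le> (1 + real_of_int (sup_abs i)) * (1 + real_of_int (sup_abs j))"
    unfolding ring_distribs by linarith
  then have "poly_weight s (i + j) \<le> ((1 + real_of_int (sup_abs i)) * (1 + sup_abs j)) powr s"
    unfolding poly_weight_def by (intro powr_mono2) (use assms in auto)
  then show ?thesis by (simp add: poly_weight_def powr_mult)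
qed

lemma poly_weight_subadd:
  fixes i j :: "'d::finite index"
  assumes "0 \<le> s" shows "poly_weight s (i + j) \<le> 2 powr s * (poly_weight s i + poly_weight s j)"
proof -
  have *: "poly_weight s (i + j) \<le> 2 powr s * poly_weight s i"
    if "sup_abs j \<le> sup_abs i" for i j :: "'d index"
  proof -
    have "1 + real_of_int (sup_abs (i + j)) \<le> 2 * (1 + real_of_int (sup_abs i))"
    proof -
      have "sup_abs (i + j) \<le> sup_abs i + sup_abs i"
        using sup_abs_triangle[of i j] that by (meson add_left_mono order_trans)
      then have "1 + sup_abs (i + j) \<le> 2 * (1 + sup_abs i)" by simp
      then have "real_of_int (1 + sup_abs (i + j)) \<le> real_of_int (2 * (1 + sup_abs i))"
        by (simp only: of_int_le_iff)
      then show ?thesis by simp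
    qed
    then have "poly_weight s (i + j) \<le> (2 * (1 + real_of_int (sup_abs i))) powr s"
      unfolding poly_weight_def by (intro powr_mono2) (use assms in auto)
    then show ?thesis
      by (simp only: poly_weight_def powr_mult)
  qed
  have p: "0 \<le> 2 powr s * poly_weight s i" "0 \<le> 2 powr s * poly_weight s j" by auto
  show ?thesis
  proof (cases "sup_abs j \<le> sup_abs i")
    case True
    show ?thesis unfolding distrib_left using *[OF True] p(2) by linarith
  next
    case False
    then have "sup_abs i \<le> sup_abs j" by simp
    then have "poly_weight s (i + j) \<le> 2 powr s * poly_weight s j"
      using * by (metis add.commute)
    then show ?thesis unfolding distrib_left using p(1) by linarith
  qed
qed

abbreviation weighted_sum :: "real \<Rightarrow> ('d::finite index \<Rightarrow> ennreal) \<Rightarrow> ennreal"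
  where "weighted_sum s a \<equiv> (ESUM j. a j * ennreal (poly_weight s j))"

lemma weighted_sum_minus: "weighted_sum s (\<lambda>j. a (- j)) = weighted_sum s a"
  using esum_reflect[of "\<lambda>j. a j * ennreal (poly_weight s j)" 0] by simp

text \<open>
  A polynomial of degree \<open>d + 1\<close> is summable over the lattice of rank \<open>d\<close>: up to a
  constant it is at most the sum of \<open>(1 + N) ^ (- d - 2)\<close> over the cubes of radius \<open>N\<close> that contain the point,
  and such a cube has at most \<open>(2 N + 1) ^ d\<close> points.
\<close>

lemma esum_lattice_decay_finite:
  "(ESUM l :: 'd::finite index. ennreal (1 / (1 + real_of_int (sup_abs l)) ^ (CARD('d) + 1))) < top"
proof -
  define d where "d = CARD('d)"
  define c where "c = (\<lambda>N::nat. (2::real) ^ (d + 2) / (1 + real N) ^ (d + 2))"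
  have c0: "0 \<le> c N" for N by (simp add: c_def)
  have "ennreal (1 / (1 + real_of_int (sup_abs l)) ^ (d + 1))
      \<le> (ESUM N. ennreal (c N) * indicator (cube N) l)" for l :: "'d index"
  proof -
    define L where "L = nat (sup_abs l)"
    have L: "real_of_int (sup_abs l) = real L" "sup_abs l = int L" by (auto simp: L_def)
    have "1 / (1 + real L) ^ (d + 1) = (1 + real L) / (1 + real L) ^ (d + 2)"
      by (simp add: divide_simps)
    \<comment> \<open>The range from \<open>L\<close> to \<open>2 L\<close> has \<open>L + 1\<close> elements, all comparable to \<open>L\<close>.\<close>
    also have "\<dots> = (\<Sum>N\<in>{L..2*L}. 2 ^ (d+2) / (2 + 2 * real L) ^ (d + 2))"
    proof -
      have "(2 + 2 * real L) ^ (d + 2) = 2 ^ (d + 2) * (1 + real L) ^ (d + 2)"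
        by (subst power_mult_distrib[symmetric]) (simp add: algebra_simps)
      moreover have "real (card {L..2*L}) = 1 + real L" by simp
      ultimately show ?thesis by simp
    qed
    also have "\<dots> \<le> (\<Sum>N\<in>{L..2*L}. c N)"
      unfolding c_def by (intro sum_mono divide_left_mono power_mono mult_pos_pos) auto
    finally have "ennreal (1 / (1 + real L) ^ (d + 1)) \<le> (\<Sum>N\<in>{L..2*L}. ennreal (c N))"
      by (simp add: ennreal_leI sum_ennreal c0)
    also have "\<dots> = (\<Sum>N\<in>{L..2*L}. ennreal (c N) * indicator (cube N) l)"
      by (intro sum.cong) (auto simp: cube_def L)
    also have "\<dots> \<le> (ESUM N. ennreal (c N) * indicator (cube N) l)"
      by (rule sum_le_esum) auto
    finally show ?thesis by (simp add: L)
  qed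
  then have "(ESUM l::'d index. ennreal (1 / (1 + real_of_int (sup_abs l)) ^ (d + 1)))
      \<le> (ESUM l::'d index. (ESUM N. ennreal (c N) * indicator (cube N) l))"
    by (intro nn_integral_mono)
  also have "\<dots> = (ESUM N. (ESUM l::'d index. ennreal (c N) * indicator (cube N) l))"
    by (rule esum_swap)
  also have "\<dots> = (ESUM N. ennreal (c N) * of_nat (card (cube N :: 'd index set)))"
    by (simp add: nn_integral_cmult)
  also have "\<dots> \<le> (ESUM N. ennreal (2 ^ (2 * d + 2) * (1 / (1 + real N)\<^sup>2)))"
  proof (intro nn_integral_mono)
    fix N
    have "ennreal (c N) * of_nat (card (cube N :: 'd index set))
        = ennreal (c N * card (cube N :: 'd index set))"
      by (simp add: ennreal_mult c0 ennreal_of_nat_eq_real_of_nat)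
    also have "c N * card (cube N :: 'd index set) \<le> c N * (2 * (1 + real N)) ^ d"
    proof (intro mult_left_mono c0)
      have "real (card (cube N :: 'd index set)) \<le> real ((2 * N + 1) ^ d)"
        using card_cube_le[where 'd='d] unfolding d_def of_nat_le_iff .
      also have "\<dots> = (2 * real N + 1) ^ d" by (simp add: add.commute)
      also have "\<dots> \<le> (2 * (1 + real N)) ^ d"
        by (intro power_mono) auto
      finally show "real (card (cube N :: 'd index set)) \<le> (2 * (1 + real N)) ^ d" .
    qed
    also have "c N * (2 * (1 + real N)) ^ d = 2 ^ (2 * d + 2) * (1 / (1 + real N)\<^sup>2)"
    proof -
      have "2 * d + 2 = (d + 2) + d" by simp
      then have "(2::real) ^ (2 * d + 2) = 2 ^ (d + 2) * 2 ^ d"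
        by (simp only: power_add)
      moreover have "(1 + real N) ^ d \<noteq> 0" by simp
      ultimately show ?thesis
        unfolding c_def power_mult_distrib power_add[of "1 + real N" d 2] by simp
    qed
    finally show "ennreal (c N) * of_nat (card (cube N :: 'd index set))
       \<le> ennreal (2 ^ (2 * d + 2) * (1 / (1 + real N)\<^sup>2))"
      by (simp add: ennreal_leI)
  qed
  also have "\<dots> = (\<Sum>N. ennreal (2 ^ (2 * d + 2) * (1 / (1 + real N)\<^sup>2)))"
    by (rule nn_integral_count_space_nat)
  also have "\<dots> < top"
  proof -
    have "summable (\<lambda>N. 1 / (1 + real N)\<^sup>2)"
      using summable_Suc_iff[of "\<lambda>N. inverse ((real N)\<^sup>2)"] inverse_power_summable[of 2, where 'a=real]
      by (simp add: inverse_eq_divide)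
    then have "summable (\<lambda>N. 2 ^ (2 * d + 2) * (1 / (1 + real N)\<^sup>2))"
      by (rule summable_mult)
    then show ?thesis
      by (subst suminf_ennreal2) auto
  qed
  finally show ?thesis by (simp add: d_def)
qed

text \<open>
  Decay away from the origin at scale \<open>R\<close>.  The weights used to localise sequences are this
  function and its square.
\<close>

definition decay :: "real \<Rightarrow> 'd::finite index \<Rightarrow> real"
  where "decay R l = 1 / (1 + real_of_int (sup_abs l) / R) ^ (CARD('d) + 1)"

lemma decay_pos: "0 < R \<Longrightarrow> 0 < decay R l"
  unfolding decay_def by (simp add: add_pos_nonneg)

lemma decay_le_1: "0 < R \<Longrightarrow> decay R l \<le> 1"
proof -
  assume "0 < R"
  then have *: "1 \<le> (1 + real_of_int (sup_abs l) / R) ^ (CARD('a) + 1)"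
    by (intro one_le_power) simp
  then have "0 < (1 + real_of_int (sup_abs l) / R) ^ (CARD('a) + 1)"
    by (rule less_le_trans[OF zero_less_one])
  with * have ?thesis
    unfolding decay_def by (simp only: divide_le_eq_1_pos)
  then show ?thesis .
qed

lemma decay_zero [simp]: "decay R 0 = 1"
  by (simp add: decay_def)

lemma esum_decay_finite:
  assumes "1 \<le> R"
  shows "(ESUM l :: 'd::finite index. ennreal (decay R l)) < top"
proof -
  have "decay R l \<le> R ^ (CARD('d) + 1) * (1 / (1 + real_of_int (sup_abs l)) ^ (CARD('d) + 1))"
    for l :: "'d index"
  proof -
    have "(1 + real_of_int (sup_abs l)) / R \<le> 1 + real_of_int (sup_abs l) / R"
      using assms by (simp add: add_divide_distrib)
    then have "1 / (1 + real_of_int (sup_abs l) / R) ^ (CARD('d) + 1)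
        \<le> 1 / ((1 + real_of_int (sup_abs l)) / R) ^ (CARD('d) + 1)"
      using assms by (intro divide_left_mono power_mono mult_pos_pos zero_less_power)
        (auto intro!: add_pos_nonneg divide_pos_pos)
    then show ?thesis by (simp add: decay_def power_divide)
  qed
  then have "(ESUM l :: 'd index. ennreal (decay R l)) \<le>
     (ESUM l :: 'd index. ennreal (R ^ (CARD('d) + 1)) * ennreal (1 / (1 + real_of_int (sup_abs l)) ^ (CARD('d) + 1)))"
    using assms by (intro nn_integral_mono) (simp add: ennreal_leI flip: ennreal_mult)
  also have "\<dots> < top"
    by (subst nn_integral_cmult)
      (use esum_lattice_decay_finite[where 'd='d] in \<open>auto simp: ennreal_mult_less_top\<close>)
  finally show ?thesis .
qed

section \<open>Hilbert spaces and adjoints\<close>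

lemma scaleC_zero_right [simp]: "c *\<^sub>C 0 = (0 :: 'a::complex_hilbert)"
  using scaleC_add_right[of c 0 0] by (simp del: scaleC_add_right)

lemma cinner_add_right: "cinner x (y + z) = cinner x y + cinner x (z :: 'a::complex_hilbert)"
  by (metis cinner_add_left cinner_commute complex_cnj_add)

lemma cinner_scaleC_right: "cinner x (c *\<^sub>C y) = cnj c * cinner x (y :: 'a::complex_hilbert)"
  by (metis cinner_scaleC_left cinner_commute complex_cnj_mult)

lemma norm_scaleC: "norm (c *\<^sub>C x) = cmod c * norm (x :: 'a::complex_hilbert)"
proof -
  have "cinner (c *\<^sub>C x) (c *\<^sub>C x) = (c * cnj c) * cinner x x"
    by (simp add: cinner_scaleC_left cinner_scaleC_right)
  then have "complex_of_real ((norm (c *\<^sub>C x))\<^sup>2) = complex_of_real ((cmod c * norm x)\<^sup>2)"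
    unfolding cinner_self complex_norm_square[symmetric] by (simp add: power_mult_distrib)
  then have "(norm (c *\<^sub>C x))\<^sup>2 = (cmod c * norm x)\<^sup>2"
    by (simp only: of_real_eq_iff)
  then show ?thesis by (simp add: power2_eq_iff_nonneg)
qed

lemma scaleC_scaleR_commute: "c *\<^sub>C (r *\<^sub>R x) = r *\<^sub>R (c *\<^sub>C (x :: 'a::complex_hilbert))"
  by (simp add: scaleR_scaleC scaleC_scaleC mult.commute)

lemma bounded_linear_scaleC: "bounded_linear (\<lambda>x :: 'a::complex_hilbert. c *\<^sub>C x)"
  by (rule bounded_linear_intro[where K="cmod c"])
     (auto simp: scaleC_add_right scaleC_scaleR_commute norm_scaleC mult.commute)

text \<open>
  Minimisation arguments and expansions of squared norms take place in the underlying real Hilbert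
  space; the complex inner product is recovered from the values at \<open>x\<close> and \<open>\<i> x\<close>.
\<close>

definition rinner :: "'a::complex_hilbert \<Rightarrow> 'a \<Rightarrow> real"
  where "rinner x y = Re (cinner x y)"

lemma rinner_commute: "rinner x y = rinner y x"
  unfolding rinner_def by (subst cinner_commute) simp

lemma rinner_add_left: "rinner (x + y) z = rinner x z + rinner y z"
  by (simp add: rinner_def cinner_add_left)

lemma rinner_add_right: "rinner x (y + z) = rinner x y + rinner x z"
  by (simp add: rinner_def cinner_add_right)

lemma rinner_scaleR_left: "rinner (r *\<^sub>R x) y = r * rinner x y"
  by (simp add: rinner_def scaleR_scaleC cinner_scaleC_left)

lemma rinner_scaleR_right: "rinner x (r *\<^sub>R y) = r * rinner x y"
  by (simp add: rinner_def scaleR_scaleC cinner_scaleC_right)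

lemma rinner_self: "rinner x x = (norm x)\<^sup>2"
  by (simp add: rinner_def cinner_self)

lemma rinner_diff_right: "rinner x (y - z) = rinner x y - rinner x z"
  using rinner_add_right[of x "y - z" z] by simp

lemma norm_add_squared: "(norm (x + y))\<^sup>2 = (norm x)\<^sup>2 + 2 * rinner x y + (norm (y :: 'a::complex_hilbert))\<^sup>2"
  by (simp add: rinner_self[symmetric] rinner_add_left rinner_add_right rinner_commute)

lemma norm_diff_scaleR_squared:
  "(norm (x - r *\<^sub>R y))\<^sup>2 = (norm x)\<^sup>2 - 2 * r * rinner x y + r\<^sup>2 * (norm (y :: 'a::complex_hilbert))\<^sup>2"
  using norm_add_squared[of x "(- r) *\<^sub>R y"]
  by (simp add: rinner_scaleR_right power_mult_distrib del: scaleR_minus_left)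
     (simp add: power_mult_distrib)

lemma rinner_le: "rinner x y \<le> norm x * norm y"
proof -
  have "(norm (x + y))\<^sup>2 \<le> (norm x + norm y)\<^sup>2"
    by (intro power_mono norm_triangle_ineq) auto
  then show ?thesis unfolding norm_add_squared power2_sum by simp
qed

lemma abs_rinner_le: "\<bar>rinner x y\<bar> \<le> norm x * norm y"
  using rinner_le[of x y] rinner_le[of "- x" y] rinner_scaleR_left[of "-1" x y] by simp

lemma rinner_eqI: "(\<And>x. rinner x u = rinner x v) \<Longrightarrow> u = v"
  using rinner_self[of "u - v"] by (simp add: rinner_diff_right)

lemma bounded_linear_rinner_left: "bounded_linear (\<lambda>x. rinner x y)"
  by (rule bounded_linear_intro[where K="norm y"])
     (auto simp: rinner_add_left rinner_scaleR_left abs_rinner_le)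

lemma cinner_eq_rinner: "cinner x y = Complex (rinner x y) (- rinner (\<i> *\<^sub>C x) y)"
  by (simp add: rinner_def cinner_scaleC_left complex_eq_iff)

text \<open>
  The representing vector minimises \<open>\<parallel>x\<parallel>\<^sup>2 - 2 f x\<close>; a minimising sequence is Cauchy by the
  parallelogram law.
\<close>

lemma riesz_representation:
  fixes f :: "'a::complex_hilbert \<Rightarrow> real"
  assumes "bounded_linear f"
  shows "\<exists>z. \<forall>x. f x = rinner x z"
proof -
  interpret f: bounded_linear f by fact
  define J where "J = (\<lambda>x. (norm x)\<^sup>2 - 2 * f x)"
  obtain B where B: "\<And>x. norm (f x) \<le> norm x * B" "0 < B"
    using f.pos_bounded by blast
  have lower: "- B\<^sup>2 \<le> J x" for x
  proof -
    have "f x \<le> norm x * B" using B(1)[of x] by simp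
    moreover have "0 \<le> (norm x - B)\<^sup>2" by simp
    ultimately show ?thesis
      unfolding J_def by (simp add: power2_diff)
  qed
  define I where "I = (INF x. J x)"
  have bdd: "bdd_below (range J)" using lower by (auto intro!: bdd_belowI)
  have I_le: "I \<le> J x" for x unfolding I_def by (rule cINF_lower[OF bdd]) simp
  have "\<exists>x. J x < I + 1 / real (Suc n)" for n
  proof -
    have "Inf (range J) < I + 1 / real (Suc n)" by (simp add: I_def)
    then show ?thesis by (subst (asm) cInf_less_iff) (use bdd in auto)
  qed
  then obtain X where X: "\<And>n. J (X n) < I + 1 / real (Suc n)" by metis
  have par: "(norm (x - y))\<^sup>2 = 2 * J x + 2 * J y - 4 * J ((1/2) *\<^sub>R (x + y))" for x y
  proof -
    have half: "(norm ((1/2) *\<^sub>R (x + y)))\<^sup>2 = (norm (x + y))\<^sup>2 / 4"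
      by (simp add: power_divide)
    show ?thesis
      using norm_diff_scaleR_squared[of x 1 y] norm_add_squared[of x y]
      unfolding J_def f.scaleR f.add half real_scaleR_def scaleR_one by (simp add: field_simps)
  qed
  have "Cauchy X"
  proof (rule CauchyI)
    fix e :: real assume e: "0 < e"
    obtain N :: nat where "4 / e\<^sup>2 < real N" using reals_Archimedean2 by blast
    then have N: "4 < real N * e\<^sup>2" using e by (simp add: divide_less_eq)
    show "\<exists>M. \<forall>m\<ge>M. \<forall>n\<ge>M. norm (X m - X n) < e"
    proof (intro exI allI impI)
      fix m n assume mn: "N \<le> m" "N \<le> n"
      have N0: "0 < real N" using N e by (cases N) auto
      have "1 / real (Suc m) \<le> 1 / real N" "1 / real (Suc n) \<le> 1 / real N"
        using mn N0 by (auto intro!: divide_left_mono)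
      then have "(norm (X m - X n))\<^sup>2 < 4 * (1 / real N)"
        using par[of "X m" "X n"] X[of m] X[of n] I_le[of "(1/2) *\<^sub>R (X m + X n)"] by linarith
      also have "\<dots> < e\<^sup>2" using N N0 by (simp add: divide_less_eq mult.commute)
      finally show "norm (X m - X n) < e" using e by (auto intro: power_less_imp_less_base)
    qed
  qed
  then obtain z where z: "X \<longlonglongrightarrow> z" using Cauchy_convergent convergentD by blast
  have "(\<lambda>n. J (X n)) \<longlonglongrightarrow> J z"
    unfolding J_def by (intro tendsto_intros z f.tendsto)
  moreover have "(\<lambda>n. I + 1 / real (Suc n)) \<longlonglongrightarrow> I + 0"
    by (intro tendsto_intros LIMSEQ_Suc[OF lim_1_over_n])
  ultimately have Jz: "J z \<le> I"
    using LIMSEQ_le[of "\<lambda>n. J (X n)" "J z" "\<lambda>n. I + 1 / real (Suc n)" "I + 0"] X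
    by (auto intro: less_imp_le)
  have "f x = rinner x z" for x
  proof -
    define g where "g = rinner x z - f x"
    have *: "0 \<le> t\<^sup>2 * (norm x)\<^sup>2 + 2 * t * g" for t
    proof -
      have "J (z + t *\<^sub>R x) = J z + (t\<^sup>2 * (norm x)\<^sup>2 + 2 * t * g)"
        unfolding J_def norm_add_squared g_def f.add f.scaleR rinner_scaleR_right
        by (simp add: power_mult_distrib rinner_commute algebra_simps)
      then show ?thesis using I_le[of "z + t *\<^sub>R x"] Jz by linarith
    qed
    have "g = 0"
    proof (rule ccontr)
      assume g: "g \<noteq> 0"
      define c where "c = (norm x)\<^sup>2 + 1"
      have c: "0 < c" "(norm x)\<^sup>2 < c" by (auto simp: c_def add_nonneg_pos)
      have "(- g / c)\<^sup>2 * (norm x)\<^sup>2 < (- g / c)\<^sup>2 * c"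
        using c g by (intro mult_strict_left_mono) auto
      also have "\<dots> = g\<^sup>2 / c" using c by (simp add: power2_eq_square)
      finally have "(- g / c)\<^sup>2 * (norm x)\<^sup>2 + 2 * (- g / c) * g < g\<^sup>2 / c - 2 * (g\<^sup>2 / c)"
        by (simp add: power2_eq_square)
      also have "\<dots> \<le> 0" using c by simp
      finally show False using *[of "- g / c"] by linarith
    qed
    then show ?thesis by (simp add: g_def)
  qed
  then show ?thesis by blast
qed

text \<open>
  The Riesz representation applies to the real parts; complex linearity of \<open>a\<close> then gives
  the imaginary parts.
\<close>

lemma hilbert_adjoint_ex:
  fixes a :: "'a::complex_hilbert \<Rightarrow>\<^sub>L 'b::complex_hilbert"
  assumes "complex_linear a"
  shows "\<exists>b. \<forall>x y. cinner (blinfun_apply a x) y = cinner x (blinfun_apply b y)"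
proof -
  have "bounded_linear (\<lambda>x. rinner (blinfun_apply a x) y)" for y
    by (rule bounded_linear_compose[OF bounded_linear_rinner_left blinfun.bounded_linear_right])
  then have "\<exists>z. \<forall>x. rinner (blinfun_apply a x) y = rinner x z" for y
    by (rule riesz_representation)
  then obtain g where g: "\<And>x y. rinner (blinfun_apply a x) y = rinner x (g y)" by metis
  have "bounded_linear g"
  proof (rule bounded_linear_intro[where K="norm a"])
    show "g (x + y) = g x + g y" for x y
      by (rule rinner_eqI) (simp add: g[symmetric] rinner_add_right)
    show "g (r *\<^sub>R x) = r *\<^sub>R g x" for r x
      by (rule rinner_eqI) (simp add: g[symmetric] rinner_scaleR_right)
    show "norm (g y) \<le> norm y * norm a" for y
    proof -
      have "norm (g y) * norm (g y) = rinner (blinfun_apply a (g y)) y"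
        by (simp add: g rinner_self power2_eq_square)
      also have "\<dots> \<le> norm (blinfun_apply a (g y)) * norm y" by (rule rinner_le)
      also have "\<dots> \<le> (norm a * norm (g y)) * norm y"
        by (intro mult_right_mono norm_blinfun) auto
      finally have "norm (g y) * norm (g y) \<le> norm (g y) * (norm y * norm a)"
        by (simp add: ac_simps)
      then show ?thesis
        by (cases "norm (g y) = 0") (auto intro: mult_nonneg_nonneg)
    qed
  qed
  then have "blinfun_apply (Blinfun g) y = g y" for y
    by (simp add: bounded_linear_Blinfun_apply)
  moreover have "cinner (blinfun_apply a x) y = cinner x (g y)" for x y
    unfolding cinner_eq_rinner using assms by (simp add: complex_linear_def g[symmetric])
  ultimately show ?thesis by metis
qed

lemma cinner_eqI: "(\<And>x. cinner x u = cinner x v) \<Longrightarrow> u = v"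
  by (rule rinner_eqI) (simp add: rinner_def)

lemma cinner_hilbert_adjoint:
  assumes "complex_linear a"
  shows "cinner (blinfun_apply a x) y = cinner x (blinfun_apply (hilbert_adjoint a) y)"
proof -
  obtain b where b: "\<forall>x y. cinner (blinfun_apply a x) y = cinner x (blinfun_apply b y)"
    using hilbert_adjoint_ex[OF assms] by blast
  have "\<forall>x y. cinner (blinfun_apply a x) y = cinner x (blinfun_apply (hilbert_adjoint a) y)"
    unfolding hilbert_adjoint_def
  proof (rule theI)
    show "\<forall>x y. cinner (blinfun_apply a x) y = cinner x (blinfun_apply b y)" by fact
    fix c assume c: "\<forall>x y. cinner (blinfun_apply a x) y = cinner x (blinfun_apply c y)"
    have "cinner x (blinfun_apply c y) = cinner x (blinfun_apply b y)" for x y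
      by (rule trans[OF c[rule_format, symmetric] b[rule_format]])
    then show "c = b" by (rule blinfun_eqI[OF cinner_eqI])
  qed
  then show ?thesis by blast
qed

lemma complex_linear_hilbert_adjoint:
  "complex_linear a \<Longrightarrow> complex_linear (hilbert_adjoint a)"
  unfolding complex_linear_def[of "hilbert_adjoint a"]
  by (intro allI, rule cinner_eqI) (simp add: cinner_hilbert_adjoint[symmetric] cinner_scaleC_right)

lemma hilbert_adjoint_adjoint:
  assumes "complex_linear a" shows "hilbert_adjoint (hilbert_adjoint a) = a"
proof (rule blinfun_eqI[OF cinner_eqI])
  fix x y
  have "cinner y (blinfun_apply (hilbert_adjoint (hilbert_adjoint a)) x)
      = cnj (cinner x (blinfun_apply (hilbert_adjoint a) y))"
    by (metis cinner_commute cinner_hilbert_adjoint complex_linear_hilbert_adjoint assms)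
  then show "cinner y (blinfun_apply (hilbert_adjoint (hilbert_adjoint a)) x)
      = cinner y (blinfun_apply a x)"
    by (metis cinner_commute cinner_hilbert_adjoint assms)
qed

lemma norm_hilbert_adjoint_le:
  assumes "complex_linear a" shows "norm (hilbert_adjoint a) \<le> norm a"
proof (rule norm_blinfun_bound)
  fix y
  define z where "z = blinfun_apply (hilbert_adjoint a) y"
  have "norm z * norm z = rinner (blinfun_apply a z) y"
    using cinner_hilbert_adjoint[OF assms, of z y]
    by (simp add: z_def rinner_def cinner_self power2_eq_square)
  also have "\<dots> \<le> norm (blinfun_apply a z) * norm y" by (rule rinner_le)
  also have "\<dots> \<le> (norm a * norm z) * norm y"
    by (intro mult_right_mono norm_blinfun) auto
  finally have "norm z * norm z \<le> norm z * (norm a * norm y)"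
    by (simp add: ac_simps)
  then show "norm (blinfun_apply (hilbert_adjoint a) y) \<le> norm a * norm y"
    unfolding z_def[symmetric]
    by (cases "norm z = 0") (auto intro: mult_nonneg_nonneg)
qed simp

lemma norm_hilbert_adjoint:
  "complex_linear a \<Longrightarrow> norm (hilbert_adjoint a) = norm a"
  by (metis antisym complex_linear_hilbert_adjoint hilbert_adjoint_adjoint norm_hilbert_adjoint_le)

lemma operator_matrix_mat_star: "operator_matrix A \<Longrightarrow> operator_matrix (mat_star A)"
  by (simp add: operator_matrix_def mat_star_def complex_linear_hilbert_adjoint)

lemma mat_star_star: "operator_matrix A \<Longrightarrow> mat_star (mat_star A) = A"
  by (simp add: operator_matrix_def mat_star_def hilbert_adjoint_adjoint)

lemma norm_mat_star: "operator_matrix A \<Longrightarrow> norm (mat_star A m n) = norm (A n m)"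
  by (simp add: operator_matrix_def mat_star_def norm_hilbert_adjoint)


lemma esum_norm_apply_right_le:
  "(ESUM i. enorm (blinfun_apply T (y i))) \<le> enorm T * (ESUM i. enorm (y i))"
proof -
  have "(ESUM i. enorm (blinfun_apply T (y i))) \<le> (ESUM i. enorm T * enorm (y i))"
    by (intro nn_integral_mono) (simp add: ennreal_leI norm_blinfun flip: ennreal_mult)
  then show ?thesis by (simp add: nn_integral_cmult)
qed

lemma esum_norm_apply_left_le:
  "(ESUM i. enorm (blinfun_apply (T i) h)) \<le> (ESUM i. enorm (T i)) * enorm h"
proof -
  have "(ESUM i. enorm (blinfun_apply (T i) h)) \<le> (ESUM i. enorm (T i) * enorm h)"
    by (intro nn_integral_mono) (simp add: ennreal_leI norm_blinfun flip: ennreal_mult)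
  then show ?thesis by (simp add: nn_integral_multc)
qed

lemma complex_linear_infsum:
  assumes fin: "(ESUM i. enorm (T i)) < top" and "\<And>i. complex_linear (T i)"
  shows "complex_linear (\<Sum>\<^sub>\<infinity>i. T i)"
  unfolding complex_linear_def
proof (intro allI)
  fix c h
  have app: "blinfun_apply (\<Sum>\<^sub>\<infinity>i. T i) h = (\<Sum>\<^sub>\<infinity>i. blinfun_apply (T i) h)" for h
    by (rule infsum_bounded_linear_of_esum[OF fin blinfun.bounded_linear_left])
  have "(ESUM i. enorm (blinfun_apply (T i) h)) < top"
    by (rule le_less_trans[OF esum_norm_apply_left_le]) (use fin in \<open>simp add: ennreal_mult_less_top\<close>)
  from infsum_bounded_linear_of_esum[OF this bounded_linear_scaleC]
  show "blinfun_apply (\<Sum>\<^sub>\<infinity>i. T i) (c *\<^sub>C h) = c *\<^sub>C blinfun_apply (\<Sum>\<^sub>\<infinity>i. T i) h"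
    unfolding app using assms(2) by (simp add: complex_linear_def)
qed


section \<open>Matrices dominated along a slant\<close>

text \<open>
  All matrices below are controlled through a scalar sequence \<open>a\<close> and a map \<open>\<phi>\<close> of the index
  lattice: the entry at \<open>(m, n)\<close> has norm at most \<open>a (\<phi> m - n)\<close>.  For \<open>\<phi> m = \<lfloor>\<alpha> m\<rfloor>\<close> these are
  the \<open>\<alpha>\<close>-slanted matrices, and for \<open>\<phi> = id\<close> the convolution-dominated ones.  Almost everything
  uses only that the fibres of \<open>\<phi>\<close> are uniformly finite.
\<close>

definition dominated :: "('d::finite index \<Rightarrow> 'd index) \<Rightarrow> ('d index \<Rightarrow> ennreal) \<Rightarrow>
    ('a::complex_hilbert, 'b::complex_hilbert, 'd) op_matrix \<Rightarrow> bool"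
  where "dominated \<phi> a A \<longleftrightarrow> (\<forall>m n. enorm (A m n) \<le> a (\<phi> m - n))"

definition slanted :: "('d::finite index \<Rightarrow> 'd index) \<Rightarrow> real \<Rightarrow>
    ('a::complex_hilbert, 'b::complex_hilbert, 'd) op_matrix \<Rightarrow> bool"
  where "slanted \<phi> s A \<longleftrightarrow> operator_matrix A \<and>
    (\<exists>a. weighted_sum s a < top \<and> dominated \<phi> a A)"

definition fibres_le :: "nat \<Rightarrow> ('i \<Rightarrow> 'j) \<Rightarrow> bool"
  where "fibres_le K \<phi> \<longleftrightarrow> (\<forall>j. finite {i. \<phi> i = j} \<and> card {i. \<phi> i = j} \<le> K)"

lemma fibres_le_id: "fibres_le 1 id"
  by (simp add: fibres_le_def)

lemma esum_fibres:
  fixes \<phi> :: "'i::countable \<Rightarrow> 'j::countable"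
  shows "fibres_le K \<phi> \<Longrightarrow> (ESUM i. g (\<phi> i)) \<le> of_nat K * esum g"
  by (rule esum_fibres_le) (auto simp: fibres_le_def)

lemma dominatedD: "dominated \<phi> a A \<Longrightarrow> enorm (A m n) \<le> a (\<phi> m - n)"
  by (simp add: dominated_def)

lemma esum_le_esum_weight:
  "0 \<le> s \<Longrightarrow> esum a \<le> weighted_sum s a"
proof (intro nn_integral_mono)
  fix j assume "0 \<le> s"
  then have "a j * 1 \<le> a j * ennreal (poly_weight s j)"
    by (intro mult_left_mono) (auto simp: poly_weight_ge_1 ennreal_leI simp flip: ennreal_1)
  then show "a j \<le> a j * ennreal (poly_weight s j)" by simp
qed

lemma slantedE:
  assumes "slanted \<phi> s A" "0 \<le> s"
  obtains a where "weighted_sum s a < top" "esum a < top" "dominated \<phi> a A"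
  using assms esum_le_esum_weight[OF assms(2)] le_less_trans unfolding slanted_def by blast

lemma slantedI:
  "operator_matrix A \<Longrightarrow> weighted_sum s a < top \<Longrightarrow> dominated \<phi> a A
    \<Longrightarrow> slanted \<phi> s A"
  unfolding slanted_def by (intro conjI exI[of _ a])

lemma slanted_operator_matrix: "slanted \<phi> s A \<Longrightarrow> operator_matrix A"
  by (simp add: slanted_def)

lemma dominated_row:
  "dominated \<phi> a A \<Longrightarrow> (ESUM n. enorm (A m n)) \<le> esum a"
  using nn_integral_mono[of "count_space UNIV" "\<lambda>n. enorm (A m n)" "\<lambda>n. a (\<phi> m - n)"]
  by (simp add: dominatedD esum_reflect)

lemma dominated_norm: "dominated \<phi> a A \<Longrightarrow> enorm (A m n) \<le> esum a"
  using dominatedD esum_ge_term order_trans by metis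

subsection \<open>The action on bounded sequences\<close>

lemma esum_norm_apply_le:
  assumes "dominated \<phi> a A"
  shows "(ESUM n. enorm ((A m n) (x n)))
     \<le> (ESUM n. a (\<phi> m - n) * enorm (x n))"
proof (intro nn_integral_mono)
  fix n
  have "enorm ((A m n) (x n)) \<le> enorm (A m n) * enorm (x n)"
    by (simp add: ennreal_leI norm_blinfun flip: ennreal_mult)
  also have "\<dots> \<le> a (\<phi> m - n) * enorm (x n)"
    by (intro mult_right_mono dominatedD assms) auto
  finally show "enorm ((A m n) (x n)) \<le> a (\<phi> m - n) * enorm (x n)" .
qed

lemma norm_mat_op_le:
  assumes "dominated \<phi> a A"
  shows "enorm (mat_op A x m) \<le> (ESUM n. a (\<phi> m - n) * enorm (x n))"
  unfolding mat_op_def by (rule order_trans[OF norm_infsum_le_esum esum_norm_apply_le[OF assms]])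

lemma esum_reflect_bounded:
  fixes a :: "'i::ab_group_add \<Rightarrow> ennreal"
  assumes "\<And>n. \<xi> n \<le> X"
  shows "(ESUM n. a (c - n) * ennreal (\<xi> n)) \<le> esum a * ennreal X"
proof -
  have "(ESUM n. a (c - n) * ennreal (\<xi> n)) \<le> (ESUM n. a (c - n) * ennreal X)"
    by (intro nn_integral_mono mult_left_mono ennreal_leI assms) auto
  also have "\<dots> = (ESUM n. a (c - n)) * ennreal X" by (rule nn_integral_multc) auto
  finally show ?thesis by (simp add: esum_reflect)
qed

lemma bounded_rangeE:
  assumes "bounded (range x)"
  obtains X where "0 \<le> X" "\<And>n. norm (x n) \<le> X"
  using assms unfolding bounded_pos by (auto intro: less_imp_le)

lemma mat_op_esum_finite:
  assumes "dominated \<phi> a A" "esum a < top" "bounded (range x)"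
  shows "(ESUM n. enorm ((A m n) (x n))) < top"
proof -
  obtain X where "\<And>n. norm (x n) \<le> X" using bounded_rangeE[OF assms(3)] by blast
  then have "(ESUM n. enorm ((A m n) (x n))) \<le> esum a * ennreal X"
    by (intro order_trans[OF esum_norm_apply_le[OF assms(1)] esum_reflect_bounded])
  then show ?thesis
    by (rule le_less_trans) (use assms(2) in \<open>simp add: ennreal_mult_less_top\<close>)
qed

lemma bounded_mat_op:
  assumes "dominated \<phi> a A" "esum a < top" "bounded (range x)"
  shows "bounded (range (mat_op A x))"
proof -
  obtain X where X: "\<And>n. norm (x n) \<le> X" using bounded_rangeE[OF assms(3)] by blast
  have *: "enorm (mat_op A x m) \<le> esum a * ennreal X" for m
    by (rule order_trans[OF norm_mat_op_le[OF assms(1)] esum_reflect_bounded[OF X]])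
  have fin: "esum a * ennreal X < top" using assms(2) by (simp add: ennreal_mult_less_top)
  have "norm (mat_op A x m) \<le> enn2real (esum a * ennreal X)" for m
    using enn2real_mono[OF *[of m]] fin by simp
  then show ?thesis by (auto simp: bounded_iff)
qed

lemma mat_op_summable:
  assumes "dominated \<phi> a A" "esum a < top" "bounded (range x)"
  shows "(\<lambda>n. (A m n) (x n)) summable_on UNIV"
  by (rule summable_on_of_esum[OF mat_op_esum_finite[OF assms]])

lemma mat_op_add:
  assumes "dominated \<phi> a A" "esum a < top" "bounded (range x)" "bounded (range y)"
  shows "mat_op A (\<lambda>n. x n + y n) = (\<lambda>m. mat_op A x m + mat_op A y m)"
  unfolding mat_op_def
  by (simp add: blinfun.add_right infsum_add mat_op_summable[OF assms(1,2)] assms(3,4))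

lemma mat_op_scaleR:
  "mat_op A (\<lambda>n. r *\<^sub>R x n) = (\<lambda>m. r *\<^sub>R mat_op A x m)"
  unfolding mat_op_def by (simp add: blinfun.scaleR_right infsum_scaleR_right)

lemma bounded_range_scaleR:
  "bounded (range x) \<Longrightarrow> bounded (range (\<lambda>n. r *\<^sub>R x n :: 'a::real_normed_vector))"
  using bounded_scaling[of "range x" r] by (simp add: image_image)

lemma bounded_range_diff:
  "bounded (range x) \<Longrightarrow> bounded (range y) \<Longrightarrow> bounded (range (\<lambda>n. x n - y n :: 'a::real_normed_vector))"
  by (rule bounded_minus_comp)

lemma mat_op_diff:
  assumes "dominated \<phi> a A" "esum a < top" "bounded (range x)" "bounded (range y)"
  shows "mat_op A (\<lambda>n. x n - y n) = (\<lambda>m. mat_op A x m - mat_op A y m)"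
  using mat_op_add[OF assms(1,2,3) bounded_range_scaleR[OF assms(4), of "-1"]]
  by (simp add: mat_op_scaleR del: scaleR_minus_left) (simp add: mat_op_scaleR[of A "-1" y, simplified])

lemma mat_op_scaleC:
  assumes "dominated \<phi> a A" "esum a < top" "bounded (range x)" "operator_matrix A"
  shows "mat_op A (\<lambda>n. c *\<^sub>C x n) = (\<lambda>m. c *\<^sub>C mat_op A x m)"
proof
  fix m
  have "mat_op A (\<lambda>n. c *\<^sub>C x n) m = (\<Sum>\<^sub>\<infinity>n. c *\<^sub>C (A m n) (x n))"
    using assms(4) by (simp add: mat_op_def operator_matrix_def complex_linear_def)
  also have "\<dots> = c *\<^sub>C mat_op A x m"
    unfolding mat_op_def
    by (rule infsum_bounded_linear_of_esum[symmetric, OF mat_op_esum_finite[OF assms(1-3)] bounded_linear_scaleC])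
  finally show "mat_op A (\<lambda>n. c *\<^sub>C x n) m = c *\<^sub>C mat_op A x m" .
qed

subsection \<open>Products\<close>

definition mat_mult :: "('b::complex_hilbert, 'c::complex_hilbert, 'd::finite) op_matrix \<Rightarrow>
    ('a::complex_hilbert, 'b, 'd) op_matrix \<Rightarrow> ('a, 'c, 'd) op_matrix"
  where "mat_mult A B = (\<lambda>m n. \<Sum>\<^sub>\<infinity>k. A m k o\<^sub>L B k n)"

lemma esum_norm_compose_le:
  "(ESUM k. enorm (A m k o\<^sub>L B k n)) \<le> (ESUM k. enorm (A m k) * enorm (B k n))"
  by (intro nn_integral_mono) (simp add: ennreal_leI norm_blinfun_compose flip: ennreal_mult)

lemma norm_mat_mult_le:
  "enorm (mat_mult A B m n) \<le> (ESUM k. enorm (A m k) * enorm (B k n))"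
  unfolding mat_mult_def by (rule order_trans[OF norm_infsum_le_esum esum_norm_compose_le])

lemma esum_compose_finite:
  assumes "dominated \<phi> a A" "esum a < top" "dominated \<psi> b B" "esum b < top"
  shows "(ESUM k. enorm (A m k o\<^sub>L B k n)) < top"
proof -
  have "(ESUM k. enorm (A m k) * enorm (B k n))
      \<le> (ESUM k. enorm (A m k) * esum b)"
    by (intro nn_integral_mono mult_left_mono dominated_norm[OF assms(3)]) auto
  also have "\<dots> = (ESUM k. enorm (A m k)) * esum b"
    by (rule nn_integral_multc) auto
  also have "\<dots> \<le> esum a * esum b"
    by (intro mult_right_mono dominated_row[OF assms(1)]) auto
  also have "\<dots> < top" using assms(2,4) by (simp add: ennreal_mult_less_top)
  finally show ?thesis by (rule le_less_trans[OF esum_norm_compose_le])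
qed

lemma mat_mult_apply:
  assumes "dominated \<phi> a A" "esum a < top" "dominated \<psi> b B" "esum b < top"
  shows "(mat_mult A B m n) x = (\<Sum>\<^sub>\<infinity>k. (A m k) ((B k n) x))"
proof -
  have "bounded_linear (\<lambda>T. blinfun_apply T x)" by (rule blinfun.bounded_linear_left)
  from infsum_bounded_linear_of_esum[OF esum_compose_finite[OF assms] this]
  show ?thesis by (simp add: mat_mult_def)
qed

lemma operator_matrix_mat_mult:
  assumes "dominated \<phi> a A" "esum a < top" "dominated \<psi> b B" "esum b < top"
    "operator_matrix A" "operator_matrix B"
  shows "operator_matrix (mat_mult A B)"
proof -
  have "complex_linear (A m k o\<^sub>L B k n)" for m k n
    using assms(5,6) by (simp add: operator_matrix_def complex_linear_def)
  then show ?thesis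
    unfolding operator_matrix_def mat_mult_def
    by (intro allI complex_linear_infsum esum_compose_finite[OF assms(1-4)])
qed

lemma mat_op_mult:
  assumes "dominated \<phi> a A" "esum a < top" "dominated \<psi> b B" "esum b < top" "bounded (range x)"
  shows "mat_op (mat_mult A B) x = mat_op A (mat_op B x)"
proof
  fix m
  obtain X where X: "\<And>n. norm (x n) \<le> X" using bounded_rangeE[OF assms(5)] by blast
  have "(ESUM n. enorm ((A m k) ((B k n) (x n))))
      \<le> enorm (A m k) * (esum b * ennreal X)" for k
  proof -
    have "(ESUM n. enorm ((A m k) ((B k n) (x n))))
        \<le> enorm (A m k) * (ESUM n. enorm ((B k n) (x n)))"
      by (rule esum_norm_apply_right_le)
    also have "\<dots> \<le> enorm (A m k) * (esum b * ennreal X)"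
      using esum_norm_apply_le[OF assms(3), of k x] esum_reflect_bounded[of "\<lambda>n. norm (x n)" X b "\<psi> k", OF X]
      by (intro mult_left_mono) auto
    finally show ?thesis .
  qed
  then have "(ESUM k. (ESUM n. enorm ((A m k) ((B k n) (x n)))))
      \<le> (ESUM k. enorm (A m k) * (esum b * ennreal X))"
    by (intro nn_integral_mono)
  also have "\<dots> = (ESUM k. enorm (A m k)) * (esum b * ennreal X)"
    by (rule nn_integral_multc) auto
  also have "\<dots> \<le> esum a * (esum b * ennreal X)"
    by (intro mult_right_mono dominated_row[OF assms(1)]) auto
  also have "\<dots> < top" using assms(2,4) by (simp add: ennreal_mult_less_top)
  finally have fin: "(ESUM k. (ESUM n. enorm ((A m k) ((B k n) (x n))))) < top" .
  have "mat_op (mat_mult A B) x m = (\<Sum>\<^sub>\<infinity>n. \<Sum>\<^sub>\<infinity>k. (A m k) ((B k n) (x n)))"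
    unfolding mat_op_def mat_mult_apply[OF assms(1-4)] ..
  also have "\<dots> = (\<Sum>\<^sub>\<infinity>k. \<Sum>\<^sub>\<infinity>n. (A m k) ((B k n) (x n)))"
    by (rule infsum_swap_of_esum(1)[OF fin, symmetric])
  also have "\<dots> = (\<Sum>\<^sub>\<infinity>k. (A m k) (mat_op B x k))"
    unfolding mat_op_def
    by (intro infsum_cong infsum_bounded_linear_of_esum[symmetric] blinfun.bounded_linear_right
        mat_op_esum_finite[OF assms(3-5)])
  finally show "mat_op (mat_mult A B) x m = mat_op A (mat_op B x) m"
    by (simp add: mat_op_def)
qed

subsection \<open>Convolution of dominating sequences\<close>

definition conv :: "('i::ab_group_add \<Rightarrow> ennreal) \<Rightarrow> ('i \<Rightarrow> ennreal) \<Rightarrow> 'i \<Rightarrow> ennreal"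
  where "conv a b l = (ESUM i. a i * b (l - i))"

lemma esum_conv:
  fixes a b f :: "'i::{ab_group_add, countable} \<Rightarrow> ennreal"
  shows "(ESUM l. conv a b l * f l) = (ESUM i. (ESUM j. a i * b j * f (i + j)))"
proof -
  have "(ESUM l. conv a b l * f l) = (ESUM l. (ESUM i. a i * b (l - i) * f l))"
    unfolding conv_def by (intro nn_integral_cong nn_integral_multc[symmetric]) auto
  also have "\<dots> = (ESUM i. (ESUM l. a i * b (l - i) * f l))" by (rule esum_swap)
  also have "\<dots> = (ESUM i. (ESUM j. a i * b j * f (i + j)))"
    using esum_shift(1)[of "\<lambda>j. a i * b j * f (i + j)" i for i] by simp
  finally show ?thesis .
qed

lemma esum_product: "(ESUM i. (ESUM j. a i * b j)) = esum a * esum b"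
  by (simp add: nn_integral_cmult nn_integral_multc)

lemma esum_conv_weight_le:
  assumes "0 \<le> s"
  shows "weighted_sum s (conv a b)
    \<le> weighted_sum s a * weighted_sum s b"
proof -
  have "a i * b j * ennreal (poly_weight s (i + j))
      \<le> (a i * ennreal (poly_weight s i)) * (b j * ennreal (poly_weight s j))" for i j
  proof -
    have "a i * b j * ennreal (poly_weight s (i + j))
       \<le> a i * b j * (ennreal (poly_weight s i) * ennreal (poly_weight s j))"
      using poly_weight_submult[OF assms, of i j]
      by (intro mult_left_mono) (auto simp: ennreal_leI simp flip: ennreal_mult)
    then show ?thesis by (simp add: ac_simps)
  qed
  then have "weighted_sum s (conv a b) \<le>
     (ESUM i. (ESUM j. (a i * ennreal (poly_weight s i)) * (b j * ennreal (poly_weight s j))))"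
    unfolding esum_conv by (intro nn_integral_mono)
  then show ?thesis by (simp only: esum_product)
qed

lemma dominated_mult:
  assumes "dominated \<phi> a A" "dominated id b B"
  shows "dominated \<phi> (conv a b) (mat_mult A B)"
  unfolding dominated_def
proof (intro allI)
  fix m n
  have "enorm (mat_mult A B m n) \<le> (ESUM k. a (\<phi> m - k) * b (k - n))"
    using dominatedD[OF assms(1)] dominatedD[OF assms(2)]
    by (intro order_trans[OF norm_mat_mult_le] nn_integral_mono mult_mono) auto
  also have "\<dots> = conv a b (\<phi> m - n)"
    using esum_reflect[of "\<lambda>i. a i * b (\<phi> m - n - i)" "\<phi> m"] unfolding conv_def by (simp add: algebra_simps)
  finally show "enorm (mat_mult A B m n) \<le> conv a b (\<phi> m - n)" .
qed

lemma slanted_mult: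
  assumes "slanted \<phi> s A" "slanted id s B" "0 \<le> s"
  shows "slanted \<phi> s (mat_mult A B)"
proof -
  obtain a where a: "weighted_sum s a < top" "esum a < top" "dominated \<phi> a A"
    using slantedE[OF assms(1,3)] .
  obtain b where b: "weighted_sum s b < top" "esum b < top" "dominated id b B"
    using slantedE[OF assms(2,3)] .
  have "weighted_sum s (conv a b) < top"
    by (rule le_less_trans[OF esum_conv_weight_le[OF assms(3)]])
      (use a(1) b(1) in \<open>simp add: ennreal_mult_less_top\<close>)
  moreover have "operator_matrix (mat_mult A B)"
    by (intro operator_matrix_mat_mult[OF a(3,2) b(3,2)] slanted_operator_matrix[OF assms(1)]
        slanted_operator_matrix[OF assms(2)])
  ultimately show ?thesis
    by (intro slantedI[OF _ _ dominated_mult[OF a(3) b(3)]])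
qed

lemma slanted_add:
  assumes "slanted \<phi> s A" "slanted \<phi> s B"
  shows "slanted \<phi> s (\<lambda>m n. A m n + B m n)"
proof -
  obtain a where a: "weighted_sum s a < top" "dominated \<phi> a A"
    using assms(1) unfolding slanted_def by blast
  obtain b where b: "weighted_sum s b < top" "dominated \<phi> b B"
    using assms(2) unfolding slanted_def by blast
  have "(ESUM j. (a j + b j) * ennreal (poly_weight s j)) < top"
    using a(1) b(1) by (simp add: distrib_right nn_integral_add)
  moreover have "dominated \<phi> (\<lambda>j. a j + b j) (\<lambda>m n. A m n + B m n)"
    unfolding dominated_def
  proof (intro allI)
    fix m n
    have "enorm (A m n + B m n) \<le> enorm (A m n) + enorm (B m n)"
      by (simp add: ennreal_leI norm_triangle_ineq flip: ennreal_plus)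
    also have "\<dots> \<le> a (\<phi> m - n) + b (\<phi> m - n)"
      by (intro add_mono dominatedD a b)
    finally show "enorm (A m n + B m n) \<le> a (\<phi> m - n) + b (\<phi> m - n)" .
  qed
  moreover have "operator_matrix (\<lambda>m n. A m n + B m n)"
    using assms unfolding slanted_def operator_matrix_def complex_linear_def
    by (simp add: blinfun.add_left scaleC_add_right)
  ultimately show ?thesis by (intro slantedI)
qed

lemma slanted_scaleR:
  assumes "slanted \<phi> s A"
  shows "slanted \<phi> s (\<lambda>m n. r *\<^sub>R A m n)"
proof -
  obtain a where a: "weighted_sum s a < top" "dominated \<phi> a A"
    using assms(1) unfolding slanted_def by blast
  have "(ESUM j. (ennreal \<bar>r\<bar> * a j) * ennreal (poly_weight s j)) < top"
    using a(1) by (simp add: mult.assoc nn_integral_cmult ennreal_mult_less_top)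
  moreover have "dominated \<phi> (\<lambda>j. ennreal \<bar>r\<bar> * a j) (\<lambda>m n. r *\<^sub>R A m n)"
    unfolding dominated_def using dominatedD[OF a(2)]
    by (auto simp: ennreal_mult intro!: mult_left_mono)
  moreover have "operator_matrix (\<lambda>m n. r *\<^sub>R A m n)"
    using assms unfolding slanted_def operator_matrix_def complex_linear_def
    by (simp add: blinfun.scaleR_left scaleC_scaleR_commute)
  ultimately show ?thesis by (intro slantedI)
qed

definition mat_id :: "('a::complex_hilbert, 'a, 'd::finite) op_matrix"
  where "mat_id = (\<lambda>m n. if m = n then id_blinfun else 0)"

lemma mat_op_id: "mat_op mat_id x = x"
proof
  fix m
  have "mat_op mat_id x m = (\<Sum>\<^sub>\<infinity>n\<in>{m}. x n)"
    unfolding mat_op_def mat_id_def by (rule infsum_cong_neutral) auto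
  then show "mat_op mat_id x m = x m" by simp
qed

lemma dominated_id: "dominated id (indicator {0}) mat_id"
  unfolding dominated_def mat_id_def
  using norm_blinfun_id_le by (auto simp: indicator_def simp flip: ennreal_1 intro!: ennreal_leI)

lemma operator_matrix_id: "operator_matrix mat_id"
  by (simp add: operator_matrix_def complex_linear_def mat_id_def)

lemma esum_indicator_zero_weight:
  "(ESUM j. indicator {0} j * ennreal (poly_weight s j)) = 1"
proof -
  have "(ESUM j :: 'a index. indicator {0} j * ennreal (poly_weight s j))
      = (ESUM j :: 'a index. ennreal (poly_weight s j) * indicator {0} j)"
    by (simp add: mult.commute)
  then show ?thesis by (subst (asm) nn_integral_indicator_singleton) auto
qed

lemma slanted_id: "slanted id s mat_id"
  unfolding slanted_def using dominated_id operator_matrix_id esum_indicator_zero_weight[of s]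
  by (metis ennreal_one_less_top infinity_ennreal_def)

lemma mat_op_add_matrix:
  assumes "dominated \<phi> a A" "esum a < top" "dominated \<psi> b B" "esum b < top" "bounded (range x)"
  shows "mat_op (\<lambda>m n. A m n + B m n) x = (\<lambda>m. mat_op A x m + mat_op B x m)"
  unfolding mat_op_def
  by (simp add: blinfun.add_left infsum_add mat_op_summable[OF assms(1,2,5)] mat_op_summable[OF assms(3,4,5)])

lemma mat_op_scaleR_matrix: "mat_op (\<lambda>m n. r *\<^sub>R A m n) x = (\<lambda>m. r *\<^sub>R mat_op A x m)"
  unfolding mat_op_def by (simp add: blinfun.scaleR_left infsum_scaleR_right)

section \<open>Slanted matrices act on all sequence spaces\<close>

lemma enn2real_ge_1: "1 \<le> p \<Longrightarrow> p \<noteq> \<infinity> \<Longrightarrow> 1 \<le> enn2real p"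
  using enn2real_mono[of 1 p] by (simp add: top.not_eq_extremum)

lemma mem_lp_finite:
  assumes "p \<noteq> \<infinity>"
  shows "x \<in> lp p \<longleftrightarrow> (ESUM n. ennreal (norm (x n) powr enn2real p)) < top"
proof -
  have "x \<in> lp p \<longleftrightarrow> (\<lambda>n. norm (norm (x n) powr enn2real p)) summable_on UNIV"
    using assms by (simp add: lp_def)
  then show ?thesis unfolding abs_summable_iff_esum by simp
qed

lemma lp_norm_finite:
  assumes "p \<noteq> \<infinity>" "x \<in> lp p"
  shows "lp_norm p x = enn2real ((ESUM n. ennreal (norm (x n) powr enn2real p))) powr (1 / enn2real p)"
proof -
  have "(\<lambda>n. norm (x n) powr enn2real p) summable_on UNIV" using assms by (simp add: lp_def)
  then have "(ESUM n. ennreal (norm (x n) powr enn2real p))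
     = ennreal (\<Sum>\<^sub>\<infinity>n. norm (x n) powr enn2real p)"
    by (rule esum_ennreal) simp
  moreover have "0 \<le> (\<Sum>\<^sub>\<infinity>n. norm (x n) powr enn2real p)" by (rule infsum_nonneg) simp
  ultimately show ?thesis using assms(1) by (simp add: lp_norm_def)
qed

lemma mem_lp_infinity: "x \<in> lp \<infinity> \<longleftrightarrow> bounded (range x)"
  by (auto simp: lp_def bounded_iff bdd_above_def)

lemma lp_norm_infinity_le:
  "bounded (range x) \<Longrightarrow> norm (x n) \<le> lp_norm \<infinity> x"
  unfolding lp_norm_def by (auto simp: bounded_iff bdd_above_def intro!: cSUP_upper)

lemma lp_norm_infinity_least:
  "(\<And>n. norm (x n) \<le> c) \<Longrightarrow> lp_norm \<infinity> x \<le> c"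
  unfolding lp_norm_def by (auto intro!: cSUP_least)

lemma powr_inverse_powr: "0 < P \<Longrightarrow> 0 \<le> (x::real) \<Longrightarrow> (x powr P) powr (1 / P) = x"
  by (simp add: powr_powr)

lemma bounded_range_of_lp:
  assumes "1 \<le> p" "x \<in> lp p"
  shows "bounded (range x)"
proof (cases "p = \<infinity>")
  case True
  then show ?thesis using assms(2) mem_lp_infinity by blast
next
  case False
  define P where "P = enn2real p"
  define S where "S = (ESUM n. ennreal (norm (x n) powr P))"
  have P: "1 \<le> P" unfolding P_def by (rule enn2real_ge_1[OF assms(1) False])
  have S: "S < top" using assms(2) unfolding mem_lp_finite[OF False] by (simp add: S_def P_def)
  have "norm (x n) \<le> enn2real S powr (1 / P)" for n
  proof -
    have "ennreal (norm (x n) powr P) \<le> S" unfolding S_def by (rule esum_ge_term)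
    from enn2real_mono[OF this] have "norm (x n) powr P \<le> enn2real S" using S by simp
    then have "(norm (x n) powr P) powr (1 / P) \<le> enn2real S powr (1 / P)"
      using P by (intro powr_mono2) auto
    then show ?thesis using P by (simp add: powr_inverse_powr)
  qed
  then show ?thesis by (auto simp: bounded_iff)
qed

lemma young_powr:
  fixes P v \<xi> :: real
  assumes "1 \<le> P" "0 < v" "0 \<le> \<xi>"
  shows "P * v powr (P - 1) * \<xi> \<le> \<xi> powr P + (P - 1) * v powr P"
proof (cases "P = 1")
  case True
  then show ?thesis using assms by (simp add: powr_one)
next
  case False
  then have P: "1 < P" using assms by simp
  have "\<xi> * v powr (P - 1) \<le> \<xi> powr P / P + (v powr (P - 1)) powr (P / (P - 1)) / (P / (P - 1))"
    using P assms by (intro Youngs_inequality) (auto simp: field_simps)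
  also have "(v powr (P - 1)) powr (P / (P - 1)) = v powr P"
    using P by (simp add: powr_powr)
  finally have "P * (\<xi> * v powr (P - 1)) \<le> P * (\<xi> powr P / P + v powr P / (P / (P - 1)))"
    using P by (intro mult_left_mono) auto
  also have "\<dots> = \<xi> powr P + (P - 1) * v powr P" using P by (simp add: field_simps)
  finally show ?thesis by (simp add: ac_simps)
qed

text \<open>
  Jensen's inequality for the average of \<open>\<xi>\<close> with weights \<open>a n\<close> of total mass at most \<open>\<sigma>\<close>.  It follows by
  summing Young's inequality between \<open>\<xi> n\<close> and \<open>v = \<eta> / \<sigma>\<close>, the tangent inequality of the convex
  function \<open>\<lambda>x. x powr P\<close> at \<open>v\<close>.
\<close>

lemma jensen_powr:
  fixes a :: "'i \<Rightarrow> ennreal"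
  assumes "esum a \<le> ennreal \<sigma>" "0 < \<sigma>" "1 \<le> P" "0 \<le> \<eta>" "\<And>n. 0 \<le> \<xi> n"
    and le: "ennreal \<eta> \<le> (ESUM n. a n * ennreal (\<xi> n))"
  shows "ennreal (\<eta> powr P) \<le> ennreal (\<sigma> powr (P - 1)) * (ESUM n. a n * ennreal (\<xi> n powr P))"
proof (cases "\<eta> = 0")
  case False
  define v where "v = \<eta> / \<sigma>"
  have v: "0 < v" "\<eta> = \<sigma> * v" using assms False by (auto simp: v_def)
  define Q where "Q = (ESUM n. a n * ennreal (\<xi> n powr P))"
  show ?thesis
  proof (cases "Q = \<infinity>")
    case True
    then show ?thesis using assms(2) unfolding Q_def[symmetric] by (simp add: ennreal_mult_top)
  next
    case False
    define q where "q = enn2real Q"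
    have q: "Q = ennreal q" "0 \<le> q" using False by (simp_all add: q_def top.not_eq_extremum)
    define c where "c = P * v powr (P - 1)"
    have c: "0 \<le> c" using assms by (simp add: c_def)
    have v1: "v * v powr (P - 1) = v powr P"
      using v(1) by (simp add: powr_mult_base)
    have "ennreal (c * \<eta>) \<le> ennreal c * (ESUM n. a n * ennreal (\<xi> n))"
      using le c assms(4) by (simp add: ennreal_mult mult_left_mono)
    also have "\<dots> = (ESUM n. a n * ennreal (c * \<xi> n))"
      using c assms(5) by (subst nn_integral_cmult[symmetric])
        (auto simp: ennreal_mult ac_simps intro!: nn_integral_cong)
    also have "\<dots> \<le> (ESUM n. a n * ennreal (\<xi> n powr P) + a n * ennreal ((P - 1) * v powr P))"
    proof (intro nn_integral_mono)
      fix n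
      have "ennreal (c * \<xi> n) \<le> ennreal (\<xi> n powr P + (P - 1) * v powr P)"
        unfolding c_def by (intro ennreal_leI young_powr assms v)
      also have "\<dots> = ennreal (\<xi> n powr P) + ennreal ((P - 1) * v powr P)"
        using assms(3) by (intro ennreal_plus) auto
      finally show "a n * ennreal (c * \<xi> n) \<le> a n * ennreal (\<xi> n powr P) + a n * ennreal ((P - 1) * v powr P)"
        unfolding distrib_left[symmetric] by (rule mult_left_mono) simp
    qed
    also have "\<dots> = Q + esum a * ennreal ((P - 1) * v powr P)"
      unfolding Q_def by (subst nn_integral_add) (auto simp: nn_integral_multc)
    also have "\<dots> \<le> ennreal q + ennreal \<sigma> * ennreal ((P - 1) * v powr P)"
      unfolding q by (intro add_mono mult_right_mono assms) auto
    also have "\<dots> = ennreal (q + \<sigma> * ((P - 1) * v powr P))"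
      using q assms(2,3) by (simp add: ennreal_mult)
    finally have "c * \<eta> \<le> q + \<sigma> * ((P - 1) * v powr P)"
      using q assms(2,3) by (subst (asm) ennreal_le_iff) auto
    moreover have "c * \<eta> = \<sigma> * (P * v powr P)"
      unfolding c_def v(2) v1[symmetric] by (simp add: ac_simps)
    ultimately have "\<sigma> * v powr P \<le> q" by (simp add: algebra_simps)
    then have "\<sigma> powr (P - 1) * (\<sigma> * v powr P) \<le> \<sigma> powr (P - 1) * q"
      by (intro mult_left_mono) auto
    moreover have "\<sigma> powr (P - 1) * (\<sigma> * v powr P) = \<eta> powr P"
    proof -
      have "\<sigma> * \<sigma> powr (P - 1) = \<sigma> powr P" using assms(2) by (simp add: powr_mult_base)
      then show ?thesis unfolding v(2) using assms(2) v(1) by (simp add: powr_mult mult.commute)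
    qed
    ultimately have "ennreal (\<eta> powr P) \<le> ennreal (\<sigma> powr (P - 1) * q)" by (intro ennreal_leI) simp
    then show ?thesis unfolding Q_def[symmetric] q using q(2) by (simp add: ennreal_mult)
  qed
qed simp

text \<open>
  Schur's test: Jensen's inequality in each row, followed by an exchange of the sums.  The rows of
  the kernel \<open>a (\<phi> m - n)\<close> have mass at most \<open>\<sigma>\<close>, and its columns at most \<open>K \<sigma>\<close> because each value of \<open>\<phi>\<close>
  is taken at most \<open>K\<close> times.
\<close>

lemma schur_powr:
  fixes \<phi> :: "'d::finite index \<Rightarrow> 'd index" and a :: "'d index \<Rightarrow> ennreal"
  assumes "fibres_le K \<phi>" "esum a \<le> ennreal \<sigma>" "0 < \<sigma>" "1 \<le> P"
    "\<And>m. 0 \<le> \<eta> m" "\<And>n. 0 \<le> \<xi> n"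
    and le: "\<And>m. ennreal (\<eta> m) \<le> (ESUM n. a (\<phi> m - n) * ennreal (\<xi> n))"
  shows "(ESUM m. ennreal (\<eta> m powr P)) \<le> ennreal (K * \<sigma> powr P) * (ESUM n. ennreal (\<xi> n powr P))"
proof -
  have "(ESUM m. ennreal (\<eta> m powr P))
      \<le> (ESUM m. ennreal (\<sigma> powr (P - 1)) * (ESUM n. a (\<phi> m - n) * ennreal (\<xi> n powr P)))"
    by (intro nn_integral_mono jensen_powr assms) (simp add: esum_reflect assms)
  also have "\<dots> = ennreal (\<sigma> powr (P - 1)) * (ESUM m. (ESUM n. a (\<phi> m - n) * ennreal (\<xi> n powr P)))"
    by (rule nn_integral_cmult) auto
  also have "(ESUM m. (ESUM n. a (\<phi> m - n) * ennreal (\<xi> n powr P)))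
      = (ESUM n. (ESUM m. a (\<phi> m - n) * ennreal (\<xi> n powr P)))" by (rule esum_swap)
  also have "\<dots> = (ESUM n. (ESUM m. a (\<phi> m - n)) * ennreal (\<xi> n powr P))"
    by (intro nn_integral_cong nn_integral_multc) auto
  also have "\<dots> \<le> (ESUM n. (of_nat K * ennreal \<sigma>) * ennreal (\<xi> n powr P))"
  proof (intro nn_integral_mono mult_right_mono)
    fix n
    have "(ESUM m. a (\<phi> m - n)) \<le> of_nat K * (ESUM j. a (j - n))"
      using esum_fibres[OF assms(1), of "\<lambda>j. a (j - n)"] .
    also have "\<dots> \<le> of_nat K * ennreal \<sigma>" unfolding esum_shift by (intro mult_left_mono assms) auto
    finally show "(ESUM m. a (\<phi> m - n)) \<le> of_nat K * ennreal \<sigma>" .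
  qed auto
  also have "\<dots> = (of_nat K * ennreal \<sigma>) * (ESUM n. ennreal (\<xi> n powr P))"
    by (rule nn_integral_cmult) auto
  finally have *: "(ESUM m. ennreal (\<eta> m powr P))
      \<le> ennreal (\<sigma> powr (P - 1)) * ((of_nat K * ennreal \<sigma>) * (ESUM n. ennreal (\<xi> n powr P)))"
    by (simp add: mult_left_mono)
  have "\<sigma> * \<sigma> powr (P - 1) = \<sigma> powr P" using assms(3) by (simp add: powr_mult_base)
  then have "ennreal (K * \<sigma> powr P) = ennreal (\<sigma> powr (P - 1)) * (of_nat K * ennreal \<sigma>)"
    using assms(3) by (simp add: ennreal_of_nat_eq_real_of_nat flip: ennreal_mult) (simp add: ac_simps)
  with * show ?thesis by (simp add: ac_simps)
qed

lemma real_bound_of_finite: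
  assumes "e < (top::ennreal)" obtains \<sigma> where "0 < \<sigma>" "e \<le> ennreal \<sigma>"
proof
  show "0 < enn2real e + 1" by (simp add: add_nonneg_pos)
  have "e = ennreal (enn2real e)" using assms by simp
  also have "\<dots> \<le> ennreal (enn2real e + 1)" by (rule ennreal_leI) simp
  finally show "e \<le> ennreal (enn2real e + 1)" .
qed

lemma mat_op_powr_le:
  assumes "fibres_le K \<phi>" "dominated \<phi> a A" "esum a \<le> ennreal \<sigma>" "0 < \<sigma>" "1 \<le> P"
  shows "(ESUM m. ennreal (norm (mat_op A x m) powr P))
     \<le> ennreal (K * \<sigma> powr P) * (ESUM n. ennreal (norm (x n) powr P))"
  using assms(1,3-5) by (rule schur_powr) (auto intro: norm_mat_op_le[OF assms(2)])

lemma lp_mat_op: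
  fixes A :: "('a::complex_hilbert, 'b::complex_hilbert, 'd::finite) op_matrix"
  assumes "fibres_le K \<phi>" "dominated \<phi> a A" "esum a < top" "1 \<le> p"
  shows "x \<in> lp p \<Longrightarrow> mat_op A x \<in> lp p"
    and "\<exists>C. \<forall>x\<in>lp p. lp_norm p (mat_op A x) \<le> C * lp_norm p x"
proof -
  obtain \<sigma> where \<sigma>: "0 < \<sigma>" "esum a \<le> ennreal \<sigma>" using real_bound_of_finite[OF assms(3)] .
  have "(x \<in> lp p \<longrightarrow> mat_op A x \<in> lp p) \<and>
    (\<exists>C. \<forall>x\<in>lp p. lp_norm p (mat_op A x) \<le> C * lp_norm p x)"
  proof (cases "p = \<infinity>")
    case True
    have "norm (mat_op A x m) \<le> \<sigma> * lp_norm \<infinity> x" if "bounded (range x)" for x m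
    proof -
      have nn: "0 \<le> lp_norm \<infinity> x" by (rule order_trans[OF norm_ge_zero lp_norm_infinity_le[OF that, of undefined]])
      have "enorm (mat_op A x m) \<le> esum a * ennreal (lp_norm \<infinity> x)"
        by (rule order_trans[OF norm_mat_op_le[OF assms(2)] esum_reflect_bounded[OF lp_norm_infinity_le[OF that]]])
      also have "\<dots> \<le> ennreal \<sigma> * ennreal (lp_norm \<infinity> x)" by (intro mult_right_mono \<sigma>) auto
      also have "\<dots> = ennreal (\<sigma> * lp_norm \<infinity> x)" using \<sigma> nn by (simp add: ennreal_mult)
      finally show ?thesis using \<sigma> nn by (subst (asm) ennreal_le_iff) auto
    qed
    then have "lp_norm \<infinity> (mat_op A x) \<le> \<sigma> * lp_norm \<infinity> x" if "bounded (range x)" for x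
      using that by (intro lp_norm_infinity_least) blast
    then show ?thesis
      unfolding True mem_lp_infinity by (intro conjI impI bounded_mat_op[OF assms(2,3)] exI[of _ \<sigma>] ballI) (auto simp: mem_lp_infinity[unfolded infinity_ennreal_def])
  next
    case False
    define P where "P = enn2real p"
    have P: "1 \<le> P" unfolding P_def by (rule enn2real_ge_1[OF assms(4) False])
    define c where "c = K * \<sigma> powr P"
    have c: "0 \<le> c" by (simp add: c_def)
    have *: "(ESUM m. ennreal (norm (mat_op A x m) powr P))
       \<le> ennreal c * (ESUM n. ennreal (norm (x n) powr P))" for x
      unfolding c_def by (rule mat_op_powr_le[OF assms(1,2) \<sigma>(2,1) P])
    have mem: "mat_op A x \<in> lp p" if "x \<in> lp p" for x
    proof -
      have "(ESUM n. ennreal (norm (x n) powr P)) < top"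
        using that unfolding mem_lp_finite[OF False] P_def .
      then have "ennreal c * (ESUM n. ennreal (norm (x n) powr P)) < top"
        by (simp add: ennreal_mult_less_top)
      with * have "(ESUM m. ennreal (norm (mat_op A x m) powr P)) < top" by (rule le_less_trans)
      then show ?thesis unfolding mem_lp_finite[OF False] P_def .
    qed
    have "lp_norm p (mat_op A x) \<le> c powr (1 / P) * lp_norm p x" if x: "x \<in> lp p" for x
    proof -
      have fin: "(ESUM n. ennreal (norm (x n) powr P)) < top"
        using x unfolding mem_lp_finite[OF False] P_def .
      have "enn2real ((ESUM m. ennreal (norm (mat_op A x m) powr P)))
          \<le> enn2real (ennreal c * (ESUM n. ennreal (norm (x n) powr P)))"
        using * by (rule enn2real_mono) (use fin in \<open>simp add: ennreal_mult_less_top\<close>)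
      also have "\<dots> = c * enn2real ((ESUM n. ennreal (norm (x n) powr P)))"
        using c by (simp add: enn2real_mult)
      finally have "enn2real ((ESUM m. ennreal (norm (mat_op A x m) powr P))) powr (1 / P)
          \<le> (c * enn2real ((ESUM n. ennreal (norm (x n) powr P)))) powr (1 / P)"
        using P by (intro powr_mono2) auto
      then show ?thesis
        unfolding lp_norm_finite[OF False mem[OF x]] lp_norm_finite[OF False x] P_def[symmetric]
        using c by (simp add: powr_mult)
    qed
    then show ?thesis using mem by blast
  qed
  then show "x \<in> lp p \<Longrightarrow> mat_op A x \<in> lp p"
    and "\<exists>C. \<forall>x\<in>lp p. lp_norm p (mat_op A x) \<le> C * lp_norm p x" by auto
qed

lemma lp_operator_mat_op:
  assumes "fibres_le K \<phi>" "dominated \<phi> a A" "esum a < top" "operator_matrix A" "1 \<le> p"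
  shows "lp_operator p (mat_op A)"
  unfolding lp_operator_def
  using lp_mat_op[OF assms(1-3,5)] bounded_range_of_lp[OF assms(5)]
    mat_op_add[OF assms(2,3)] mat_op_scaleC[OF assms(2,3) _ assms(4)]
  by blast

lemma lp_norm_nonneg: "1 \<le> p \<Longrightarrow> x \<in> lp p \<Longrightarrow> 0 \<le> lp_norm p x"
proof (cases "p = \<infinity>")
  case True
  assume "x \<in> lp p"
  then show ?thesis
    unfolding True mem_lp_infinity
    by (intro order_trans[OF norm_ge_zero lp_norm_infinity_le[of x undefined]])
qed (simp add: lp_norm_def)

lemma lp_operator_compose:
  assumes T: "lp_operator p T" and S: "lp_operator p S" and p: "1 \<le> p"
  shows "lp_operator p (S \<circ> T)"
proof -
  obtain C where C: "\<And>x. x \<in> lp p \<Longrightarrow> lp_norm p (T x) \<le> C * lp_norm p x"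
    using T unfolding lp_operator_def by blast
  obtain D where D: "\<And>x. x \<in> lp p \<Longrightarrow> lp_norm p (S x) \<le> D * lp_norm p x"
    using S unfolding lp_operator_def by blast
  have Tm: "\<And>x. x \<in> lp p \<Longrightarrow> T x \<in> lp p" using T unfolding lp_operator_def by blast
  have "lp_norm p (S (T x)) \<le> (\<bar>D\<bar> * C) * lp_norm p x" if x: "x \<in> lp p" for x
  proof -
    have "lp_norm p (S (T x)) \<le> D * lp_norm p (T x)" by (rule D[OF Tm[OF x]])
    also have "\<dots> \<le> \<bar>D\<bar> * lp_norm p (T x)" by (intro mult_right_mono lp_norm_nonneg[OF p] Tm x) auto
    also have "\<dots> \<le> \<bar>D\<bar> * (C * lp_norm p x)" by (intro mult_left_mono C x) auto
    finally show ?thesis by simp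
  qed
  then have "\<exists>E. \<forall>x\<in>lp p. lp_norm p (S (T x)) \<le> E * lp_norm p x" by blast
  then show ?thesis
    using T S unfolding lp_operator_def comp_def by simp
qed

section \<open>Stability of the lower bound\<close>

text \<open>Convexity in \<open>u\<close>: the left-hand side lies below its chord between \<open>u = 0\<close> and \<open>u = 1\<close>.\<close>

lemma power_interpolate:
  fixes u h :: real
  assumes "0 \<le> u" "u \<le> 1" "0 \<le> h"
  shows "(1 + u * h) ^ t \<le> 1 + u * ((1 + h) ^ t - 1)"
proof (induction t)
  case (Suc t)
  define E where "E = (1 + h) ^ t"
  have E: "1 \<le> E" using assms(3) by (simp add: E_def)
  have "(1 + u * h) ^ Suc t \<le> (1 + u * h) * (1 + u * (E - 1))"
    using Suc assms by (simp add: E_def mult_left_mono)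
  also have "\<dots> = 1 + u * (E - 1) + u * h + u * (u * (h * (E - 1)))"
    by (simp add: algebra_simps)
  also have "\<dots> \<le> 1 + u * (E - 1) + u * h + 1 * (u * (h * (E - 1)))"
    using assms E by (intro add_left_mono mult_right_mono) auto
  also have "\<dots> = 1 + u * ((1 + h) ^ Suc t - 1)"
    by (simp add: E_def[symmetric] algebra_simps)
  finally show ?case .
qed simp

text \<open>
  Translation by \<open>j\<close> changes \<open>1 + \<bar>i\<bar> / R\<close> by at most the factor \<open>Z = 1 + \<bar>j\<bar> / R\<close>, in either direction.  Since
  \<open>Z ^ t - 1\<close> is of order \<open>1 / R\<close>, the squared decay function varies slowly when \<open>R\<close> is large, at the
  price of a polynomial weight in \<open>j\<close>.
\<close>

lemma decay_translate:
  fixes i j :: "'d::finite index"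
  assumes "1 \<le> R"
  shows "\<bar>(decay R i)\<^sup>2 - (decay R (i + j))\<^sup>2\<bar>
    \<le> (decay R i)\<^sup>2 * (1 / R * poly_weight (2 * (real CARD('d) + 1)) j)"
proof -
  define t where "t = 2 * (CARD('d) + 1)"
  define X Y Z where "X = 1 + real_of_int (sup_abs i) / R" and "Y = 1 + real_of_int (sup_abs (i + j)) / R"
    and "Z = 1 + real_of_int (sup_abs j) / R"
  have XYZ: "1 \<le> X" "1 \<le> Y" "1 \<le> Z" using assms by (auto simp: X_def Y_def Z_def)
  have sq: "(decay R i)\<^sup>2 = 1 / X ^ t" "(decay R (i + j))\<^sup>2 = 1 / Y ^ t"
    by (simp_all only: decay_def X_def Y_def t_def power_divide power_one mult.commute[of 2] power_mult)
  have tri: "1 + real_of_int a / R \<le> (1 + real_of_int b / R) * (1 + real_of_int c / R)"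
    if "a \<le> b + c" "0 \<le> b" "0 \<le> c" for a b c
  proof -
    have "real_of_int a \<le> real_of_int b + real_of_int c" using that(1) by linarith
    then have "real_of_int a / R \<le> (real_of_int b + real_of_int c) / R"
      using assms by (intro divide_right_mono) auto
    moreover have "0 \<le> real_of_int b / R * (real_of_int c / R)" using assms that by simp
    ultimately show ?thesis by (simp only: ring_distribs mult_1 mult_1_right add_divide_distrib)
  qed
  have "Y \<le> X * Z" unfolding X_def Y_def Z_def by (rule tri) (auto intro: sup_abs_triangle)
  then have YX: "Y ^ t \<le> X ^ t * Z ^ t" using XYZ by (simp add: power_mono flip: power_mult_distrib)
  have "sup_abs i \<le> sup_abs (i + j) + sup_abs j" using sup_abs_triangle_diff[of "i + j" j] by simp
  then have "X \<le> Y * Z" unfolding X_def Y_def Z_def by (rule tri) auto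
  then have XY: "X ^ t \<le> Y ^ t * Z ^ t" using XYZ by (simp add: power_mono flip: power_mult_distrib)
  have pos: "0 < X ^ t" "0 < Y ^ t" "1 \<le> Z ^ t" using XYZ by auto
  have up: "1 / Y ^ t \<le> 1 / X ^ t * Z ^ t" using XY pos by (simp add: field_simps)
  have lo: "1 / X ^ t * (1 / Z ^ t) \<le> 1 / Y ^ t" using YX pos by (simp add: field_simps)
  have "2 - Z ^ t \<le> 1 / Z ^ t"
  proof -
    have "0 \<le> (Z ^ t - 1)\<^sup>2" by simp
    then have "(2 - Z ^ t) * Z ^ t \<le> 1" by (simp add: power2_eq_square algebra_simps)
    then show ?thesis using pos by (subst pos_le_divide_eq) auto
  qed
  then have "1 / X ^ t * (2 - Z ^ t) \<le> 1 / X ^ t * (1 / Z ^ t)" using pos by (intro mult_left_mono) auto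
  with lo have "1 / X ^ t * (2 - Z ^ t) \<le> 1 / Y ^ t" by linarith
  then have "\<bar>1 / X ^ t - 1 / Y ^ t\<bar> \<le> 1 / X ^ t * (Z ^ t - 1)"
    using up by (simp only: right_diff_distrib mult_1_right abs_le_iff) linarith
  also have "\<dots> \<le> 1 / X ^ t * (1 / R * (1 + real_of_int (sup_abs j)) ^ t)"
  proof (rule mult_left_mono)
    have "Z ^ t - 1 \<le> 1 / R * ((1 + real_of_int (sup_abs j)) ^ t - 1)"
      using power_interpolate[of "1 / R" "real_of_int (sup_abs j)" t] assms by (simp add: Z_def)
    also have "\<dots> \<le> 1 / R * (1 + real_of_int (sup_abs j)) ^ t" using assms by (intro mult_left_mono) auto
    finally show "Z ^ t - 1 \<le> 1 / R * (1 + real_of_int (sup_abs j)) ^ t" .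
  qed (use pos in auto)
  also have "(1 + real_of_int (sup_abs j)) ^ t = poly_weight (2 * (real CARD('d) + 1)) j"
  proof -
    have "0 < 1 + real_of_int (sup_abs j)" by (simp add: add_pos_nonneg)
    then have "(1 + real_of_int (sup_abs j)) ^ t = (1 + real_of_int (sup_abs j)) powr real t"
      by (rule powr_realpow[symmetric])
    then show ?thesis by (simp add: poly_weight_def t_def algebra_simps)
  qed
  finally show ?thesis by (simp add: sq)
qed

text \<open>
  The commutator of \<open>B\<close> with the weight centred at \<open>u\<close> multiplies the entry at \<open>(m, n)\<close> by the difference of
  the weights at \<open>n - u\<close> and \<open>\<phi> m - u\<close>.  These points differ by \<open>\<phi> m - n\<close>, the argument of the dominating
  sequence, so that the polynomial loss of the translation estimate is paid for by the decay of \<open>b\<close>.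
\<close>

lemma commutator_bound:
  fixes B :: "('a::complex_hilbert, 'b::complex_hilbert, 'd::finite) op_matrix"
  assumes "dominated \<phi> b B" "esum b < top" "bounded (range x)" "1 \<le> R"
  shows "enorm (mat_op B (\<lambda>n. (decay R (n - u))\<^sup>2 *\<^sub>R x n) m - (decay R (\<phi> m - u))\<^sup>2 *\<^sub>R mat_op B x m)
    \<le> (ESUM n. (ennreal (1 / R) * (b (\<phi> m - n) * ennreal (poly_weight (2 * (real CARD('d) + 1)) (\<phi> m - n))))
          * enorm ((decay R (n - u))\<^sup>2 *\<^sub>R x n))"
proof -
  define w where "w = (\<lambda>l::'d index. (decay R l)\<^sup>2)"
  have w0: "0 \<le> w l" for l by (simp add: w_def)
  obtain X where X: "0 \<le> X" "\<And>n. norm (x n) \<le> X" using bounded_rangeE[OF assms(3)] by blast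
  have w1: "w l \<le> 1" for l
    using decay_pos[of R l] decay_le_1[of R l] assms(4) by (simp add: w_def power_le_one)
  have bw: "bounded (range (\<lambda>n. w (n - u) *\<^sub>R x n))"
    unfolding bounded_iff
  proof (intro exI[of _ X] ballI, elim imageE, simp)
    fix n
    have "w (n - u) * norm (x n) \<le> 1 * X" using w1 w0 X by (intro mult_mono) auto
    then show "\<bar>w (n - u)\<bar> * norm (x n) \<le> X" using w0[of "n - u"] by simp
  qed
  have "mat_op B (\<lambda>n. w (n - u) *\<^sub>R x n) m - w (\<phi> m - u) *\<^sub>R mat_op B x m
      = (\<Sum>\<^sub>\<infinity>n. (B m n) (w (n - u) *\<^sub>R x n)) - (\<Sum>\<^sub>\<infinity>n. w (\<phi> m - u) *\<^sub>R (B m n) (x n))"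
    by (simp add: mat_op_def infsum_scaleR_right)
  also have "\<dots> = (\<Sum>\<^sub>\<infinity>n. (B m n) (w (n - u) *\<^sub>R x n) + - (w (\<phi> m - u) *\<^sub>R (B m n) (x n)))"
  proof -
    have "(\<lambda>n. (B m n) (w (n - u) *\<^sub>R x n)) summable_on UNIV"
      by (rule mat_op_summable[OF assms(1,2) bw])
    moreover have "(\<lambda>n. - (w (\<phi> m - u) *\<^sub>R (B m n) (x n))) summable_on UNIV"
      by (intro summable_on_uminus[THEN iffD2] summable_on_scaleR_right mat_op_summable[OF assms(1-3)])
    ultimately show ?thesis by (subst infsum_add) (auto simp: infsum_uminus)
  qed
  also have "\<dots> = (\<Sum>\<^sub>\<infinity>n. (w (n - u) - w (\<phi> m - u)) *\<^sub>R (B m n) (x n))"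
    by (intro infsum_cong) (simp add: blinfun.scaleR_right scaleR_diff_left)
  finally have eq: "mat_op B (\<lambda>n. w (n - u) *\<^sub>R x n) m - w (\<phi> m - u) *\<^sub>R mat_op B x m
      = (\<Sum>\<^sub>\<infinity>n. (w (n - u) - w (\<phi> m - u)) *\<^sub>R (B m n) (x n))" .
  have "enorm (mat_op B (\<lambda>n. w (n - u) *\<^sub>R x n) m - w (\<phi> m - u) *\<^sub>R mat_op B x m)
    \<le> (ESUM n. enorm ((w (n - u) - w (\<phi> m - u)) *\<^sub>R (B m n) (x n)))"
    unfolding eq by (rule norm_infsum_le_esum)
  also have "\<dots> \<le> (ESUM n. (ennreal (1 / R) * (b (\<phi> m - n) * ennreal (poly_weight (2 * (real CARD('d) + 1)) (\<phi> m - n))))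
          * enorm (w (n - u) *\<^sub>R x n))"
  proof (intro nn_integral_mono)
    fix n
    define W where "W = poly_weight (2 * (real CARD('d) + 1)) (\<phi> m - n)"
    have W: "0 \<le> W" by (simp add: W_def)
    have "\<bar>w (n - u) - w (\<phi> m - u)\<bar> \<le> w (n - u) * (1 / R * W)"
      using decay_translate[OF assms(4), of "n - u" "\<phi> m - n"] by (simp add: w_def W_def)
    then have "norm ((w (n - u) - w (\<phi> m - u)) *\<^sub>R (B m n) (x n))
       \<le> (w (n - u) * (1 / R * W)) * (norm (B m n) * norm (x n))"
      unfolding norm_scaleR by (intro mult_mono norm_blinfun) (auto simp: w0 W assms(4) intro!: mult_nonneg_nonneg)
    also have "\<dots> = (1 / R * (norm (B m n) * W)) * norm (w (n - u) *\<^sub>R x n)"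
      using w0[of "n - u"] by simp
    finally have "enorm ((w (n - u) - w (\<phi> m - u)) *\<^sub>R (B m n) (x n))
       \<le> ennreal ((1 / R * (norm (B m n) * W)) * norm (w (n - u) *\<^sub>R x n))" by (rule ennreal_leI)
    also have "\<dots> = (ennreal (1 / R) * (enorm (B m n) * ennreal W)) * enorm (w (n - u) *\<^sub>R x n)"
    proof -
      have "ennreal (p * (q * r) * t) = ennreal p * (ennreal q * ennreal r) * ennreal t"
        if "0 \<le> p" "0 \<le> q" "0 \<le> r" "0 \<le> t" for p q r t
        using that by (simp add: ennreal_mult)
      from this[of "1 / R" "norm (B m n)" W] show ?thesis using W assms(4) by simp
    qed
    also have "\<dots> \<le> (ennreal (1 / R) * (b (\<phi> m - n) * ennreal W)) * enorm (w (n - u) *\<^sub>R x n)"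
      by (intro mult_left_mono mult_right_mono dominatedD[OF assms(1)]) auto
    finally show "enorm ((w (n - u) - w (\<phi> m - u)) *\<^sub>R (B m n) (x n))
      \<le> (ennreal (1 / R) * (b (\<phi> m - n) * ennreal (poly_weight (2 * (real CARD('d) + 1)) (\<phi> m - n))))
          * enorm (w (n - u) *\<^sub>R x n)" by (simp only: W_def)
  qed
  finally show ?thesis by (simp only: w_def)
qed

lemma bounded_below_powr:
  assumes "p \<noteq> \<infinity>" "1 \<le> p" "0 < \<kappa>" "x \<in> lp p" "mat_op B x \<in> lp p"
    and le: "\<kappa> * lp_norm p x \<le> lp_norm p (mat_op B x)"
  shows "ennreal (\<kappa> powr enn2real p) * (ESUM n. ennreal (norm (x n) powr enn2real p))
    \<le> (ESUM m. ennreal (norm (mat_op B x m) powr enn2real p))"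
proof -
  define P where "P = enn2real p"
  have P: "1 \<le> P" unfolding P_def by (rule enn2real_ge_1[OF assms(2,1)])
  define S where "S = (ESUM n. ennreal (norm (x n) powr P))"
  define T where "T = (ESUM m. ennreal (norm (mat_op B x m) powr P))"
  have fin: "S < top" "T < top"
    using assms(4,5) unfolding mem_lp_finite[OF assms(1)] by (auto simp: S_def T_def P_def)
  have "\<kappa> * enn2real S powr (1 / P) \<le> enn2real T powr (1 / P)"
    using le unfolding lp_norm_finite[OF assms(1,4)] lp_norm_finite[OF assms(1,5)]
    by (simp add: S_def T_def P_def)
  then have "(\<kappa> * enn2real S powr (1 / P)) powr P \<le> (enn2real T powr (1 / P)) powr P"
    using P assms(3) by (intro powr_mono2) auto
  then have "\<kappa> powr P * enn2real S \<le> enn2real T"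
    using P assms(3) by (simp add: powr_mult powr_powr)
  then have "ennreal (\<kappa> powr P * enn2real S) \<le> ennreal (enn2real T)" by (rule ennreal_leI)
  then show ?thesis
    using fin by (simp add: ennreal_mult S_def[symmetric] T_def[symmetric] P_def[symmetric])
qed

lemma powr_add_le:
  fixes a b P :: real
  assumes "0 \<le> a" "0 \<le> b" "0 \<le> P"
  shows "(a + b) powr P \<le> 2 powr P * (a powr P + b powr P)"
proof -
  have *: "(a + b) powr P \<le> 2 powr P * a powr P" if "b \<le> a" "0 \<le> b" for a b :: real
  proof -
    have "(a + b) powr P \<le> (2 * a) powr P" using that assms(3) by (intro powr_mono2) auto
    then show ?thesis using that by (simp add: powr_mult)
  qed
  have p: "0 \<le> 2 powr P * a powr P" "0 \<le> 2 powr P * b powr P" by auto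
  show ?thesis
  proof (cases "b \<le> a")
    case True
    show ?thesis using *[OF True assms(2)] p(2) unfolding distrib_left by linarith
  next
    case False
    then have "(b + a) powr P \<le> 2 powr P * b powr P" by (intro * assms) simp
    then show ?thesis using p(1) unfolding distrib_left add.commute[of a b] by linarith
  qed
qed

text \<open>
  A lower bound on one space \<open>\<ell>\<^sup>p\<close> holds uniformly for all sequences localised by the
  squared decay function at large scale \<open>R\<close>, since the commutator is small compared with the bound.
  Evaluating at the centre \<open>u\<close> yields a pointwise estimate that no longer mentions \<open>p\<close>.  One of
  the two factors of the squared weight is spent on summing over the lattice, the other remains in the estimate.
\<close>

lemma bounded_below_pointwise:
  fixes B :: "('a::complex_hilbert, 'b::complex_hilbert, 'd::finite) op_matrix"
  assumes fib: "fibres_le K \<phi>" and "1 \<le> K" and dom: "dominated \<phi> b B"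
    and bw: "weighted_sum (2 * (real CARD('d) + 1)) b < top"
    and p: "1 \<le> p" and below: "bounded_below p B"
  shows "\<exists>R\<ge>1. \<exists>C\<ge>0. \<forall>x u Y. bounded (range x) \<longrightarrow>
    (\<forall>m. decay R (\<phi> m - u) * norm (mat_op B x m) \<le> Y) \<longrightarrow> norm (x u) \<le> C * Y"
proof -
  obtain \<kappa> where \<kappa>: "0 < \<kappa>" "\<And>x. x \<in> lp p \<Longrightarrow> \<kappa> * lp_norm p x \<le> lp_norm p (mat_op B x)"
    using below unfolding bounded_below_def by blast
  define W where "W = (\<lambda>j::'d index. poly_weight (2 * (real CARD('d) + 1)) j)"
  obtain \<sigma> where \<sigma>: "0 < \<sigma>" "(ESUM j. b j * ennreal (W j)) \<le> ennreal \<sigma>"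
    using real_bound_of_finite[OF bw] unfolding W_def .
  have b_fin: "esum b < top"
    by (rule le_less_trans[OF esum_le_esum_weight bw]) simp
  \<comment> \<open>With this scale the commutator can be absorbed for all exponents \<open>P \<ge> 1\<close> simultaneously:
    \<open>K (2 \<sigma> / R) ^ P \<le> \<kappa> ^ P / 2\<close>.\<close>
  define R where "R = max 1 (4 * real K * \<sigma> / \<kappa>)"
  have R: "1 \<le> R" "4 * real K * \<sigma> / \<kappa> \<le> R" by (auto simp: R_def)
  define \<tau> where "\<tau> = \<sigma> / R"
  have \<tau>: "0 < \<tau>" using \<sigma> R by (simp add: \<tau>_def)
  have "4 * real K * \<sigma> \<le> R * \<kappa>" using R(2) \<kappa>(1) by (simp add: divide_le_eq)
  then have K\<tau>: "2 * \<tau> * (2 * real K) \<le> \<kappa>" using R(1) by (simp add: \<tau>_def divide_le_eq ac_simps)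
  define c where "c = (\<lambda>j. ennreal (1 / R) * (b j * ennreal (W j)))"
  have c: "esum c \<le> ennreal \<tau>"
  proof -
    have "esum c = ennreal (1 / R) * (ESUM j. b j * ennreal (W j))"
      unfolding c_def by (rule nn_integral_cmult) auto
    also have "\<dots> \<le> ennreal (1 / R) * ennreal \<sigma>" by (intro mult_left_mono \<sigma>) auto
    also have "\<dots> = ennreal \<tau>" using \<sigma> R by (simp add: \<tau>_def flip: ennreal_mult)
    finally show ?thesis .
  qed
  define w where "w = (\<lambda>l::'d index. (decay R l)\<^sup>2)"
  have v: "0 < decay R l" "decay R l \<le> 1" for l :: "'d index"
    using decay_pos[of R l] decay_le_1[of R l] R by auto
  have w: "0 < w l" "w l \<le> decay R l" for l
    using v[of l] by (auto simp: w_def power2_eq_square mult_le_cancel_left2)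
  have bounded_loc: "bounded (range (\<lambda>n. w (n - u) *\<^sub>R x n))" if bx: "bounded (range x)" for x :: "'d index \<Rightarrow> 'a" and u
  proof -
    obtain X where X: "0 \<le> X" "\<And>n. norm (x n) \<le> X" using bounded_rangeE[OF bx] by blast
    have "w (n - u) * norm (x n) \<le> 1 * X" for n
      using w[of "n - u"] v[of "n - u"] X by (intro mult_mono) auto
    then show ?thesis using w by (auto simp: bounded_iff abs_of_pos intro!: exI[of _ X])
  qed
  have apply_loc: "\<exists>\<eta>. (\<forall>m. 0 \<le> \<eta> m) \<and>
      (\<forall>m. norm (mat_op B (\<lambda>n. w (n - u) *\<^sub>R x n) m) \<le> decay R (\<phi> m - u) * Y + \<eta> m) \<and>
      (\<forall>m. ennreal (\<eta> m) \<le> (ESUM n. c (\<phi> m - n) * enorm (w (n - u) *\<^sub>R x n)))"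
    if x: "bounded (range x)" and Y: "\<And>m. decay R (\<phi> m - u) * norm (mat_op B x m) \<le> Y" for x u Y
  proof (intro exI[of _ "\<lambda>m. norm (mat_op B (\<lambda>n. w (n - u) *\<^sub>R x n) m - w (\<phi> m - u) *\<^sub>R mat_op B x m)"] conjI allI)
    fix m
    have "norm (mat_op B (\<lambda>n. w (n - u) *\<^sub>R x n) m)
       \<le> norm (w (\<phi> m - u) *\<^sub>R mat_op B x m)
         + norm (mat_op B (\<lambda>n. w (n - u) *\<^sub>R x n) m - w (\<phi> m - u) *\<^sub>R mat_op B x m)"
      by (rule norm_triangle_sub)
    moreover have "norm (w (\<phi> m - u) *\<^sub>R mat_op B x m) = decay R (\<phi> m - u) * (decay R (\<phi> m - u) * norm (mat_op B x m))"
      by (simp add: w_def power2_eq_square abs_mult)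
    moreover have "\<dots> \<le> decay R (\<phi> m - u) * Y"
      using v by (intro mult_left_mono Y) (auto simp: less_imp_le)
    ultimately show "norm (mat_op B (\<lambda>n. w (n - u) *\<^sub>R x n) m) \<le> decay R (\<phi> m - u) * Y
        + norm (mat_op B (\<lambda>n. w (n - u) *\<^sub>R x n) m - w (\<phi> m - u) *\<^sub>R mat_op B x m)" by linarith
    show "enorm (mat_op B (\<lambda>n. w (n - u) *\<^sub>R x n) m - w (\<phi> m - u) *\<^sub>R mat_op B x m)
       \<le> (ESUM n. c (\<phi> m - n) * enorm (w (n - u) *\<^sub>R x n))"
      unfolding c_def w_def W_def by (rule commutator_bound[OF dom b_fin x R(1)])
  qed simp
  have "\<exists>C\<ge>0. \<forall>x u Y. bounded (range x) \<longrightarrow>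
    (\<forall>m. decay R (\<phi> m - u) * norm (mat_op B x m) \<le> Y) \<longrightarrow> norm (x u) \<le> C * Y"
  proof (cases "p = \<infinity>")
    case True
    have "norm (x u) \<le> (2 / \<kappa>) * Y"
      if x: "bounded (range x)" and Y: "\<And>m. decay R (\<phi> m - u) * norm (mat_op B x m) \<le> Y" for x u Y
    proof -
      define z where "z = (\<lambda>n. w (n - u) *\<^sub>R x n)"
      have z: "bounded (range z)" unfolding z_def by (rule bounded_loc[OF x])
      obtain \<eta> where \<eta>: "\<And>m. 0 \<le> \<eta> m" "\<And>m. norm (mat_op B z m) \<le> decay R (\<phi> m - u) * Y + \<eta> m"
        "\<And>m. ennreal (\<eta> m) \<le> (ESUM n. c (\<phi> m - n) * enorm (z n))"
        using apply_loc[OF x Y] unfolding z_def by blast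
      define S where "S = lp_norm \<infinity> z"
      have S: "norm (z n) \<le> S" for n unfolding S_def by (rule lp_norm_infinity_le[OF z])
      have S0: "0 \<le> S" by (rule order_trans[OF norm_ge_zero S[of undefined]])
      have Y0: "0 \<le> Y" by (rule order_trans[OF _ Y[of undefined]]) (simp add: v less_imp_le)
      have "norm (mat_op B z m) \<le> Y + \<tau> * S" for m
      proof -
        have "ennreal (\<eta> m) \<le> esum c * ennreal S"
          by (rule order_trans[OF \<eta>(3) esum_reflect_bounded[OF S]])
        also have "\<dots> \<le> ennreal \<tau> * ennreal S" by (intro mult_right_mono c) auto
        also have "\<dots> = ennreal (\<tau> * S)" using \<tau> S0 by (simp add: ennreal_mult)
        finally have "\<eta> m \<le> \<tau> * S" using \<tau> S0 by (subst (asm) ennreal_le_iff) auto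
        moreover have "decay R (\<phi> m - u) * Y \<le> 1 * Y" using v Y0 by (intro mult_right_mono)
        ultimately show ?thesis using \<eta>(2)[of m] by simp
      qed
      then have "lp_norm \<infinity> (mat_op B z) \<le> Y + \<tau> * S" by (rule lp_norm_infinity_least)
      moreover have "\<kappa> * S \<le> lp_norm \<infinity> (mat_op B z)"
        using \<kappa>(2)[of z] z unfolding S_def True mem_lp_infinity by blast
      moreover have "\<tau> * S \<le> \<kappa> / 2 * S"
      proof (rule mult_right_mono[OF _ S0])
        have "2 * \<tau> * 1 \<le> 2 * \<tau> * (2 * real K)" using \<tau> \<open>1 \<le> K\<close> by (intro mult_left_mono) auto
        then show "\<tau> \<le> \<kappa> / 2" using K\<tau> by linarith
      qed
      ultimately have "\<kappa> / 2 * S \<le> Y" by (simp add: field_simps)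
      then have "S \<le> (2 / \<kappa>) * Y" using \<kappa>(1) by (simp add: field_simps)
      moreover have "norm (x u) \<le> S" using S[of u] by (simp add: z_def w_def)
      ultimately show ?thesis by linarith
    qed
    then show ?thesis using \<kappa>(1) by (intro exI[of _ "2 / \<kappa>"]) auto
  next
    case False
    define P where "P = enn2real p"
    have P: "1 \<le> P" unfolding P_def by (rule enn2real_ge_1[OF p False])
    obtain V where V: "0 < V" "(ESUM l::'d index. ennreal (decay R l)) \<le> ennreal V"
      using real_bound_of_finite[OF esum_decay_finite[OF R(1)]] .
    define D where "D = 2 * (2 powr P * (real K * V)) / \<kappa> powr P"
    have D: "0 \<le> D" using V by (simp add: D_def)
    have small: "real K * (2 * \<tau>) powr P \<le> \<kappa> powr P / 2"
    proof -
      have "2 * \<tau> \<le> \<kappa> * (1 / (2 * real K))" using K\<tau> \<open>1 \<le> K\<close> by (simp add: field_simps)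
      then have "(2 * \<tau>) powr P \<le> (\<kappa> * (1 / (2 * real K))) powr P"
        using \<tau> P by (intro powr_mono2) auto
      also have "\<dots> = \<kappa> powr P * (1 / (2 * real K)) powr P" using \<kappa>(1) by (simp only: powr_mult)
      also have "\<dots> \<le> \<kappa> powr P * (1 / (2 * real K)) powr 1"
        using \<open>1 \<le> K\<close> P by (intro mult_left_mono powr_mono') auto
      finally have "real K * (2 * \<tau>) powr P \<le> real K * (\<kappa> powr P * (1 / (2 * real K)))"
        using \<open>1 \<le> K\<close> by (intro mult_left_mono) auto
      also have "\<dots> = \<kappa> powr P / 2" using \<open>1 \<le> K\<close> by simp
      finally show ?thesis .
    qed
    have "norm (x u) \<le> D powr (1 / P) * Y"
      if x: "bounded (range x)" and Y: "\<And>m. decay R (\<phi> m - u) * norm (mat_op B x m) \<le> Y" for x u Y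
    proof -
      define z where "z = (\<lambda>n. w (n - u) *\<^sub>R x n)"
      have z: "bounded (range z)" unfolding z_def by (rule bounded_loc[OF x])
      obtain \<eta> where \<eta>: "\<And>m. 0 \<le> \<eta> m" "\<And>m. norm (mat_op B z m) \<le> decay R (\<phi> m - u) * Y + \<eta> m"
        "\<And>m. ennreal (\<eta> m) \<le> (ESUM n. c (\<phi> m - n) * enorm (z n))"
        using apply_loc[OF x Y] unfolding z_def by blast
      have Y0: "0 \<le> Y" by (rule order_trans[OF _ Y[of undefined]]) (simp add: v less_imp_le)
      obtain X where X: "0 \<le> X" "\<And>n. norm (x n) \<le> X" using bounded_rangeE[OF x] by blast
      define e where "e = (ESUM n. ennreal (norm (z n) powr P))"
      have decay_powr: "(decay R l * t) powr P \<le> decay R l * t powr P" if "0 \<le> t" for l :: "'d index" and t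
      proof -
        have "(decay R l * t) powr P = decay R l powr P * t powr P"
          using v[of l] that by (simp add: powr_mult)
        also have "\<dots> \<le> decay R l powr 1 * t powr P"
          using v[of l] P by (intro mult_right_mono powr_mono') auto
        finally show ?thesis using v[of l] by simp
      qed
      have "e \<le> (ESUM n. ennreal (decay R (n - u)) * ennreal (X powr P))"
        unfolding e_def
      proof (intro nn_integral_mono)
        fix n
        have "norm (z n) \<le> decay R (n - u) * X"
          unfolding z_def using w[of "n - u"] X v[of "n - u"] by (auto intro!: mult_mono)
        then have "norm (z n) powr P \<le> (decay R (n - u) * X) powr P" using P by (intro powr_mono2) auto
        also have "\<dots> \<le> decay R (n - u) * X powr P" by (rule decay_powr[OF X(1)])
        finally show "ennreal (norm (z n) powr P) \<le> ennreal (decay R (n - u)) * ennreal (X powr P)"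
          using v[of "n - u"] by (simp add: ennreal_leI flip: ennreal_mult)
      qed
      also have "\<dots> = (ESUM n. ennreal (decay R (n - u))) * ennreal (X powr P)" by (rule nn_integral_multc) auto
      also have "\<dots> = (ESUM n::'d index. ennreal (decay R n)) * ennreal (X powr P)"
        by (subst esum_shift) simp
      also have "\<dots> < top" using esum_decay_finite[OF R(1), where 'd='d] by (simp add: ennreal_mult_less_top)
      finally have e_fin: "e < top" .
      then have zp: "z \<in> lp p" unfolding mem_lp_finite[OF False] e_def P_def .
      have Bzp: "mat_op B z \<in> lp p" by (rule lp_mat_op(1)[OF fib dom b_fin p zp])
      have "ennreal (\<kappa> powr P) * e \<le> (ESUM m. ennreal (norm (mat_op B z m) powr P))"
        unfolding e_def P_def by (rule bounded_below_powr[OF False p \<kappa>(1) zp Bzp \<kappa>(2)[OF zp]])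
      also have "\<dots> \<le> (ESUM m. ennreal (2 powr P) * (ennreal (decay R (\<phi> m - u)) * ennreal (Y powr P) + ennreal (\<eta> m powr P)))"
      proof (intro nn_integral_mono)
        fix m
        have "norm (mat_op B z m) powr P \<le> (decay R (\<phi> m - u) * Y + \<eta> m) powr P"
          using P by (intro powr_mono2 \<eta>) auto
        also have "\<dots> \<le> 2 powr P * ((decay R (\<phi> m - u) * Y) powr P + \<eta> m powr P)"
          using v[of "\<phi> m - u"] Y0 \<eta>(1) P by (intro powr_add_le) auto
        also have "\<dots> \<le> 2 powr P * (decay R (\<phi> m - u) * Y powr P + \<eta> m powr P)"
          by (intro mult_left_mono add_right_mono decay_powr Y0) auto
        finally show "ennreal (norm (mat_op B z m) powr P)
           \<le> ennreal (2 powr P) * (ennreal (decay R (\<phi> m - u)) * ennreal (Y powr P) + ennreal (\<eta> m powr P))"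
          using v[of "\<phi> m - u"] by (simp add: ennreal_leI flip: ennreal_mult ennreal_plus)
      qed
      also have "\<dots> = ennreal (2 powr P) * ((ESUM m. ennreal (decay R (\<phi> m - u))) * ennreal (Y powr P)
          + (ESUM m. ennreal (\<eta> m powr P)))"
        by (simp add: nn_integral_cmult nn_integral_add nn_integral_multc)
      also have "\<dots> \<le> ennreal (2 powr P) * ((of_nat K * ennreal V) * ennreal (Y powr P)
          + ennreal (K * \<tau> powr P) * e)"
      proof (intro mult_left_mono add_mono mult_right_mono)
        have "(ESUM m. ennreal (decay R (\<phi> m - u))) \<le> of_nat K * (ESUM j. ennreal (decay R (j - u)))"
          using esum_fibres[OF fib, of "\<lambda>j. ennreal (decay R (j - u))"] .
        also have "\<dots> = of_nat K * (ESUM j::'d index. ennreal (decay R j))"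
          using esum_shift(1)[of "\<lambda>j. ennreal (decay R j)" u] by simp
        also have "\<dots> \<le> of_nat K * ennreal V" by (intro mult_left_mono V) auto
        finally show "(ESUM m. ennreal (decay R (\<phi> m - u))) \<le> of_nat K * ennreal V" .
        show "(ESUM m. ennreal (\<eta> m powr P)) \<le> ennreal (K * \<tau> powr P) * e"
          unfolding e_def using \<eta>(3) by (intro schur_powr[OF fib c \<tau> P \<eta>(1)]) auto
      qed auto
      also have "e = ennreal (enn2real e)" using e_fin by simp
      finally have "ennreal (\<kappa> powr P * enn2real e)
        \<le> ennreal (2 powr P * ((K * V) * Y powr P + K * \<tau> powr P * enn2real e))"
        using V by (simp add: ennreal_of_nat_eq_real_of_nat flip: ennreal_mult ennreal_plus)
      then have "\<kappa> powr P * enn2real e \<le> 2 powr P * ((K * V) * Y powr P + K * \<tau> powr P * enn2real e)"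
        using V by (subst (asm) ennreal_le_iff) auto
      also have "\<dots> = 2 powr P * (K * V) * Y powr P + (K * (2 * \<tau>) powr P) * enn2real e"
        using \<tau> by (simp add: powr_mult algebra_simps)
      also have "\<dots> \<le> 2 powr P * (K * V) * Y powr P + (\<kappa> powr P / 2) * enn2real e"
        by (intro add_left_mono mult_right_mono small) auto
      finally have "\<kappa> powr P / 2 * enn2real e \<le> 2 powr P * (K * V) * Y powr P" by simp
      then have e_le: "enn2real e \<le> D * Y powr P"
        using \<kappa>(1) by (simp add: D_def field_simps)
      have "ennreal (norm (z u) powr P) \<le> e" unfolding e_def by (rule esum_ge_term)
      from enn2real_mono[OF this] have "norm (z u) powr P \<le> enn2real e" using e_fin by simp
      with e_le have "norm (x u) powr P \<le> D * Y powr P" by (simp add: z_def w_def)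
      then have "(norm (x u) powr P) powr (1 / P) \<le> (D * Y powr P) powr (1 / P)"
        using P by (intro powr_mono2) auto
      also have "\<dots> = D powr (1 / P) * Y" using D Y0 P by (simp add: powr_mult powr_inverse_powr)
      finally show ?thesis using P by (simp add: powr_inverse_powr)
    qed
    then show ?thesis by (intro exI[of _ "D powr (1 / P)"]) auto
  qed
  then show ?thesis using R(1) by blast
qed

abbreviation energy :: "('d::finite index \<Rightarrow> 'a::real_normed_vector) \<Rightarrow> ennreal"
  where "energy x \<equiv> (ESUM n. ennreal ((norm (x n))\<^sup>2))"

text \<open>
  The localised supremum in the pointwise estimate is at most the square root of a weighted sum of
  squares; squaring and summing over the centre \<open>u\<close> then costs only the sum of the weights.
\<close>

lemma bounded_below_energy:
  fixes B :: "('a::complex_hilbert, 'b::complex_hilbert, 'd::finite) op_matrix"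
  assumes "fibres_le K \<phi>" "1 \<le> K" "dominated \<phi> b B"
    "weighted_sum (2 * (real CARD('d) + 1)) b < top"
    "1 \<le> p" "bounded_below p B"
  shows "\<exists>c>0. \<forall>x. bounded (range x) \<longrightarrow> energy x \<le> ennreal c * energy (mat_op B x)"
proof -
  obtain R C where R: "1 \<le> R" and C: "0 \<le> C"
    and le: "\<And>x u Y. bounded (range x) \<Longrightarrow> (\<And>m. decay R (\<phi> m - u) * norm (mat_op B x m) \<le> Y) \<Longrightarrow> norm (x u) \<le> C * Y"
    using bounded_below_pointwise[OF assms] by blast
  obtain V where V: "0 < V" "(ESUM l::'d index. ennreal (decay R l)) \<le> ennreal V"
    using real_bound_of_finite[OF esum_decay_finite[OF R]] .
  have v: "0 < decay R l" "decay R l \<le> 1" for l :: "'d index"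
    using decay_pos[of R l] decay_le_1[of R l] R by auto
  \<comment> \<open>The summand \<open>1\<close> keeps the constant positive, so that the product is infinite when
    \<open>B x\<close> has infinite energy.\<close>
  have "energy x \<le> ennreal (C\<^sup>2 * V + 1) * energy (mat_op B x)" if x: "bounded (range x)" for x
  proof (cases "energy (mat_op B x) = \<infinity>")
    case True
    have "0 < C\<^sup>2 * V + 1" using V by (simp add: add_nonneg_pos)
    then show ?thesis unfolding True by (simp add: ennreal_mult_top)
  next
    case False
    define Z where "Z = (\<lambda>u. (ESUM m. ennreal ((decay R (\<phi> m - u) * norm (mat_op B x m))\<^sup>2)))"
    have Z_fin: "Z u < top" for u
    proof -
      have "Z u \<le> energy (mat_op B x)"
        unfolding Z_def
      proof (intro nn_integral_mono ennreal_leI power_mono)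
        show "decay R (\<phi> m - u) * norm (mat_op B x m) \<le> norm (mat_op B x m)" for m
          using v[of "\<phi> m - u"] by (simp add: mult_left_le_one_le)
        show "0 \<le> decay R (\<phi> m - u) * norm (mat_op B x m)" for m
          using v(1)[of "\<phi> m - u"] by simp
      qed
      then show ?thesis using False by (simp add: top.not_eq_extremum le_less_trans)
    qed
    have "ennreal ((norm (x u))\<^sup>2) \<le> ennreal (C\<^sup>2) * Z u" for u
    proof -
      define Y where "Y = sqrt (enn2real (Z u))"
      have "decay R (\<phi> m - u) * norm (mat_op B x m) \<le> Y" for m
      proof -
        have "ennreal ((decay R (\<phi> m - u) * norm (mat_op B x m))\<^sup>2) \<le> Z u"
          unfolding Z_def by (rule esum_ge_term)
        from enn2real_mono[OF this] have "(decay R (\<phi> m - u) * norm (mat_op B x m))\<^sup>2 \<le> enn2real (Z u)"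
          using Z_fin[of u] by simp
        then show ?thesis unfolding Y_def by (rule real_le_rsqrt)
      qed
      then have "norm (x u) \<le> C * Y" by (rule le[OF x])
      then have "(norm (x u))\<^sup>2 \<le> (C * Y)\<^sup>2" by (intro power_mono) auto
      also have "\<dots> = C\<^sup>2 * enn2real (Z u)" by (simp add: Y_def power_mult_distrib)
      finally have "ennreal ((norm (x u))\<^sup>2) \<le> ennreal (C\<^sup>2) * ennreal (enn2real (Z u))"
        by (simp add: ennreal_leI flip: ennreal_mult)
      then show ?thesis using Z_fin[of u] by simp
    qed
    then have "energy x \<le> (ESUM u. ennreal (C\<^sup>2) * Z u)" by (intro nn_integral_mono)
    also have "\<dots> = ennreal (C\<^sup>2) * esum Z" by (rule nn_integral_cmult) auto
    also have "esum Z = (ESUM m. (ESUM u. ennreal ((decay R (\<phi> m - u) * norm (mat_op B x m))\<^sup>2)))"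
      unfolding Z_def by (rule esum_swap)
    also have "\<dots> \<le> (ESUM m. ennreal V * ennreal ((norm (mat_op B x m))\<^sup>2))"
    proof (intro nn_integral_mono)
      fix m
      have "(ESUM u. ennreal ((decay R (\<phi> m - u) * norm (mat_op B x m))\<^sup>2))
          \<le> (ESUM u. ennreal (decay R (\<phi> m - u)) * ennreal ((norm (mat_op B x m))\<^sup>2))"
      proof (intro nn_integral_mono)
        fix u
        have "(decay R (\<phi> m - u))\<^sup>2 \<le> decay R (\<phi> m - u)"
          using v[of "\<phi> m - u"] by (simp add: power2_eq_square mult_le_cancel_left2)
        then have "(decay R (\<phi> m - u) * norm (mat_op B x m))\<^sup>2 \<le> decay R (\<phi> m - u) * (norm (mat_op B x m))\<^sup>2"
          unfolding power_mult_distrib by (rule mult_right_mono) simp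
        then show "ennreal ((decay R (\<phi> m - u) * norm (mat_op B x m))\<^sup>2)
            \<le> ennreal (decay R (\<phi> m - u)) * ennreal ((norm (mat_op B x m))\<^sup>2)"
          using v[of "\<phi> m - u"] by (simp add: ennreal_leI flip: ennreal_mult)
      qed
      also have "\<dots> = (ESUM u. ennreal (decay R (\<phi> m - u))) * ennreal ((norm (mat_op B x m))\<^sup>2)"
        by (rule nn_integral_multc) auto
      also have "\<dots> \<le> ennreal V * ennreal ((norm (mat_op B x m))\<^sup>2)"
        using V(2) esum_reflect[of "\<lambda>l. ennreal (decay R l)" "\<phi> m"] by (intro mult_right_mono) auto
      finally show "(ESUM u. ennreal ((decay R (\<phi> m - u) * norm (mat_op B x m))\<^sup>2))
          \<le> ennreal V * ennreal ((norm (mat_op B x m))\<^sup>2)" .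
    qed
    also have "\<dots> = ennreal V * energy (mat_op B x)" by (rule nn_integral_cmult) auto
    finally have "energy x \<le> ennreal (C\<^sup>2) * (ennreal V * energy (mat_op B x))"
      by (simp add: mult_left_mono)
    also have "\<dots> = ennreal (C\<^sup>2 * V) * energy (mat_op B x)" using V by (simp add: ennreal_mult mult.assoc)
    also have "\<dots> \<le> ennreal (C\<^sup>2 * V + 1) * energy (mat_op B x)"
      by (intro mult_right_mono ennreal_leI) auto
    finally show ?thesis .
  qed
  moreover have "0 < C\<^sup>2 * V + 1" using V by (simp add: add_nonneg_pos)
  ultimately show ?thesis by blast
qed


section \<open>The normalised Gram operator is a contraction\<close>

lemma energy_mat_op_le:
  assumes "fibres_le K \<phi>" "dominated \<phi> a A" "esum a \<le> ennreal \<sigma>" "0 < \<sigma>"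
  shows "energy (mat_op A x) \<le> ennreal (K * \<sigma>\<^sup>2) * energy x"
  using mat_op_powr_le[OF assms, of 2 x] assms(4) by (simp add: powr_numeral)

lemma bounded_of_energy_finite: "energy x < top \<Longrightarrow> bounded (range x)"
proof -
  assume fin: "energy x < top"
  have "norm (x n) \<le> sqrt (enn2real (energy x))" for n
  proof -
    have "ennreal ((norm (x n))\<^sup>2) \<le> energy x" by (rule esum_ge_term)
    from enn2real_mono[OF this] have "(norm (x n))\<^sup>2 \<le> enn2real (energy x)" using fin by simp
    then show ?thesis by (rule real_le_rsqrt)
  qed
  then show ?thesis by (auto simp: bounded_iff)
qed

lemma energy_real:
  assumes "energy x < top"
  shows "(\<lambda>n. (norm (x n))\<^sup>2) summable_on UNIV"
    and "energy x = ennreal (\<Sum>\<^sub>\<infinity>n. (norm (x n))\<^sup>2)"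
proof -
  show *: "(\<lambda>n. (norm (x n))\<^sup>2) summable_on UNIV"
    by (rule summable_on_of_esum) (use assms in simp)
  show "energy x = ennreal (\<Sum>\<^sub>\<infinity>n. (norm (x n))\<^sup>2)" by (rule esum_ennreal[OF *]) simp
qed

text \<open>
  The double sum behind \<open>\<langle>B\<^sup>\<star>y, x\<rangle> = \<langle>B x, y\<rangle>\<close> converges absolutely, because
  \<open>\<parallel>x m\<parallel> \<parallel>y k\<parallel> \<le> \<parallel>x m\<parallel>\<^sup>2 + \<parallel>y k\<parallel>\<^sup>2\<close> and both the rows and the columns of the dominating kernel have
  bounded sums.
\<close>

lemma infsum_rinner_star:
  fixes B :: "('a::complex_hilbert, 'b::complex_hilbert, 'd::finite) op_matrix"
  assumes fib: "fibres_le K \<phi>" and dom: "dominated \<phi> b B" and fin: "esum b < top"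
    and op: "operator_matrix B" and x: "energy x < top" and y: "energy y < top"
    and star: "\<And>m. (ESUM k. enorm ((mat_star B m k) (y k))) < top"
  shows "(\<lambda>m. rinner (mat_op (mat_star B) y m) (x m)) summable_on UNIV"
    and "(\<Sum>\<^sub>\<infinity>m. rinner (mat_op (mat_star B) y m) (x m)) = (\<Sum>\<^sub>\<infinity>k. rinner (mat_op B x k) (y k))"
proof -
  define f where "f = (\<lambda>k m. rinner ((B k m) (x m)) (y k))"
  have "enorm (f k m)
     \<le> b (\<phi> k - m) * ennreal ((norm (x m))\<^sup>2) + b (\<phi> k - m) * ennreal ((norm (y k))\<^sup>2)" for k m
  proof -
    have "norm (f k m) \<le> norm ((B k m) (x m)) * norm (y k)"
      unfolding f_def real_norm_def by (rule abs_rinner_le)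
    also have "\<dots> \<le> (norm (B k m) * norm (x m)) * norm (y k)"
      by (intro mult_right_mono norm_blinfun) auto
    also have "\<dots> = norm (B k m) * (norm (x m) * norm (y k))" by simp
    also have "\<dots> \<le> norm (B k m) * ((norm (x m))\<^sup>2 + (norm (y k))\<^sup>2)"
    proof (rule mult_left_mono)
      have "0 \<le> (norm (x m) - norm (y k))\<^sup>2" by simp
      then have "2 * (norm (x m) * norm (y k)) \<le> (norm (x m))\<^sup>2 + (norm (y k))\<^sup>2"
        by (simp add: power2_diff)
      moreover have "0 \<le> norm (x m) * norm (y k)" by simp
      ultimately show "norm (x m) * norm (y k) \<le> (norm (x m))\<^sup>2 + (norm (y k))\<^sup>2" by linarith
    qed simp
    finally have "enorm (f k m) \<le> enorm (B k m) * (ennreal ((norm (x m))\<^sup>2) + ennreal ((norm (y k))\<^sup>2))"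
      by (simp add: ennreal_leI flip: ennreal_mult ennreal_plus)
    also have "\<dots> \<le> b (\<phi> k - m) * (ennreal ((norm (x m))\<^sup>2) + ennreal ((norm (y k))\<^sup>2))"
      by (intro mult_right_mono dominatedD[OF dom]) auto
    finally show ?thesis by (simp only: distrib_left)
  qed
  then have "(ESUM k. (ESUM m. enorm (f k m))) \<le>
    (ESUM k. (ESUM m. b (\<phi> k - m) * ennreal ((norm (x m))\<^sup>2) + b (\<phi> k - m) * ennreal ((norm (y k))\<^sup>2)))"
    by (intro nn_integral_mono)
  also have "\<dots> = (ESUM k. (ESUM m. b (\<phi> k - m) * ennreal ((norm (x m))\<^sup>2)))
      + (ESUM k. (ESUM m. b (\<phi> k - m) * ennreal ((norm (y k))\<^sup>2)))"
    by (simp add: nn_integral_add)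
  also have "(ESUM k. (ESUM m. b (\<phi> k - m) * ennreal ((norm (y k))\<^sup>2))) = esum b * energy y"
    by (simp add: nn_integral_multc nn_integral_cmult esum_reflect)
  also have "(ESUM k. (ESUM m. b (\<phi> k - m) * ennreal ((norm (x m))\<^sup>2)))
      = (ESUM m. (ESUM k. b (\<phi> k - m)) * ennreal ((norm (x m))\<^sup>2))"
    by (subst esum_swap) (simp add: nn_integral_multc)
  also have "\<dots> \<le> (ESUM m. (of_nat K * esum b) * ennreal ((norm (x m))\<^sup>2))"
  proof (intro nn_integral_mono mult_right_mono)
    show "(ESUM k. b (\<phi> k - m)) \<le> of_nat K * esum b" for m
      using esum_fibres[OF fib, of "\<lambda>j. b (j - m)"] by (simp add: esum_shift)
  qed auto
  also have "\<dots> = (of_nat K * esum b) * energy x" by (rule nn_integral_cmult) auto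
  also have "(of_nat K * esum b) * energy x + esum b * energy y < top"
    using fin x y by (simp add: ennreal_mult_less_top of_nat_less_top)
  finally have f: "(ESUM k. (ESUM m. enorm (f k m))) < top" by (simp add: add_right_mono)
  have bx: "bounded (range x)" by (rule bounded_of_energy_finite[OF x])
  have 1: "(\<Sum>\<^sub>\<infinity>m. f k m) = rinner (mat_op B x k) (y k)" for k
    unfolding f_def mat_op_def
    by (rule infsum_bounded_linear_of_esum[symmetric, OF mat_op_esum_finite[OF dom fin bx] bounded_linear_rinner_left])
  have 2: "(\<Sum>\<^sub>\<infinity>k. f k m) = rinner (mat_op (mat_star B) y m) (x m)" for m
  proof -
    have "f k m = rinner ((mat_star B m k) (y k)) (x m)" for k
    proof -
      have "cinner ((B k m) (x m)) (y k) = cinner (x m) ((mat_star B m k) (y k))"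
        using op unfolding mat_star_def operator_matrix_def by (intro cinner_hilbert_adjoint) blast
      then show ?thesis unfolding f_def by (metis rinner_def rinner_commute)
    qed
    then show ?thesis
      unfolding mat_op_def
      using infsum_bounded_linear_of_esum[OF star bounded_linear_rinner_left] by simp
  qed
  show "(\<Sum>\<^sub>\<infinity>m. rinner (mat_op (mat_star B) y m) (x m)) = (\<Sum>\<^sub>\<infinity>k. rinner (mat_op B x k) (y k))"
    using infsum_swap_of_esum(1)[OF f] by (simp only: 1 2)
  show "(\<lambda>m. rinner (mat_op (mat_star B) y m) (x m)) summable_on UNIV"
    using infsum_swap_of_esum(5)[OF f] by (simp only: 2)
qed

text \<open>
  Expanding the square and using \<open>\<parallel>B\<^sup>\<star>Bx\<parallel>\<^sup>2 \<le> M \<parallel>Bx\<parallel>\<^sup>2\<close>,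
  \<open>\<parallel>x - B\<^sup>\<star>Bx / M\<parallel>\<^sup>2 = \<parallel>x\<parallel>\<^sup>2 - 2 \<parallel>Bx\<parallel>\<^sup>2 / M + \<parallel>B\<^sup>\<star>Bx\<parallel>\<^sup>2 / M\<^sup>2 \<le> \<parallel>x\<parallel>\<^sup>2 - \<parallel>Bx\<parallel>\<^sup>2 / M\<close>,
  and \<open>\<parallel>Bx\<parallel>\<^sup>2 \<ge> \<parallel>x\<parallel>\<^sup>2 / c\<close>.
\<close>

lemma gram_contraction:
  fixes B :: "('a::complex_hilbert, 'b::complex_hilbert, 'd::finite) op_matrix"
  assumes fib: "fibres_le K \<phi>" and dom: "dominated \<phi> b B" and fin: "esum b < top"
    and op: "operator_matrix B" and x: "energy x < top"
    and star: "\<And>y m. bounded (range y) \<Longrightarrow> (ESUM k. enorm ((mat_star B m k) (y k))) < top"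
    and M: "0 < M" "energy (mat_op B x) \<le> ennreal M * energy x"
      "energy (mat_op (mat_star B) (mat_op B x)) \<le> ennreal M * energy (mat_op B x)"
    and c: "0 < c" "energy x \<le> ennreal c * energy (mat_op B x)"
  shows "energy (\<lambda>m. x m - (1 / M) *\<^sub>R mat_op (mat_star B) (mat_op B x) m)
     \<le> ennreal (max 0 (1 - 1 / (c * M))) * energy x"
proof -
  define y where "y = mat_op B x"
  define z where "z = mat_op (mat_star B) y"
  have y: "energy y < top"
    unfolding y_def by (rule le_less_trans[OF M(2)]) (use x in \<open>simp add: ennreal_mult_less_top\<close>)
  have z: "energy z < top"
    unfolding z_def y_def
    by (rule le_less_trans[OF M(3)]) (use y in \<open>simp add: ennreal_mult_less_top y_def\<close>)
  define X Y Z where "X = (\<Sum>\<^sub>\<infinity>n. (norm (x n))\<^sup>2)" and "Y = (\<Sum>\<^sub>\<infinity>n. (norm (y n))\<^sup>2)"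
    and "Z = (\<Sum>\<^sub>\<infinity>n. (norm (z n))\<^sup>2)"
  have nonneg: "0 \<le> X" "0 \<le> Y" "0 \<le> Z" by (auto simp: X_def Y_def Z_def intro: infsum_nonneg)
  have E: "energy x = ennreal X" "energy y = ennreal Y" "energy z = ennreal Z"
    unfolding X_def Y_def Z_def by (intro energy_real x y z)+
  have ZY: "Z \<le> M * Y"
    using M(3) unfolding y_def[symmetric] z_def[symmetric] E using M(1) nonneg
    by (simp flip: ennreal_mult)
  have XY: "X \<le> c * Y"
    using c(2) unfolding y_def[symmetric] E using c(1) nonneg by (simp flip: ennreal_mult)
  note star_y = star[OF bounded_of_energy_finite[OF y]]
  have inner: "(\<lambda>m. rinner (z m) (x m)) summable_on UNIV" "(\<Sum>\<^sub>\<infinity>m. rinner (z m) (x m)) = Y"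
    using infsum_rinner_star[OF fib dom fin op x y star_y]
    unfolding z_def Y_def by (simp_all add: rinner_self flip: y_def)
  define g where "g = (\<lambda>m. (norm (x m))\<^sup>2 + (- 2 / M) * rinner (z m) (x m) + (1 / M)\<^sup>2 * (norm (z m))\<^sup>2)"
  have g: "(norm (x m - (1 / M) *\<^sub>R z m))\<^sup>2 = g m" for m
    unfolding norm_diff_scaleR_squared g_def by (simp add: rinner_commute)
  have s: "(\<lambda>m. (norm (x m))\<^sup>2) summable_on UNIV" "(\<lambda>m. (- 2 / M) * rinner (z m) (x m)) summable_on UNIV"
    "(\<lambda>m. (1 / M)\<^sup>2 * (norm (z m))\<^sup>2) summable_on UNIV"
    by (intro summable_on_cmult_right energy_real x z inner)+
  have gs: "g summable_on UNIV" unfolding g_def by (intro summable_on_add s)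
  have "infsum g UNIV = X + (- 2 / M) * Y + (1 / M)\<^sup>2 * Z"
    unfolding g_def X_def Z_def inner(2)[symmetric] infsum_cmult_right'[symmetric]
    by (simp only: infsum_add summable_on_add s)
  also have "\<dots> \<le> X + (- 2 / M) * Y + (1 / M)\<^sup>2 * (M * Y)"
    by (intro add_left_mono mult_left_mono ZY) auto
  also have "\<dots> = X - Y / M" using M(1) by (simp add: power2_eq_square field_simps)
  also have "\<dots> \<le> (1 - 1 / (c * M)) * X"
  proof -
    have "X / (c * M) \<le> (c * Y) / (c * M)" using XY c(1) M(1) by (intro divide_right_mono) auto
    then show ?thesis using c(1) by (simp add: left_diff_distrib)
  qed
  also have "\<dots> \<le> max 0 (1 - 1 / (c * M)) * X" using nonneg by (intro mult_right_mono) auto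
  finally have "infsum g UNIV \<le> max 0 (1 - 1 / (c * M)) * X" .
  moreover have "energy (\<lambda>m. x m - (1 / M) *\<^sub>R z m) = ennreal (infsum g UNIV)"
    unfolding g by (rule esum_ennreal[OF gs]) (simp flip: g)
  ultimately have "energy (\<lambda>m. x m - (1 / M) *\<^sub>R z m) \<le> ennreal (max 0 (1 - 1 / (c * M))) * energy x"
    using nonneg by (simp add: E ennreal_leI flip: ennreal_mult)
  then show ?thesis by (simp only: z_def y_def)
qed

section \<open>Inverting contractions inside the algebra of convolution-dominated matrices\<close>

text \<open>
  Bounded sequences include every \<open>\<ell>\<^sup>p\<close>, so that identities between matrices in the weighted class need
  to be checked only on them.
\<close>

definition resolvent :: "real \<Rightarrow> ('a::complex_hilbert, 'a, 'd::finite) op_matrix \<Rightarrow>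
    ('a, 'a, 'd) op_matrix \<Rightarrow> bool"
  where "resolvent s U V \<longleftrightarrow> slanted id s V \<and> (\<forall>x. bounded (range x) \<longrightarrow>
    mat_op V (\<lambda>n. x n - mat_op U x n) = x \<and> (\<lambda>n. mat_op V x n - mat_op U (mat_op V x) n) = x)"

lemma bounded_mat_op_slanted:
  "slanted \<phi> s A \<Longrightarrow> 0 \<le> s \<Longrightarrow> bounded (range x) \<Longrightarrow> bounded (range (mat_op A x))"
  by (erule (1) slantedE) (rule bounded_mat_op)

lemma mat_op_mult_slanted:
  assumes "slanted \<phi> s A" "slanted \<psi> s B" "0 \<le> s" "bounded (range x)"
  shows "mat_op (mat_mult A B) x = mat_op A (mat_op B x)"
proof -
  obtain a where a: "esum a < top" "dominated \<phi> a A" using slantedE[OF assms(1,3)] by blast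
  obtain b where b: "esum b < top" "dominated \<psi> b B" using slantedE[OF assms(2,3)] by blast
  show ?thesis by (rule mat_op_mult[OF a(2,1) b(2,1) assms(4)])
qed

lemma mat_op_add_slanted:
  assumes "slanted \<phi> s A" "0 \<le> s" "bounded (range x)" "bounded (range y)"
  shows "mat_op A (\<lambda>n. x n + y n) = (\<lambda>m. mat_op A x m + mat_op A y m)"
proof -
  obtain a where a: "esum a < top" "dominated \<phi> a A" using slantedE[OF assms(1,2)] by blast
  show ?thesis by (rule mat_op_add[OF a(2,1) assms(3,4)])
qed

lemma mat_op_diff_slanted:
  assumes "slanted \<phi> s A" "0 \<le> s" "bounded (range x)" "bounded (range y)"
  shows "mat_op A (\<lambda>n. x n - y n) = (\<lambda>m. mat_op A x m - mat_op A y m)"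
proof -
  obtain a where a: "esum a < top" "dominated \<phi> a A" using slantedE[OF assms(1,2)] by blast
  show ?thesis by (rule mat_op_diff[OF a(2,1) assms(3,4)])
qed

lemma mat_op_add_matrix_slanted:
  assumes "slanted \<phi> s A" "slanted \<psi> s B" "0 \<le> s" "bounded (range x)"
  shows "mat_op (\<lambda>m n. A m n + B m n) x = (\<lambda>m. mat_op A x m + mat_op B x m)"
proof -
  obtain a where a: "esum a < top" "dominated \<phi> a A" using slantedE[OF assms(1,3)] by blast
  obtain b where b: "esum b < top" "dominated \<psi> b B" using slantedE[OF assms(2,3)] by blast
  show ?thesis by (rule mat_op_add_matrix[OF a(2,1) b(2,1) assms(4)])
qed

text \<open>Since \<open>1 - U\<^sup>2 = (1 - U) (1 + U)\<close>, inverting \<open>1 - U\<^sup>2\<close> is enough to invert \<open>1 - U\<close>.\<close>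

lemma resolvent_of_square:
  assumes U: "slanted id s U" and s: "0 \<le> s" and V: "resolvent s (mat_mult U U) V"
  shows "\<exists>V'. resolvent s U V'"
proof -
  have sV: "slanted id s V" using V by (simp add: resolvent_def)
  define V' where "V' = (\<lambda>m n. V m n + mat_mult U V m n)"
  have sV': "slanted id s V'" unfolding V'_def by (intro slanted_add slanted_mult sV U s)
  have V': "mat_op V' x = (\<lambda>m. mat_op V x m + mat_op U (mat_op V x) m)" if "bounded (range x)" for x
    unfolding V'_def mat_op_add_matrix_slanted[OF sV slanted_mult[OF U sV s] s that]
      mat_op_mult_slanted[OF U sV s that] ..
  note bU = bounded_mat_op_slanted[OF U s]
  note bV = bounded_mat_op_slanted[OF sV s]
  have right: "(\<lambda>n. mat_op V' x n - mat_op U (mat_op V' x) n) = x" if x: "bounded (range x)" for x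
  proof -
    have "mat_op U (mat_op V' x) = (\<lambda>m. mat_op U (mat_op V x) m + mat_op U (mat_op U (mat_op V x)) m)"
      unfolding V'[OF x] by (rule mat_op_add_slanted[OF U s bV[OF x] bU[OF bV[OF x]]])
    then have "(\<lambda>n. mat_op V' x n - mat_op U (mat_op V' x) n)
       = (\<lambda>n. mat_op V x n - mat_op (mat_mult U U) (mat_op V x) n)"
      unfolding mat_op_mult_slanted[OF U U s bV[OF x]] by (simp add: V'[OF x])
    then show ?thesis using V x by (simp add: resolvent_def)
  qed
  have injective: "z = (\<lambda>n. 0)" if z: "bounded (range z)" "mat_op U z = z" for z
  proof -
    have "mat_op V (\<lambda>n. z n - mat_op (mat_mult U U) z n) = z"
      using V z by (simp add: resolvent_def)
    moreover have "mat_op (mat_mult U U) z = z" unfolding mat_op_mult_slanted[OF U U s z(1)] z(2) z(2) ..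
    ultimately have "z = mat_op V (\<lambda>n. 0)" by simp
    then show ?thesis by (simp add: mat_op_def)
  qed
  have left: "mat_op V' (\<lambda>n. x n - mat_op U x n) = x" if x: "bounded (range x)" for x
  proof -
    define y where "y = (\<lambda>n. x n - mat_op U x n)"
    have y: "bounded (range y)" unfolding y_def by (intro bounded_range_diff x bU)
    define z where "z = (\<lambda>n. mat_op V' y n - x n)"
    have bV'y: "bounded (range (mat_op V' y))" by (rule bounded_mat_op_slanted[OF sV' s y])
    have z: "bounded (range z)" unfolding z_def by (intro bounded_range_diff x bV'y)
    have Uz: "mat_op U z = (\<lambda>n. mat_op U (mat_op V' y) n - mat_op U x n)"
      unfolding z_def by (rule mat_op_diff_slanted[OF U s bV'y x])
    have "mat_op V' y n - mat_op U (mat_op V' y) n = x n - mat_op U x n" for n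
      using fun_cong[OF right[OF y], of n] by (simp add: y_def)
    then have "mat_op U (mat_op V' y) n - mat_op U x n = mat_op V' y n - x n" for n
      by (simp add: algebra_simps)
    then have "mat_op U z = z" unfolding Uz by (simp add: z_def)
    then have "z = (\<lambda>n. 0)" by (rule injective[OF z])
    then have "mat_op V' y n = x n" for n unfolding z_def by (metis eq_iff_diff_eq_0)
    then show ?thesis by (auto simp: y_def)
  qed
  show ?thesis unfolding resolvent_def using sV' left right by blast
qed

lemma infsum_nat_Suc:
  fixes f :: "nat \<Rightarrow> 'b::banach"
  assumes "f summable_on UNIV"
  shows "infsum f UNIV = f 0 + (\<Sum>\<^sub>\<infinity>i. f (Suc i))"
proof -
  have U: "(UNIV :: nat set) = {0} \<union> range Suc" by (auto intro: nat.exhaust)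
  have "infsum f ({0} \<union> range Suc) = infsum f {0} + infsum f (range Suc)"
    by (intro infsum_Un_disjoint summable_on_subset_banach[OF assms]) auto
  moreover have "infsum f (range Suc) = (\<Sum>\<^sub>\<infinity>i. f (Suc i))"
    by (subst infsum_reindex) (auto simp: comp_def)
  ultimately show ?thesis using U by simp
qed

text \<open>
  The weight is submultiplicative, so the \<open>i\<close>-th power of \<open>U\<close> is dominated by a sequence of weighted
  sum at most \<open>\<theta> ^ i\<close>, with \<open>\<theta> < 1\<close> the weighted sum of \<open>t\<close>, and the Neumann series converges in the
  weighted class.
\<close>

lemma resolvent_neumann:
  fixes U :: "('a::complex_hilbert, 'a, 'd::finite) op_matrix"
  assumes op: "operator_matrix U" and dom: "dominated id t U" and s: "0 \<le> s"
    and small: "weighted_sum s t < 1"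
  shows "\<exists>V. resolvent s U V"
proof -
  define P where "P = rec_nat mat_id (\<lambda>_. mat_mult U)"
  have P: "P 0 = mat_id" "\<And>i. P (Suc i) = mat_mult U (P i)" by (simp_all add: P_def)
  define d where "d = rec_nat (indicator {0}) (\<lambda>_. conv t)"
  have d: "d 0 = indicator {0}" "\<And>i. d (Suc i) = conv t (d i)" by (simp_all add: d_def)
  have domP: "dominated id (d i) (P i)" for i
    by (induction i) (simp_all only: P d dominated_id dominated_mult[OF dom])
  define \<theta> where "\<theta> = enn2real (weighted_sum s t)"
  have t_fin: "weighted_sum s t < top"
    using small by (rule less_trans) simp
  then have \<theta>: "weighted_sum s t = ennreal \<theta>" "0 \<le> \<theta>"
    by (simp_all add: \<theta>_def)
  have \<theta>1: "\<theta> < 1" using small \<theta> by (simp add: ennreal_less_one_iff)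
  have d_weight: "weighted_sum s (d i) \<le> ennreal (\<theta> ^ i)" for i
  proof (induction i)
    case 0
    then show ?case by (simp add: d esum_indicator_zero_weight)
  next
    case (Suc i)
    have "weighted_sum s (d (Suc i)) \<le> ennreal \<theta> * ennreal (\<theta> ^ i)"
      unfolding d using esum_conv_weight_le[OF s, of t "d i"] Suc unfolding \<theta>
      by (meson mult_left_mono order_trans zero_le)
    then show ?case using \<theta>(2) by (simp add: ennreal_mult)
  qed
  define \<sigma> where "\<sigma> = (\<lambda>l. (ESUM i. d i l))"
  have "weighted_sum s \<sigma> = (ESUM l. (ESUM i. d i l * ennreal (poly_weight s l)))"
    unfolding \<sigma>_def by (intro nn_integral_cong nn_integral_multc[symmetric]) auto
  also have "\<dots> = (ESUM i. weighted_sum s (d i))" by (rule esum_swap)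
  also have "\<dots> \<le> (ESUM i. ennreal (\<theta> ^ i))" by (intro nn_integral_mono d_weight)
  also have "\<dots> = (\<Sum>i. ennreal (\<theta> ^ i))" by (rule nn_integral_count_space_nat)
  also have "\<dots> < top"
    using summable_geometric[of \<theta>] \<theta>(2) \<theta>1 by (subst suminf_ennreal2) auto
  finally have \<sigma>_weight: "weighted_sum s \<sigma> < top" .
  have \<sigma>_fin: "esum \<sigma> < top" by (rule le_less_trans[OF esum_le_esum_weight[OF s] \<sigma>_weight])
  have t1_fin: "esum t < top" by (rule le_less_trans[OF esum_le_esum_weight[OF s] t_fin])
  have d_fin: "esum (d i) < top" for i
    by (rule le_less_trans[OF esum_le_esum_weight[OF s] le_less_trans[OF d_weight]]) simp
  have opP: "operator_matrix (P i)" for i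
    by (induction i) (auto simp: P intro: operator_matrix_id operator_matrix_mat_mult[OF dom t1_fin domP d_fin op])
  define S where "S = (\<lambda>m n. \<Sum>\<^sub>\<infinity>i. P i m n)"
  have P_entries: "(ESUM i. enorm (P i m n)) \<le> \<sigma> (m - n)" for m n
    unfolding \<sigma>_def using dominatedD[OF domP] by (intro nn_integral_mono) auto
  have P_entries_fin: "(ESUM i. enorm (P i m n)) < top" for m n
    by (rule le_less_trans[OF P_entries le_less_trans[OF esum_ge_term \<sigma>_fin]])
  have domS: "dominated id \<sigma> S"
    unfolding dominated_def S_def
    using order_trans[OF norm_infsum_le_esum P_entries] by simp
  have S_apply: "(S m n) h = (\<Sum>\<^sub>\<infinity>i. (P i m n) h)" for m n h
    unfolding S_def
    by (rule infsum_bounded_linear_of_esum[OF P_entries_fin blinfun.bounded_linear_left])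
  have apply_entries: "(ESUM i. enorm ((P i m n) h)) \<le> \<sigma> (m - n) * enorm h" for m n h
    by (rule order_trans[OF esum_norm_apply_left_le mult_right_mono[OF P_entries]]) simp
  have opS: "operator_matrix S"
    using opP unfolding operator_matrix_def S_def by (intro allI complex_linear_infsum P_entries_fin) blast
  have slS: "slanted id s S" by (rule slantedI[OF opS \<sigma>_weight domS])
  have slU: "slanted id s U" by (rule slantedI[OF op t_fin dom])
  have PSuc: "mat_op (P (Suc i)) x = mat_op U (mat_op (P i) x)" if "bounded (range x)" for i x
    unfolding P by (rule mat_op_mult[OF dom t1_fin domP d_fin that])
  have PU: "mat_op (P i) (mat_op U x) = mat_op (P (Suc i)) x" if x: "bounded (range x)" for i x
  proof (induction i)
    case 0
    show ?case unfolding PSuc[OF x] by (simp add: P mat_op_id)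
  next
    case (Suc i)
    show ?case
      unfolding PSuc[OF x] PSuc[OF bounded_mat_op[OF dom t1_fin x]] Suc ..
  qed
  have sum_iterates: "(ESUM i. enorm (mat_op (P i) x m)) \<le> esum \<sigma> * ennreal X"
    if "\<And>n. norm (x n) \<le> X" for x X m
  proof -
    have "(ESUM i. enorm (mat_op (P i) x m)) \<le> (ESUM i. esum (d i) * ennreal X)"
      by (intro nn_integral_mono order_trans[OF norm_mat_op_le[OF domP] esum_reflect_bounded] that)
    also have "\<dots> = (ESUM i. esum (d i)) * ennreal X" by (rule nn_integral_multc) auto
    also have "(ESUM i. esum (d i)) = esum \<sigma>" unfolding \<sigma>_def by (rule esum_swap)
    finally show ?thesis .
  qed
  have S_series: "mat_op S x m = (\<Sum>\<^sub>\<infinity>i. mat_op (P i) x m)" if x: "bounded (range x)" for x m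
  proof -
    obtain X where X: "0 \<le> X" "\<And>n. norm (x n) \<le> X" using bounded_rangeE[OF x] by blast
    have "(ESUM n. (ESUM i. enorm ((P i m n) (x n))))
        \<le> (ESUM n. \<sigma> (m - n) * enorm (x n))"
      by (intro nn_integral_mono apply_entries)
    also have "\<dots> \<le> esum \<sigma> * ennreal X" by (rule esum_reflect_bounded[OF X(2)])
    also have "\<dots> < top" using \<sigma>_fin by (simp add: ennreal_mult_less_top)
    finally have "(ESUM n. (ESUM i. enorm ((P i m n) (x n)))) < top" .
    from infsum_swap_of_esum(1)[OF this] show ?thesis by (simp add: mat_op_def S_apply)
  qed
  have US_series: "mat_op U (mat_op S x) m = (\<Sum>\<^sub>\<infinity>i. mat_op (P (Suc i)) x m)" if x: "bounded (range x)" for x m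
  proof -
    obtain X where X: "0 \<le> X" "\<And>n. norm (x n) \<le> X" using bounded_rangeE[OF x] by blast
    define y where "y = (\<lambda>i. mat_op (P i) x)"
    have y: "bounded (range (y i))" for i unfolding y_def by (rule bounded_mat_op[OF domP d_fin x])
    have ysum: "(ESUM i. enorm (y i n)) \<le> esum \<sigma> * ennreal X" for n
      unfolding y_def by (rule sum_iterates[OF X(2)])
    have XS: "esum \<sigma> * ennreal X < top" using \<sigma>_fin by (simp add: ennreal_mult_less_top)
    have "(ESUM n. (ESUM i. enorm ((U m n) (y i n))))
        \<le> (ESUM n. enorm (U m n) * (esum \<sigma> * ennreal X))"
    proof (intro nn_integral_mono)
      fix n
      have "(ESUM i. enorm ((U m n) (y i n))) \<le> enorm (U m n) * (ESUM i. enorm (y i n))"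
        by (rule esum_norm_apply_right_le)
      also have "\<dots> \<le> enorm (U m n) * (esum \<sigma> * ennreal X)" by (intro mult_left_mono ysum) auto
      finally show "(ESUM i. enorm ((U m n) (y i n)))
        \<le> enorm (U m n) * (esum \<sigma> * ennreal X)" .
    qed
    also have "\<dots> = (ESUM n. enorm (U m n)) * (esum \<sigma> * ennreal X)" by (rule nn_integral_multc) auto
    also have "\<dots> \<le> esum t * (esum \<sigma> * ennreal X)" by (intro mult_right_mono dominated_row[OF dom]) auto
    also have "\<dots> < top" using t1_fin XS by (simp add: ennreal_mult_less_top)
    finally have fin: "(ESUM n. (ESUM i. enorm ((U m n) (y i n)))) < top" .
    have "mat_op U (mat_op S x) m = (\<Sum>\<^sub>\<infinity>n. (U m n) (\<Sum>\<^sub>\<infinity>i. y i n))"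
      unfolding mat_op_def[of U] S_series[OF x] y_def ..
    also have "\<dots> = (\<Sum>\<^sub>\<infinity>n. \<Sum>\<^sub>\<infinity>i. (U m n) (y i n))"
      by (intro infsum_cong infsum_bounded_linear_of_esum blinfun.bounded_linear_right le_less_trans[OF ysum XS])
    also have "\<dots> = (\<Sum>\<^sub>\<infinity>i. \<Sum>\<^sub>\<infinity>n. (U m n) (y i n))"
      by (rule infsum_swap_of_esum(1)[OF fin])
    also have "\<dots> = (\<Sum>\<^sub>\<infinity>i. mat_op (P (Suc i)) x m)"
      unfolding PSuc[OF x] y_def mat_op_def[of U] ..
    finally show ?thesis .
  qed
  have telescope: "mat_op S x m - (\<Sum>\<^sub>\<infinity>i. mat_op (P (Suc i)) x m) = x m" if x: "bounded (range x)" for x m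
  proof -
    obtain X where X: "0 \<le> X" "\<And>n. norm (x n) \<le> X" using bounded_rangeE[OF x] by blast
    have "(ESUM i. enorm (mat_op (P i) x m)) < top"
      by (rule le_less_trans[OF sum_iterates[OF X(2)]]) (use \<sigma>_fin in \<open>simp add: ennreal_mult_less_top\<close>)
    then have "(\<lambda>i. mat_op (P i) x m) summable_on UNIV" by (rule summable_on_of_esum)
    from infsum_nat_Suc[OF this] show ?thesis unfolding S_series[OF x] by (simp add: P mat_op_id)
  qed
  have "mat_op S (\<lambda>n. x n - mat_op U x n) = x" if x: "bounded (range x)" for x
  proof
    fix m
    have Ux: "bounded (range (mat_op U x))" by (rule bounded_mat_op[OF dom t1_fin x])
    show "mat_op S (\<lambda>n. x n - mat_op U x n) m = x m"
      unfolding mat_op_diff[OF domS \<sigma>_fin x Ux] S_series[OF Ux] PU[OF x] by (rule telescope[OF x])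
  qed
  moreover have "(\<lambda>n. mat_op S x n - mat_op U (mat_op S x) n) = x" if x: "bounded (range x)" for x
    unfolding US_series[OF x] telescope[OF x] ..
  ultimately show ?thesis using slS unfolding resolvent_def by blast
qed

subsection \<open>Spectral radius by repeated squaring\<close>

lemma esum_conv_square_le:
  assumes "0 \<le> s"
  shows "weighted_sum s (conv t t)
    \<le> ennreal (2 * 2 powr s) * (weighted_sum s t * esum t)"
proof -
  define W where "W = weighted_sum s t"
  have "t i * t j * ennreal (poly_weight s (i + j))
     \<le> ennreal (2 powr s) * (((t i * ennreal (poly_weight s i)) * t j) + (t i * (t j * ennreal (poly_weight s j))))" for i j
  proof -
    have "t i * t j * ennreal (poly_weight s (i + j))
       \<le> t i * t j * (ennreal (2 powr s) * (ennreal (poly_weight s i) + ennreal (poly_weight s j)))"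
      using poly_weight_subadd[OF assms, of i j]
      by (intro mult_left_mono) (auto simp: ennreal_leI simp flip: ennreal_mult ennreal_plus)
    then show ?thesis by (simp add: algebra_simps)
  qed
  then have "weighted_sum s (conv t t) \<le> (ESUM i. (ESUM j.
     ennreal (2 powr s) * (((t i * ennreal (poly_weight s i)) * t j) + (t i * (t j * ennreal (poly_weight s j))))))"
    unfolding esum_conv by (intro nn_integral_mono)
  also have "\<dots> = ennreal (2 powr s) * (W * esum t + esum t * W)"
    by (simp add: nn_integral_cmult nn_integral_add nn_integral_multc W_def)
  also have "W * esum t + esum t * W = 2 * (W * esum t)"
    by (simp only: mult_2 mult.commute[of "esum t" W])
  also have "ennreal (2 powr s) * (2 * (W * esum t)) = ennreal (2 * 2 powr s) * (W * esum t)"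
    by (simp add: ennreal_mult ac_simps)
  finally show ?thesis by (simp add: W_def)
qed

text \<open>
  Inside a cube the terms are few and each is at most \<open>\<rho>\<close>; outside, the weight is at least
  \<open>N powr s\<close>.
\<close>

lemma esum_split_cube:
  fixes t :: "'d::finite index \<Rightarrow> ennreal"
  assumes "\<And>l. t l \<le> ennreal \<rho>" "0 \<le> \<rho>" "1 \<le> N" "0 \<le> s"
  shows "esum t \<le> ennreal ((2 * real N + 1) ^ CARD('d) * \<rho>)
    + ennreal (real N powr - s) * weighted_sum s t"
proof -
  have "t l \<le> ennreal \<rho> * indicator (cube N) l + ennreal (real N powr - s) * (t l * ennreal (poly_weight s l))" for l
  proof (cases "l \<in> cube N")
    case True
    then show ?thesis using assms(1)[of l] by (simp add: add_increasing2)
  next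
    case False
    then have "int N < sup_abs l" by (simp add: cube_def)
    then have "real N \<le> 1 + real_of_int (sup_abs l)" by linarith
    then have "real N powr s \<le> poly_weight s l"
      unfolding poly_weight_def using assms(4) by (intro powr_mono2) auto
    then have "real N powr - s * real N powr s \<le> real N powr - s * poly_weight s l"
      by (intro mult_left_mono) auto
    then have "1 \<le> real N powr - s * poly_weight s l"
      using assms(3) by (simp flip: powr_add)
    then have "t l * 1 \<le> t l * ennreal (real N powr - s * poly_weight s l)"
      by (intro mult_left_mono) (auto simp flip: ennreal_1 intro: ennreal_leI)
    then show ?thesis using False by (simp add: ennreal_mult ac_simps)
  qed
  then have "esum t \<le> (ESUM l. ennreal \<rho> * indicator (cube N) l + ennreal (real N powr - s) * (t l * ennreal (poly_weight s l)))"
    by (intro nn_integral_mono)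
  also have "\<dots> = ennreal \<rho> * of_nat (card (cube N :: 'd index set))
      + ennreal (real N powr - s) * weighted_sum s t"
    by (simp add: nn_integral_add nn_integral_cmult)
  also have "ennreal \<rho> * of_nat (card (cube N :: 'd index set)) \<le> ennreal ((2 * real N + 1) ^ CARD('d) * \<rho>)"
  proof -
    have "real (card (cube N :: 'd index set)) \<le> real ((2 * N + 1) ^ CARD('d))"
      using card_cube_le[where 'd='d] unfolding of_nat_le_iff .
    then have "\<rho> * real (card (cube N :: 'd index set)) \<le> \<rho> * (2 * real N + 1) ^ CARD('d)"
      using assms(2) by (intro mult_left_mono) (auto simp: add.commute)
    then show ?thesis
      using assms(2) by (simp add: ennreal_of_nat_eq_real_of_nat ennreal_leI mult.commute flip: ennreal_mult)
  qed
  finally show ?thesis by (simp add: add_right_mono)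
qed

text \<open>Optimising the radius \<open>N\<close>: the choice \<open>N \<approx> \<rho> powr (- 1 / (2 d))\<close> balances the two terms.\<close>

lemma balance_cube_radius:
  fixes u v \<rho> s :: real
  assumes "0 < \<rho>" "\<rho> \<le> 1" "1 \<le> d" "real d \<le> s" "1 \<le> u"
    and le: "\<And>N::nat. 1 \<le> N \<Longrightarrow> v \<le> (2 * real N + 1) ^ d * \<rho> + real N powr - s * u"
  shows "v \<le> (5 ^ d + 1) * sqrt \<rho> * u"
proof -
  define x where "x = \<rho> powr (- (1 / (2 * real d)))"
  have "\<rho> powr 0 \<le> x" unfolding x_def using assms by (intro powr_mono') auto
  then have x: "1 \<le> x" using assms(1) by simp
  define N where "N = nat \<lceil>x\<rceil>"
  have N: "x \<le> real N" "real N \<le> 2 * x" "1 \<le> N" using x unfolding N_def by linarith+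
  have "(2 * real N + 1) ^ d \<le> (5 * x) ^ d" using N x by (intro power_mono) auto
  also have "\<dots> = 5 ^ d * \<rho> powr (- (1 / 2))"
    using assms(1,3) by (simp add: power_mult_distrib x_def powr_powr flip: powr_realpow)
  finally have "(2 * real N + 1) ^ d * \<rho> \<le> 5 ^ d * \<rho> powr (- (1 / 2)) * \<rho>"
    using assms(1) by (intro mult_right_mono) auto
  also have "\<dots> = 5 ^ d * sqrt \<rho>"
    using assms(1) powr_add[of \<rho> "- (1 / 2)" 1] by (simp add: powr_half_sqrt)
  also have "\<dots> \<le> 5 ^ d * sqrt \<rho> * u" using assms(1,5) by simp
  finally have 1: "(2 * real N + 1) ^ d * \<rho> \<le> 5 ^ d * sqrt \<rho> * u" .
  have "real N powr - s \<le> x powr - s" using N x assms by (intro powr_mono2') auto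
  also have "\<dots> = \<rho> powr (s / (2 * real d))" by (simp add: x_def powr_powr)
  also have "\<dots> \<le> \<rho> powr (1 / 2)"
    using assms by (intro powr_mono') (auto simp: field_simps)
  also have "\<dots> = sqrt \<rho>" using assms(1) by (simp add: powr_half_sqrt)
  finally have "real N powr - s * u \<le> sqrt \<rho> * u" using assms(5) by (intro mult_right_mono) auto
  with 1 le[OF N(3)] show ?thesis by (simp add: algebra_simps)
qed

text \<open>
  As long as the terms stay above \<open>1\<close>, the recursion gives \<open>D * u k \<le> (D * u 0 * q ^ k) ^ (2 ^ k)\<close>, and the
  base of this power tends to \<open>0\<close>.
\<close>

lemma squaring_recursion:
  fixes u :: "nat \<Rightarrow> real"
  assumes "0 < q" "q < 1" "1 \<le> D" "\<And>k. 0 \<le> u k"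
    and rec: "\<And>k. 1 \<le> u k \<Longrightarrow> u (Suc k) \<le> D * q ^ (2 ^ Suc k) * (u k)\<^sup>2"
  shows "\<exists>k. u k < 1"
proof (rule ccontr)
  assume "\<not> ?thesis"
  then have u: "1 \<le> u k" for k by (simp add: not_less)
  have *: "D * u k \<le> (D * u 0 * q ^ k) ^ (2 ^ k)" for k
  proof (induction k)
    case (Suc k)
    have "D * u (Suc k) \<le> D * (D * q ^ (2 ^ Suc k) * (u k)\<^sup>2)"
      using assms(3) rec[OF u] by (intro mult_left_mono) auto
    also have "\<dots> = q ^ (2 ^ Suc k) * (D * u k)\<^sup>2" by (simp add: power2_eq_square)
    also have "\<dots> \<le> q ^ (2 ^ Suc k) * ((D * u 0 * q ^ k) ^ (2 ^ k))\<^sup>2"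
      using Suc assms u[of k] by (intro mult_left_mono power_mono) auto
    also have "((D * u 0 * q ^ k) ^ (2 ^ k))\<^sup>2 = (D * u 0 * q ^ k) ^ (2 ^ Suc k)"
      by (simp add: mult.commute flip: power_mult)
    also have "q ^ (2 ^ Suc k) * (D * u 0 * q ^ k) ^ (2 ^ Suc k) = (D * u 0 * q ^ Suc k) ^ (2 ^ Suc k)"
      by (simp add: ac_simps flip: power_mult_distrib)
    finally show ?case .
  qed simp
  have pos: "0 < D * u 0" using assms(3) u[of 0] by simp
  obtain k where k: "q ^ k < 1 / (D * u 0)"
    using real_arch_pow_inv[of "1 / (D * u 0)" q] pos assms(2) by auto
  have "D * u 0 * q ^ k < 1" using k pos by (simp add: field_simps)
  then have "(D * u 0 * q ^ k) ^ (2 ^ k) < 1"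
    using pos assms(1) power_strict_mono[of "D * u 0 * q ^ k" 1 "2 ^ k"] by simp
  then have "D * u k < 1" using *[of k] by linarith
  moreover have "1 \<le> D * u k" using assms(3) u[of k] by (metis mult_mono' mult_1 zero_le_one)
  ultimately show False by simp
qed

text \<open>Test the bound on sequences supported at a single index.\<close>

lemma norm_entry_le_of_contraction:
  fixes U :: "('a::complex_hilbert, 'b::complex_hilbert, 'd::finite) op_matrix"
  assumes "0 \<le> \<rho>" "\<And>x. energy x < top \<Longrightarrow> energy (mat_op U x) \<le> ennreal (\<rho>\<^sup>2) * energy x"
  shows "norm (U m n) \<le> \<rho>"
proof (rule norm_blinfun_bound[OF assms(1)])
  fix h :: 'a
  define x where "x = (\<lambda>k. if k = n then h else 0)"
  have "energy x = (ESUM k. ennreal ((norm h)\<^sup>2) * indicator {n} k)"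
    by (intro nn_integral_cong) (auto simp: x_def indicator_def)
  also have "\<dots> = ennreal ((norm h)\<^sup>2)" by (subst nn_integral_cmult) auto
  finally have E: "energy x = ennreal ((norm h)\<^sup>2)" .
  have "mat_op U x m = (\<Sum>\<^sub>\<infinity>k\<in>{n}. (U m k) (x k))"
    unfolding mat_op_def by (rule infsum_cong_neutral) (auto simp: x_def)
  then have Ux: "mat_op U x m = (U m n) h" by (simp add: x_def)
  have "ennreal ((norm (mat_op U x m))\<^sup>2) \<le> energy (mat_op U x)" by (rule esum_ge_term)
  also have "\<dots> \<le> ennreal (\<rho>\<^sup>2) * ennreal ((norm h)\<^sup>2)" using assms(2)[of x] by (simp add: E)
  also have "\<dots> = ennreal ((\<rho> * norm h)\<^sup>2)" by (simp add: power_mult_distrib ennreal_mult)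
  finally have "(norm ((U m n) h))\<^sup>2 \<le> (\<rho> * norm h)\<^sup>2"
    unfolding Ux by (subst (asm) ennreal_le_iff) auto
  then show "norm ((U m n) h) \<le> \<rho> * norm h"
    by (rule power2_le_imp_le) (use assms(1) in simp)
qed

text \<open>
  The spectral radius in the weighted class does not exceed the norm on \<open>\<ell>\<^sup>2\<close>.  The power \<open>T ^ (2 ^ k)\<close> is
  dominated by a sequence \<open>t k\<close> whose terms are at most \<open>r ^ (2 ^ k)\<close> and at most those of the
  convolution of \<open>t (k - 1)\<close> with itself when \<open>k > 0\<close>.  Writing \<open>u\<close> for the weighted and \<open>v\<close> for the unweighted sum, the
  inequality \<open>\<omega> (i + j) \<le> 2 ^ s (\<omega> i + \<omega> j)\<close> yields \<open>u (k + 1) \<le> 2 ^ (s + 1) u k v k\<close>, and splitting the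
  unweighted sum at the optimal radius bounds \<open>v k\<close> by a multiple of \<open>sqrt (r ^ (2 ^ k)) u k\<close> while
  \<open>u k \<ge> 1\<close>.  Hence some \<open>u k\<close> is below \<open>1\<close>.
\<close>

lemma resolvent_of_contraction:
  fixes T :: "('a::complex_hilbert, 'a, 'd::finite) op_matrix"
  assumes T: "slanted id s T" and s: "real CARD('d) \<le> s" and r: "0 < r" "r < 1"
    and contr: "\<And>x. energy x < top \<Longrightarrow> energy (mat_op T x) \<le> ennreal (r\<^sup>2) * energy x"
  shows "\<exists>V. resolvent s T V"
proof -
  have s0: "0 \<le> s" by (rule order_trans[OF _ s]) simp
  define U where "U = rec_nat T (\<lambda>_ W. mat_mult W W)"
  have U: "U 0 = T" "\<And>k. U (Suc k) = mat_mult (U k) (U k)" by (simp_all add: U_def)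
  define \<rho> where "\<rho> = (\<lambda>k::nat. r ^ (2 ^ k))"
  have \<rho>: "0 < \<rho> k" "\<rho> k \<le> 1" for k using r by (simp_all add: \<rho>_def power_le_one)
  have \<rho>_Suc: "\<rho> (Suc k) = \<rho> k * \<rho> k" for k by (simp only: \<rho>_def power_Suc mult_2 power_add)
  have slU: "slanted id s (U k)" for k
    by (induction k) (simp_all only: U T slanted_mult s0)
  have contrU: "energy (mat_op (U k) x) \<le> ennreal ((\<rho> k)\<^sup>2) * energy x" if "energy x < top" for k x
    using that
  proof (induction k arbitrary: x)
    case 0
    then show ?case using contr by (simp add: U \<rho>_def)
  next
    case (Suc k)
    have fin: "energy (mat_op (U k) x) < top"
      by (rule le_less_trans[OF Suc.IH[OF Suc.prems]]) (use Suc.prems in \<open>simp add: ennreal_mult_less_top\<close>)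
    have "energy (mat_op (U (Suc k)) x) = energy (mat_op (U k) (mat_op (U k) x))"
      unfolding U mat_op_mult_slanted[OF slU slU s0 bounded_of_energy_finite[OF Suc.prems]] ..
    also have "\<dots> \<le> ennreal ((\<rho> k)\<^sup>2) * (ennreal ((\<rho> k)\<^sup>2) * energy x)"
      by (rule order_trans[OF Suc.IH[OF fin] mult_left_mono[OF Suc.IH[OF Suc.prems]]]) simp
    also have "\<dots> = ennreal ((\<rho> (Suc k))\<^sup>2) * energy x"
      by (simp only: \<rho>_Suc power_mult_distrib ennreal_mult mult.assoc zero_le_power2)
    finally show ?case .
  qed
  have entry: "enorm (U k m n) \<le> ennreal (\<rho> k)" for k m n
    using \<rho>[of k] by (intro ennreal_leI norm_entry_le_of_contraction contrU) auto
  obtain a where a: "weighted_sum s a < top" "dominated id a T"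
    using slantedE[OF T s0] by blast
  define t where "t = rec_nat (\<lambda>l. min (ennreal (\<rho> 0)) (a l)) (\<lambda>k t l. min (ennreal (\<rho> (Suc k))) (conv t t l))"
  have t: "t 0 = (\<lambda>l. min (ennreal (\<rho> 0)) (a l))"
    "\<And>k. t (Suc k) = (\<lambda>l. min (ennreal (\<rho> (Suc k))) (conv (t k) (t k) l))" by (simp_all add: t_def)
  have domU: "dominated id (t k) (U k)" for k
  proof (induction k)
    case 0
    then show ?case using entry[of 0] a(2) by (simp add: U t dominated_def)
  next
    case (Suc k)
    then have "dominated id (conv (t k) (t k)) (U (Suc k))" unfolding U by (intro dominated_mult)
    then show ?case using entry[of "Suc k"] by (simp add: t dominated_def)
  qed
  have t_le: "t k l \<le> ennreal (\<rho> k)" for k l by (cases k) (auto simp: t)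
  have step: "weighted_sum s (t (Suc k))
     \<le> ennreal (2 * 2 powr s) * (weighted_sum s (t k) * esum (t k))" for k
    by (rule order_trans[OF _ esum_conv_square_le[OF s0]]) (auto simp: t intro!: nn_integral_mono mult_right_mono)
  have t_fin: "weighted_sum s (t k) < top" for k
  proof (induction k)
    case 0
    have "weighted_sum s (t 0) \<le> weighted_sum s a"
      by (auto simp: t intro!: nn_integral_mono mult_right_mono)
    then show ?case using a(1) by (rule le_less_trans)
  next
    case (Suc k)
    then have "esum (t k) < top" by (rule le_less_trans[OF esum_le_esum_weight[OF s0]])
    with Suc show ?case by (intro le_less_trans[OF step]) (simp add: ennreal_mult_less_top)
  qed
  have t1_fin: "esum (t k) < top" for k by (rule le_less_trans[OF esum_le_esum_weight[OF s0] t_fin])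
  define u v where "u = (\<lambda>k. enn2real (weighted_sum s (t k)))"
    and "v = (\<lambda>k. enn2real (esum (t k)))"
  have uv: "weighted_sum s (t k) = ennreal (u k)" "esum (t k) = ennreal (v k)"
    "0 \<le> u k" "0 \<le> v k" for k
    using t_fin[of k] t1_fin[of k] by (simp_all add: u_def v_def)
  define d where "d = CARD('d)"
  have d: "1 \<le> d" "real d \<le> s" using s by (simp_all add: d_def Suc_leI)
  define D where "D = 2 * 2 powr s * (5 ^ d + 1)"
  have "(1::real) \<le> 2 powr s" using s0 by (intro ge_one_powr_ge_zero) auto
  then have D: "1 \<le> D" unfolding D_def
    by (smt (verit) mult_le_cancel_left1 mult_less_cancel_left2 zero_le_power)
  \<comment> \<open>The fourth root, since the recursion contains \<open>sqrt (r ^ (2 ^ k)) = q ^ (2 ^ (k + 1))\<close>.\<close>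
  define q where "q = sqrt (sqrt r)"
  have q: "0 < q" "q < 1" using r by (simp_all add: q_def)
  have q_pow: "q ^ (2 ^ Suc k) = sqrt (\<rho> k)" for k
  proof -
    have "q ^ (2 ^ Suc k) = (q\<^sup>2) ^ (2 ^ k)" by (simp flip: power_mult)
    then show ?thesis using r by (simp add: q_def \<rho>_def real_sqrt_power)
  qed
  have "u (Suc k) \<le> D * q ^ (2 ^ Suc k) * (u k)\<^sup>2" if "1 \<le> u k" for k
  proof -
    have v_le: "v k \<le> (5 ^ d + 1) * sqrt (\<rho> k) * u k"
    proof (rule balance_cube_radius[OF \<rho> d that])
      fix N :: nat assume N: "1 \<le> N"
      have "ennreal (v k) \<le> ennreal ((2 * real N + 1) ^ d * \<rho> k) + ennreal (real N powr - s) * ennreal (u k)"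
        using esum_split_cube[of "t k", OF t_le less_imp_le[OF \<rho>(1)] N s0] unfolding uv d_def .
      also have "\<dots> = ennreal ((2 * real N + 1) ^ d * \<rho> k + real N powr - s * u k)"
        using \<rho>(1)[of k] uv(3)[of k] by (simp flip: ennreal_mult ennreal_plus)
      finally show "v k \<le> (2 * real N + 1) ^ d * \<rho> k + real N powr - s * u k"
        using \<rho>(1)[of k] uv(3)[of k] by (subst (asm) ennreal_le_iff) auto
    qed
    have "ennreal (u (Suc k)) \<le> ennreal (2 * 2 powr s) * (ennreal (u k) * ennreal (v k))"
      using step[of k] unfolding uv .
    also have "\<dots> = ennreal (2 * 2 powr s * (u k * v k))" using uv(3,4)[of k] by (simp add: ennreal_mult)
    finally have "u (Suc k) \<le> 2 * 2 powr s * (u k * v k)"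
      using uv(3,4)[of k] by (subst (asm) ennreal_le_iff) auto
    also have "\<dots> \<le> 2 * 2 powr s * (u k * ((5 ^ d + 1) * sqrt (\<rho> k) * u k))"
      using uv(3)[of k] by (intro mult_left_mono v_le) auto
    also have "\<dots> = D * q ^ (2 ^ Suc k) * (u k)\<^sup>2"
      unfolding q_pow D_def by (simp add: power2_eq_square)
    finally show ?thesis .
  qed
  then obtain k where k: "u k < 1" using squaring_recursion[of q D u, OF q D uv(3)] by blast
  have "\<exists>V. resolvent s (U k) V"
    by (rule resolvent_neumann[OF slanted_operator_matrix[OF slU] domU s0])
       (use k uv(3)[of k] in \<open>simp add: uv ennreal_less_one_iff\<close>)
  then have "\<exists>V. resolvent s (U 0) V"
  proof (induction k)
    case (Suc k)
    then show ?case using resolvent_of_square[OF slU s0] unfolding U by blast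
  qed
  then show ?thesis by (simp add: U)
qed

section \<open>The inverse of the Gram operator\<close>

text \<open>
  The entry of \<open>B\<^sup>\<star>B\<close> at \<open>(m, n)\<close> is a sum over \<open>k\<close> of terms bounded by \<open>b (\<phi> k - m) * b (\<phi> k - n)\<close>.  Replacing
  \<open>\<phi> k\<close> by a free index costs the factor \<open>K\<close> and leaves a convolution in \<open>m - n\<close>.
\<close>

lemma slanted_gram:
  assumes fib: "fibres_le K \<phi>" and B: "slanted \<phi> s B" and Bs: "slanted \<psi> s (mat_star B)" and s: "0 \<le> s"
  shows "slanted id s (mat_mult (mat_star B) B)"
proof -
  obtain b where b: "weighted_sum s b < top" "esum b < top" "dominated \<phi> b B"
    using slantedE[OF B s] .
  obtain b' where b': "esum b' < top" "dominated \<psi> b' (mat_star B)" using slantedE[OF Bs s] by blast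
  have opB: "operator_matrix B" by (rule slanted_operator_matrix[OF B])
  define r where "r = (\<lambda>j. b (- j))"
  have r: "weighted_sum s r < top" using b(1) by (simp add: r_def weighted_sum_minus)
  have "(ESUM l. (of_nat K * conv r b l) * ennreal (poly_weight s l))
      = of_nat K * weighted_sum s (conv r b)"
    by (simp add: mult.assoc nn_integral_cmult)
  also have "\<dots> \<le> of_nat K * (weighted_sum s r * weighted_sum s b)"
    by (intro mult_left_mono esum_conv_weight_le s) simp
  also have "\<dots> < top" using r b(1) by (simp add: ennreal_mult_less_top of_nat_less_top)
  finally have "(ESUM l. (of_nat K * conv r b l) * ennreal (poly_weight s l)) < top" .
  moreover have "dominated id (\<lambda>l. of_nat K * conv r b l) (mat_mult (mat_star B) B)"
    unfolding dominated_def
  proof (intro allI)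
    fix m n
    have "enorm (mat_mult (mat_star B) B m n) \<le> (ESUM k. b (\<phi> k - m) * b (\<phi> k - n))"
      using dominatedD[OF b(3)] norm_mat_star[OF opB]
      by (intro order_trans[OF norm_mat_mult_le] nn_integral_mono mult_mono) auto
    also have "\<dots> \<le> of_nat K * (ESUM j. b (j - m) * b (j - n))"
      using esum_fibres[OF fib, of "\<lambda>j. b (j - m) * b (j - n)"] .
    also have "(ESUM j. b (j - m) * b (j - n)) = conv r b (m - n)"
      using esum_reflect[of "\<lambda>j. b (j - m) * b (j - n)" m] by (simp add: conv_def r_def algebra_simps)
    finally show "enorm (mat_mult (mat_star B) B m n) \<le> of_nat K * conv r b (id m - n)" by simp
  qed
  moreover have "operator_matrix (mat_mult (mat_star B) B)"
    by (rule operator_matrix_mat_mult[OF b'(2,1) b(3,2) slanted_operator_matrix[OF Bs] opB])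
  ultimately show ?thesis by (intro slantedI)
qed

text \<open>
  A lower bound on one \<open>\<ell>\<^sup>p\<close> makes \<open>1 - B\<^sup>\<star>B / M\<close> a strict contraction on \<open>\<ell>\<^sup>2\<close> for large \<open>M\<close>, so
  that \<open>B\<^sup>\<star>B\<close> is invertible within the weighted class of convolution-dominated matrices.
\<close>

lemma gram_inverse:
  fixes B :: "('a::complex_hilbert, 'b::complex_hilbert, 'd::finite) op_matrix"
  assumes fib: "fibres_le K \<phi>" "1 \<le> K" "fibres_le L \<psi>"
    and B: "slanted \<phi> s B" and Bs: "slanted \<psi> s (mat_star B)" and s: "2 * (real CARD('d) + 1) \<le> s"
    and p: "1 \<le> p" and below: "bounded_below p B"
  shows "\<exists>G. slanted id s G \<and> (\<forall>x. bounded (range x) \<longrightarrow>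
    mat_op G (mat_op (mat_star B) (mat_op B x)) = x \<and> mat_op (mat_star B) (mat_op B (mat_op G x)) = x)"
proof -
  have s0: "0 \<le> s" by (rule order_trans[OF _ s]) simp
  obtain b where b: "weighted_sum s b < top" "esum b < top" "dominated \<phi> b B"
    using slantedE[OF B s0] .
  obtain b' where b': "esum b' < top" "dominated \<psi> b' (mat_star B)" using slantedE[OF Bs s0] by blast
  have opB: "operator_matrix B" by (rule slanted_operator_matrix[OF B])
  have "weighted_sum (2 * (real CARD('d) + 1)) b
      \<le> weighted_sum s b"
    by (intro nn_integral_mono mult_left_mono ennreal_leI poly_weight_mono_exponent s) simp
  then have "weighted_sum (2 * (real CARD('d) + 1)) b < top"
    using b(1) by (rule le_less_trans)
  then obtain c where c: "0 < c" "\<And>x. bounded (range x) \<Longrightarrow> energy x \<le> ennreal c * energy (mat_op B x)"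
    using bounded_below_energy[OF fib(1,2) b(3) _ p below] by blast
  obtain \<sigma> where \<sigma>: "0 < \<sigma>" "esum b \<le> ennreal \<sigma>" using real_bound_of_finite[OF b(2)] .
  obtain \<sigma>' where \<sigma>': "0 < \<sigma>'" "esum b' \<le> ennreal \<sigma>'" using real_bound_of_finite[OF b'(1)] .
  define M where "M = real K * \<sigma>\<^sup>2 + real L * \<sigma>'\<^sup>2"
  have M: "0 < M" "real K * \<sigma>\<^sup>2 \<le> M" "real L * \<sigma>'\<^sup>2 \<le> M"
    using \<sigma>(1) fib(2) by (auto simp: M_def add_pos_nonneg)
  have EB: "energy (mat_op B x) \<le> ennreal M * energy x" for x
    by (rule order_trans[OF energy_mat_op_le[OF fib(1) b(3) \<sigma>(2,1)]])
       (intro mult_right_mono ennreal_leI M; simp)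
  have EBs: "energy (mat_op (mat_star B) y) \<le> ennreal M * energy y" for y
    by (rule order_trans[OF energy_mat_op_le[OF fib(3) b'(2) \<sigma>'(2,1)]])
       (intro mult_right_mono ennreal_leI M; simp)
  note bB = bounded_mat_op[OF b(3,2)] and bBs = bounded_mat_op[OF b'(2,1)]
  define C where "C = mat_mult (mat_star B) B"
  have slC: "slanted id s C" unfolding C_def by (rule slanted_gram[OF fib(1) B Bs s0])
  have C: "mat_op C x = mat_op (mat_star B) (mat_op B x)" if "bounded (range x)" for x
    unfolding C_def by (rule mat_op_mult[OF b'(2,1) b(3,2) that])
  define T where "T = (\<lambda>m n. mat_id m n + (- (1 / M)) *\<^sub>R C m n)"
  have slT: "slanted id s T" unfolding T_def by (intro slanted_add slanted_scaleR slanted_id slC)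
  have T: "mat_op T x = (\<lambda>m. x m - (1 / M) *\<^sub>R mat_op (mat_star B) (mat_op B x) m)"
    if x: "bounded (range x)" for x
    unfolding T_def mat_op_add_matrix_slanted[OF slanted_id slanted_scaleR[OF slC] s0 x]
      mat_op_scaleR_matrix mat_op_id C[OF x] by simp
  \<comment> \<open>The maximum with \<open>1/2\<close> guarantees \<open>0 < r\<close>.\<close>
  define r where "r = sqrt (max (1/2) (1 - 1 / (c * M)))"
  have "max (1/2) (1 - 1 / (c * M)) < 1" using c(1) M(1) by simp
  then have r: "0 < r" "r < 1" "r\<^sup>2 = max (1/2) (1 - 1 / (c * M))"
    by (auto simp: r_def)
  have "\<exists>V. resolvent s T V"
  proof (rule resolvent_of_contraction[OF slT _ r(1,2)])
    show "real CARD('d) \<le> s" by (rule order_trans[OF _ s]) simp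
    fix x :: "'d index \<Rightarrow> 'a" assume x: "energy x < top"
    have bx: "bounded (range x)" by (rule bounded_of_energy_finite[OF x])
    have "energy (mat_op T x) \<le> ennreal (max 0 (1 - 1 / (c * M))) * energy x"
      unfolding T[OF bx]
      by (rule gram_contraction[OF fib(1) b(3,2) opB x mat_op_esum_finite[OF b'(2,1)] M(1) EB EBs c(1) c(2)[OF bx]])
    also have "\<dots> \<le> ennreal (r\<^sup>2) * energy x"
      unfolding r(3) by (intro mult_right_mono ennreal_leI) auto
    finally show "energy (mat_op T x) \<le> ennreal (r\<^sup>2) * energy x" .
  qed
  then obtain V where slV: "slanted id s V"
    and V: "\<And>x. bounded (range x) \<Longrightarrow> mat_op V (\<lambda>n. x n - mat_op T x n) = x"
      "\<And>x. bounded (range x) \<Longrightarrow> (\<lambda>n. mat_op V x n - mat_op T (mat_op V x) n) = x"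
    unfolding resolvent_def by blast
  define G where "G = (\<lambda>m n. (1 / M) *\<^sub>R V m n)"
  have slG: "slanted id s G" unfolding G_def by (rule slanted_scaleR[OF slV])
  have G: "mat_op G x = (\<lambda>m. (1 / M) *\<^sub>R mat_op V x m)" for x
    unfolding G_def by (rule mat_op_scaleR_matrix)
  have "mat_op G (mat_op (mat_star B) (mat_op B x)) = x" if x: "bounded (range x)" for x
  proof -
    have "mat_op G (mat_op (mat_star B) (mat_op B x)) = mat_op V (\<lambda>n. (1 / M) *\<^sub>R mat_op (mat_star B) (mat_op B x) n)"
      unfolding G mat_op_scaleR ..
    then show ?thesis using V(1)[OF x] unfolding T[OF x] by simp
  qed
  moreover have "mat_op (mat_star B) (mat_op B (mat_op G x)) = x" if x: "bounded (range x)" for x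
  proof -
    have "mat_op (mat_star B) (mat_op B (mat_op G x)) = (\<lambda>m. (1 / M) *\<^sub>R mat_op (mat_star B) (mat_op B (mat_op V x)) m)"
      unfolding G mat_op_scaleR ..
    then show ?thesis using V(2)[OF x] unfolding T[OF bounded_mat_op_slanted[OF slV s0 x]] by simp
  qed
  ultimately show ?thesis using slG by blast
qed


section \<open>The slants of slope \<open>\<alpha>\<close>\<close>

definition floor_map :: "real \<Rightarrow> 'd::finite index \<Rightarrow> 'd index"
  where "floor_map \<alpha> m = (\<chi> k. \<lfloor>\<alpha> * real_of_int (m $ k)\<rfloor>)"

lemma fibres_floor_map:
  assumes "\<alpha> \<noteq> 0"
  obtains K where "1 \<le> K" "fibres_le K (floor_map \<alpha> :: 'd::finite index \<Rightarrow> 'd index)"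
proof
  define L where "L = nat \<lceil>1 / \<bar>\<alpha>\<bar>\<rceil>"
  have sub: "{m. floor_map \<alpha> m = j} \<subseteq> (\<lambda>l. m0 + l) ` cube L" if m0: "floor_map \<alpha> m0 = j" for j m0 :: "'d index"
  proof
    fix m assume "m \<in> {m. floor_map \<alpha> m = j}"
    then have m: "floor_map \<alpha> m = j" by simp
    have "\<bar>(m - m0) $ k\<bar> \<le> int L" for k
    proof -
      have "\<lfloor>\<alpha> * real_of_int (m $ k)\<rfloor> = \<lfloor>\<alpha> * real_of_int (m0 $ k)\<rfloor>"
        using m m0 by (metis floor_map_def vec_lambda_beta)
      then have "\<bar>\<alpha> * real_of_int (m $ k) - \<alpha> * real_of_int (m0 $ k)\<bar> < 1" by linarith
      then have "\<bar>\<alpha>\<bar> * \<bar>real_of_int ((m - m0) $ k)\<bar> < 1"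
        by (simp add: abs_mult[symmetric] right_diff_distrib)
      then have "\<bar>real_of_int ((m - m0) $ k)\<bar> < 1 / \<bar>\<alpha>\<bar>" using assms by (simp add: field_simps)
      also have "\<dots> \<le> real L" unfolding L_def by linarith
      finally show ?thesis by linarith
    qed
    then have "m - m0 \<in> cube L" by (simp add: cube_def sup_abs_le_iff)
    then show "m \<in> (\<lambda>l. m0 + l) ` cube L" by (intro image_eqI[of _ _ "m - m0"]) auto
  qed
  show "fibres_le (card (cube L :: 'd index set)) (floor_map \<alpha> :: 'd index \<Rightarrow> 'd index)"
    unfolding fibres_le_def
  proof
    fix j :: "'d index"
    show "finite {i. floor_map \<alpha> i = j} \<and> card {i. floor_map \<alpha> i = j} \<le> card (cube L :: 'd index set)"
    proof (cases "{i. floor_map \<alpha> i = j} = {}")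
      case False
      then obtain m0 where "floor_map \<alpha> m0 = j" by blast
      note sub = sub[OF this]
      have "card {i. floor_map \<alpha> i = j} \<le> card ((\<lambda>l. m0 + l) ` cube L :: 'd index set)"
        by (intro card_mono sub) simp
      also have "\<dots> \<le> card (cube L :: 'd index set)" by (rule card_image_le) simp
      finally show ?thesis using finite_subset[OF sub] by simp
    qed (metis card.empty finite.emptyI zero_le)
  qed
  have "(0 :: 'd index) \<in> cube L" by (simp add: cube_def)
  then have "card (cube L :: 'd index set) \<noteq> 0" by (metis card_0_eq emptyE finite_cube)
  then show "1 \<le> card (cube L :: 'd index set)" by (meson less_one not_le)
qed

lemma slant_eq:
  "slant \<alpha> j A = (\<lambda>m n. if j = floor_map \<alpha> m - n then A m n else 0)"
proof (intro ext)
  fix m n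
  have "indicat_real {real_of_int (j $ k)..<real_of_int (j $ k) + 1} (\<alpha> * real_of_int (m $ k) - real_of_int (n $ k))
      = of_bool (j $ k = (floor_map \<alpha> m - n) $ k)" for k
    unfolding indicator_def floor_map_def by (auto simp: of_bool_def) linarith+
  then have "(\<Prod>k\<in>UNIV. indicat_real {real_of_int (j $ k)..<real_of_int (j $ k) + 1}
      (\<alpha> * real_of_int (m $ k) - real_of_int (n $ k))) = of_bool (\<forall>k. j $ k = (floor_map \<alpha> m - n) $ k)"
    by (auto simp: of_bool_def)
  also have "\<dots> = of_bool (j = floor_map \<alpha> m - n)" by (simp only: vec_eq_iff)
  finally show "slant \<alpha> j A m n = (if j = floor_map \<alpha> m - n then A m n else 0)"
    unfolding slant_def by simp
qed

text \<open>
  Each entry lies on exactly one slant, so the suprema over the slants form the least dominating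
  sequence.
\<close>

lemma Sigma_class_iff_slanted:
  fixes A :: "('a::complex_hilbert, 'b::complex_hilbert, 'd::finite) op_matrix"
  assumes "\<alpha> \<noteq> 0"
  shows "A \<in> Sigma_class \<alpha> (poly_weight s) \<longleftrightarrow> slanted (floor_map \<alpha>) s A"
proof -
  have "0 < \<lceil>1 / \<bar>\<alpha>\<bar>\<rceil>" using assms by simp
  then have K: "nat \<lceil>1 / \<bar>\<alpha>\<bar>\<rceil> ^ CARD('d) \<noteq> 0" by simp
  have "Sigma_norm \<alpha> (poly_weight s) A < top \<longleftrightarrow>
      (ESUM j. sup_norm (slant \<alpha> j A) * ennreal (poly_weight s j)) < top"
    unfolding Sigma_norm_def infsum_eq_esum
    using K by (auto simp: ennreal_mult_less_top of_nat_less_top simp del: of_nat_power)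
  also have "\<dots> \<longleftrightarrow> (\<exists>a. weighted_sum s a < top \<and> dominated (floor_map \<alpha>) a A)"
  proof
    assume fin: "(ESUM j. sup_norm (slant \<alpha> j A) * ennreal (poly_weight s j)) < top"
    have "enorm (A m n) \<le> sup_norm (slant \<alpha> (floor_map \<alpha> m - n) A)" for m n
    proof -
      have "enorm (A m n) = enorm (slant \<alpha> (floor_map \<alpha> m - n) A m n)"
        by (simp add: slant_eq)
      also have "\<dots> \<le> (SUP n. enorm (slant \<alpha> (floor_map \<alpha> m - n) A m n))" 
        unfolding slant_eq by (rule SUP_upper2[of n]) auto
      finally show ?thesis
        unfolding sup_norm_def slant_eq by (intro SUP_upper2[of m] SUP_upper2[of n]) auto
    qed
    then have "dominated (floor_map \<alpha>) (\<lambda>j. sup_norm (slant \<alpha> j A)) A" by (simp add: dominated_def)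
    with fin show "\<exists>a. weighted_sum s a < top \<and> dominated (floor_map \<alpha>) a A"
      by (intro exI[of _ "\<lambda>j. sup_norm (slant \<alpha> j A)"]) simp
  next
    assume "\<exists>a. weighted_sum s a < top \<and> dominated (floor_map \<alpha>) a A"
    then obtain a where a: "weighted_sum s a < top" "dominated (floor_map \<alpha>) a A"
      by blast
    have "sup_norm (slant \<alpha> j A) \<le> a j" for j
      unfolding sup_norm_def slant_eq using dominatedD[OF a(2)] by (auto intro!: SUP_least)
    then have "(ESUM j. sup_norm (slant \<alpha> j A) * ennreal (poly_weight s j)) \<le> weighted_sum s a"
      by (intro nn_integral_mono mult_right_mono) auto
    then show "(ESUM j. sup_norm (slant \<alpha> j A) * ennreal (poly_weight s j)) < top"
      using a(1) by (rule le_less_trans)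
  qed
  finally show ?thesis by (simp add: Sigma_class_def slanted_def)
qed

text \<open>
  Transposition replaces the slope \<open>\<alpha>\<close> by \<open>1 / \<alpha>\<close>: if \<open>l = \<lfloor>m / \<alpha>\<rfloor> - n\<close>, then \<open>\<lfloor>\<alpha> n\<rfloor> - m\<close> differs from
  \<open>\<lfloor>- \<alpha> l\<rfloor>\<close> by a bounded vector, and \<open>l \<mapsto> \<lfloor>- \<alpha> l\<rfloor>\<close> has bounded fibres and distorts the weight by a bounded
  factor.
\<close>

lemma slanted_transpose:
  fixes D :: "('a::complex_hilbert, 'b::complex_hilbert, 'd::finite) op_matrix"
  assumes \<alpha>: "\<alpha> \<noteq> 0" and s: "0 \<le> s" and op: "operator_matrix D"
    and h: "weighted_sum s h < top"
    and le: "\<And>m n. enorm (D m n) \<le> h (floor_map \<alpha> n - m)"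
  shows "slanted (floor_map (1 / \<alpha>)) s D"
proof -
  define N where "N = nat \<lceil>\<bar>\<alpha>\<bar>\<rceil> + 1"
  have N: "\<bar>\<alpha>\<bar> + 1 \<le> real N" unfolding N_def by linarith
  define \<theta> where "\<theta> = (floor_map (- \<alpha>) :: 'd index \<Rightarrow> 'd index)"
  define g where "g = (\<lambda>l. \<Sum>e\<in>cube N. h (\<theta> l + e))"
  have "enorm (D m n) \<le> g (floor_map (1 / \<alpha>) m - n)" for m n
  proof -
    define l where "l = floor_map (1 / \<alpha>) m - n"
    define e where "e = floor_map \<alpha> n - m - \<theta> l"
    have "\<bar>e $ k\<bar> \<le> int N" for k
    proof -
      define f where "f = real_of_int (m $ k) / \<alpha> - of_int \<lfloor>real_of_int (m $ k) / \<alpha>\<rfloor>"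
      have f: "0 \<le> f" "f < 1" unfolding f_def by linarith+
      have "n $ k = \<lfloor>real_of_int (m $ k) / \<alpha>\<rfloor> - l $ k" by (simp add: l_def floor_map_def)
      then have "real_of_int (n $ k) = real_of_int (m $ k) / \<alpha> - f - real_of_int (l $ k)" by (simp add: f_def)
      then have "\<alpha> * real_of_int (n $ k) = real_of_int (m $ k) + - \<alpha> * real_of_int (l $ k) - \<alpha> * f"
        using \<alpha> by (simp add: field_simps)
      moreover have "\<bar>\<alpha> * f\<bar> \<le> \<bar>\<alpha>\<bar>"
        using f by (simp add: abs_mult mult_left_le)
      moreover have "e $ k = \<lfloor>\<alpha> * real_of_int (n $ k)\<rfloor> - m $ k - \<lfloor>- \<alpha> * real_of_int (l $ k)\<rfloor>"
        by (simp add: e_def \<theta>_def floor_map_def)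
      ultimately have "\<bar>real_of_int (e $ k)\<bar> \<le> \<bar>\<alpha>\<bar> + 1" by linarith
      then show ?thesis using N by linarith
    qed
    then have e: "e \<in> cube N" by (simp add: cube_def sup_abs_le_iff)
    have "h (floor_map \<alpha> n - m) = h (\<theta> l + e)" by (simp add: e_def)
    also have "\<dots> \<le> g l" unfolding g_def using e by (intro member_le_sum) auto
    finally show ?thesis using le[of m n] by (simp add: l_def)
  qed
  then have dom: "dominated (floor_map (1 / \<alpha>)) g D" by (simp add: dominated_def)
  obtain K where K: "fibres_le K \<theta>"
    using fibres_floor_map[of "- \<alpha>", where 'd='d] \<alpha> unfolding \<theta>_def by auto
  define c where "c = 1 + (real N + 1) / \<bar>\<alpha>\<bar>"
  have c: "1 \<le> c" by (simp add: c_def)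
  have weight: "poly_weight s l \<le> c powr s * poly_weight s (\<theta> l + e)" if e: "e \<in> cube N" for l e
  proof -
    define S where "S = sup_abs (\<theta> l + e)"
    have S0: "0 \<le> S" by (simp add: S_def)
    have "\<bar>real_of_int (l $ k)\<bar> \<le> (real N + 1 + S) / \<bar>\<alpha>\<bar>" for k
    proof -
      have "\<bar>(\<theta> l + e) $ k\<bar> \<le> S" unfolding S_def by (rule sup_abs_nth)
      moreover have "\<bar>e $ k\<bar> \<le> int N" using sup_abs_nth[of e k] e by (simp add: cube_def)
      moreover have "(\<theta> l + e) $ k = \<lfloor>- \<alpha> * real_of_int (l $ k)\<rfloor> + e $ k" by (simp add: \<theta>_def floor_map_def)
      ultimately have "\<bar>- \<alpha> * real_of_int (l $ k)\<bar> \<le> real N + 1 + S" by linarith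
      then show ?thesis using \<alpha> by (simp add: abs_mult field_simps)
    qed
    then have "real_of_int (sup_abs l) \<le> (real N + 1 + S) / \<bar>\<alpha>\<bar>"
    proof -
      assume *: "\<And>k. \<bar>real_of_int (l $ k)\<bar> \<le> (real N + 1 + S) / \<bar>\<alpha>\<bar>"
      have "sup_abs l \<le> \<lfloor>(real N + 1 + S) / \<bar>\<alpha>\<bar>\<rfloor>"
        unfolding sup_abs_le_iff using * by (simp add: le_floor_iff)
      then show ?thesis by (simp add: le_floor_iff)
    qed
    also have "\<dots> \<le> (real N + 1) * (1 + S) / \<bar>\<alpha>\<bar>"
      using S0 \<alpha> by (intro divide_right_mono) (auto simp: algebra_simps)
    finally have "1 + real_of_int (sup_abs l) \<le> c * (1 + real_of_int S)"
      using S0 by (simp add: c_def distrib_right)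
    then have "poly_weight s l \<le> (c * (1 + real_of_int S)) powr s"
      unfolding poly_weight_def by (intro powr_mono2 s) (auto intro: add_nonneg_nonneg)
    also have "\<dots> = c powr s * poly_weight s (\<theta> l + e)"
      by (simp only: powr_mult poly_weight_def S_def)
    finally show ?thesis .
  qed
  have "weighted_sum s g = (\<Sum>e\<in>cube N. (ESUM l. h (\<theta> l + e) * ennreal (poly_weight s l)))"
    unfolding g_def sum_distrib_right by (rule nn_integral_sum) auto
  also have "\<dots> < top"
  proof -
    have "(ESUM l. h (\<theta> l + e) * ennreal (poly_weight s l)) < top" if e: "e \<in> cube N" for e
    proof -
      have "(ESUM l. h (\<theta> l + e) * ennreal (poly_weight s l))
         \<le> (ESUM l. ennreal (c powr s) * (h (\<theta> l + e) * ennreal (poly_weight s (\<theta> l + e))))"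
      proof (intro nn_integral_mono)
        fix l
        have "h (\<theta> l + e) * ennreal (poly_weight s l) \<le> h (\<theta> l + e) * (ennreal (c powr s) * ennreal (poly_weight s (\<theta> l + e)))"
          using weight[OF e, of l] by (intro mult_left_mono) (auto simp: ennreal_leI simp flip: ennreal_mult)
        then show "h (\<theta> l + e) * ennreal (poly_weight s l)
           \<le> ennreal (c powr s) * (h (\<theta> l + e) * ennreal (poly_weight s (\<theta> l + e)))" by (simp add: ac_simps)
      qed
      also have "\<dots> = ennreal (c powr s) * (ESUM l. h (\<theta> l + e) * ennreal (poly_weight s (\<theta> l + e)))"
        by (rule nn_integral_cmult) auto
      also have "\<dots> \<le> ennreal (c powr s) * (of_nat K * (ESUM j. h (j + e) * ennreal (poly_weight s (j + e))))"
        using esum_fibres[OF K, of "\<lambda>j. h (j + e) * ennreal (poly_weight s (j + e))"] by (intro mult_left_mono) auto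
      also have "(ESUM j. h (j + e) * ennreal (poly_weight s (j + e))) = weighted_sum s h"
        by (rule esum_shift(2))
      also have "ennreal (c powr s) * (of_nat K * weighted_sum s h) < top"
        using h by (simp add: ennreal_mult_less_top of_nat_less_top)
      finally show ?thesis .
    qed
    then show ?thesis by (simp add: ennreal_sum_less_top)
  qed
  finally show ?thesis by (intro slantedI[OF op _ dom])
qed

lemma slanted_mat_star:
  assumes "\<alpha> \<noteq> 0" "0 \<le> s" "slanted (floor_map \<alpha>) s A"
  shows "slanted (floor_map (1 / \<alpha>)) s (mat_star A)"
proof -
  obtain a where a: "weighted_sum s a < top" "dominated (floor_map \<alpha>) a A"
    using assms(3) unfolding slanted_def by blast
  have op: "operator_matrix A" by (rule slanted_operator_matrix[OF assms(3)])
  show ?thesis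
    by (rule slanted_transpose[OF assms(1,2) operator_matrix_mat_star[OF op] a(1)])
       (simp add: norm_mat_star[OF op] dominatedD[OF a(2)])
qed

text \<open>
  In transposed form the product is dominated by a convolution along \<open>\<phi> n - m\<close>, where \<open>\<phi>\<close> is the map of
  slope \<open>\<alpha>\<close>.
\<close>

lemma slanted_mult_mat_star:
  assumes "\<alpha> \<noteq> 0" "0 \<le> s" and G: "slanted id s G" and A: "slanted (floor_map \<alpha>) s A"
  shows "slanted (floor_map (1 / \<alpha>)) s (mat_mult G (mat_star A))"
proof -
  obtain a where a: "weighted_sum s a < top" "dominated (floor_map \<alpha>) a A"
    using A unfolding slanted_def by blast
  obtain g where g: "weighted_sum s g < top" "esum g < top" "dominated id g G"
    using slantedE[OF G assms(2)] .
  have As: "slanted (floor_map (1 / \<alpha>)) s (mat_star A)" by (rule slanted_mat_star[OF assms(1,2) A])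
  obtain a' where a': "esum a' < top" "dominated (floor_map (1 / \<alpha>)) a' (mat_star A)"
    using slantedE[OF As assms(2)] by blast
  have op: "operator_matrix A" by (rule slanted_operator_matrix[OF A])
  define r where "r = (\<lambda>j. g (- j))"
  have r: "weighted_sum s r < top" using g(1) by (simp add: r_def weighted_sum_minus)
  show ?thesis
  proof (rule slanted_transpose[OF assms(1,2)])
    show "operator_matrix (mat_mult G (mat_star A))"
      by (rule operator_matrix_mat_mult[OF g(3,2) a'(2,1) slanted_operator_matrix[OF G] slanted_operator_matrix[OF As]])
    show "weighted_sum s (conv a r) < top"
      by (rule le_less_trans[OF esum_conv_weight_le[OF assms(2)]])
        (use a(1) r in \<open>simp add: ennreal_mult_less_top\<close>)
    fix m n
    have "enorm (mat_mult G (mat_star A) m n) \<le> (ESUM k. g (m - k) * a (floor_map \<alpha> n - k))"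
      using dominatedD[OF g(3)] dominatedD[OF a(2)] norm_mat_star[OF op]
      by (intro order_trans[OF norm_mat_mult_le] nn_integral_mono mult_mono) auto
    also have "\<dots> = conv a r (floor_map \<alpha> n - m)"
      using esum_reflect[of "\<lambda>k. g (m - k) * a (floor_map \<alpha> n - k)" "floor_map \<alpha> n"]
      by (simp add: conv_def r_def algebra_simps)
    finally show "enorm (mat_mult G (mat_star A) m n) \<le> conv a r (floor_map \<alpha> n - m)" .
  qed
qed

section \<open>One-sided inverses on all sequence spaces\<close>

lemma lp_operator_slanted:
  fixes A :: "('a::complex_hilbert, 'b::complex_hilbert, 'd::finite) op_matrix"
  assumes "slanted \<phi> s A" "0 \<le> s" "fibres_le K \<phi>" "1 \<le> q"
  shows "lp_operator q (mat_op A)"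
proof -
  obtain a where a: "esum a < top" "dominated \<phi> a A" using slantedE[OF assms(1,2)] by blast
  show ?thesis
    by (rule lp_operator_mat_op[OF assms(3) a(2,1) slanted_operator_matrix[OF assms(1)] assms(4)])
qed

lemma inverse_matrix_gram:
  fixes B :: "('a::complex_hilbert, 'b::complex_hilbert, 'd::finite) op_matrix"
  assumes "slanted \<phi> s B" "fibres_le K \<phi>" "slanted \<psi> s (mat_star B)" "fibres_le L \<psi>" "0 \<le> s" "slanted id s G"
    and inv: "\<And>x. bounded (range x) \<Longrightarrow> mat_op G (mat_op (mat_star B) (mat_op B x)) = x"
      "\<And>x. bounded (range x) \<Longrightarrow> mat_op (mat_star B) (mat_op B (mat_op G x)) = x"
  shows "inverse_matrix (mat_op (mat_star B) \<circ> mat_op B) G"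
  unfolding inverse_matrix_def
proof (intro conjI allI impI)
  show "operator_matrix G" by (rule slanted_operator_matrix[OF assms(6)])
  fix q :: ennreal assume q: "1 \<le> q"
  have "lp_operator q (mat_op (mat_star B) \<circ> mat_op B)"
    by (rule lp_operator_compose[OF lp_operator_slanted[OF assms(1,5,2) q] lp_operator_slanted[OF assms(3,5,4) q] q])
  moreover have "lp_operator q (mat_op G)" by (rule lp_operator_slanted[OF assms(6,5) fibres_le_id q])
  ultimately show "lp_inverse q (mat_op (mat_star B) \<circ> mat_op B) (mat_op G)"
    unfolding lp_inverse_def lp_left_inverse_def lp_right_inverse_def
    using inv bounded_range_of_lp[OF q] by auto
qed

theorem theorem2p11:
  fixes \<alpha> s :: real
    and p :: ennreal
    and A :: "('a::complex_hilbert, 'b::complex_hilbert, 'd::finite) op_matrix"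
  assumes "\<alpha> \<noteq> 0"
    and "separable_space (euclidean :: 'a topology)"
    and "separable_space (euclidean :: 'b topology)"
    and "s > (real CARD('d) + 1)\<^sup>2"
    and "A \<in> Sigma_class \<alpha> (poly_weight s)"
    and "1 \<le> p"
  shows "(bounded_below p A \<longrightarrow>
            (\<forall>q\<ge>1. lp_left_invertible q (mat_op A)) \<and>
            (\<exists>G Asharp.
               inverse_matrix (mat_op (mat_star A) \<circ> mat_op A) G \<and>
               represents Asharp (mat_op G \<circ> mat_op (mat_star A)) \<and>
               Asharp \<in> Sigma_class (1 / \<alpha>) (poly_weight s) \<and>
               (\<forall>q\<ge>1. lp_left_inverse q (mat_op A) (mat_op Asharp)))) \<and>
         (bounded_below p (mat_star A) \<longrightarrow>
            (\<forall>q\<ge>1. lp_right_invertible q (mat_op A)) \<and>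
            (\<exists>G Aflat.
               inverse_matrix (mat_op A \<circ> mat_op (mat_star A)) G \<and>
               represents Aflat (mat_op (mat_star A) \<circ> mat_op G) \<and>
               Aflat \<in> Sigma_class (1 / \<alpha>) (poly_weight s) \<and>
               (\<forall>q\<ge>1. lp_right_inverse q (mat_op A) (mat_op Aflat))))"
proof -
  have \<alpha>: "1 / \<alpha> \<noteq> 0" using assms(1) by simp
  have s: "2 * (real CARD('d) + 1) \<le> s"
  proof -
    have "1 \<le> CARD('d)" by (simp add: Suc_leI)
    then have "2 \<le> real CARD('d) + 1" by linarith
    then have "2 * (real CARD('d) + 1) \<le> (real CARD('d) + 1) * (real CARD('d) + 1)"
      by (intro mult_right_mono) auto
    then show ?thesis using assms(4) by (simp add: power2_eq_square)
  qed
  then have s0: "0 \<le> s" by (rule order_trans[rotated]) simp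
  have A: "slanted (floor_map \<alpha>) s A" using assms(5) Sigma_class_iff_slanted[OF assms(1)] by blast
  have As: "slanted (floor_map (1 / \<alpha>)) s (mat_star A)" by (rule slanted_mat_star[OF assms(1) s0 A])
  have star: "mat_star (mat_star A) = A" by (rule mat_star_star[OF slanted_operator_matrix[OF A]])
  obtain K where K: "1 \<le> K" "fibres_le K (floor_map \<alpha> :: 'd index \<Rightarrow> 'd index)"
    using fibres_floor_map[OF assms(1)] .
  obtain L where L: "1 \<le> L" "fibres_le L (floor_map (1 / \<alpha>) :: 'd index \<Rightarrow> 'd index)"
    using fibres_floor_map[OF \<alpha>] .
  note bA = bounded_mat_op_slanted[OF A s0] and bAs = bounded_mat_op_slanted[OF As s0]
  show ?thesis
  proof (intro conjI impI)
    assume below: "bounded_below p A"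
    obtain G where G: "slanted id s G"
      and inv: "\<And>x. bounded (range x) \<Longrightarrow> mat_op G (mat_op (mat_star A) (mat_op A x)) = x"
        "\<And>x. bounded (range x) \<Longrightarrow> mat_op (mat_star A) (mat_op A (mat_op G x)) = x"
      using gram_inverse[OF K(2,1) L(2) A As s assms(6) below] by blast
    define Asharp where "Asharp = mat_mult G (mat_star A)"
    have sharp: "slanted (floor_map (1 / \<alpha>)) s Asharp"
      unfolding Asharp_def by (rule slanted_mult_mat_star[OF assms(1) s0 G A])
    have sharp_op: "mat_op Asharp y = mat_op G (mat_op (mat_star A) y)" if "bounded (range y)" for y
      unfolding Asharp_def by (rule mat_op_mult_slanted[OF G As s0 that])
    have left: "lp_left_inverse q (mat_op A) (mat_op Asharp)" if q: "1 \<le> q" for q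
      unfolding lp_left_inverse_def
    proof (intro conjI ballI)
      show "lp_operator q (mat_op A)" by (rule lp_operator_slanted[OF A s0 K(2) q])
      show "lp_operator q (mat_op Asharp)" by (rule lp_operator_slanted[OF sharp s0 L(2) q])
      show "mat_op Asharp (mat_op A x) = x" if "x \<in> lp q" for x
        using bounded_range_of_lp[OF q that] by (simp add: sharp_op bA inv(1))
    qed
    then show "\<forall>q\<ge>1. lp_left_invertible q (mat_op A)" unfolding lp_left_invertible_def by blast
    have "inverse_matrix (mat_op (mat_star A) \<circ> mat_op A) G"
      by (rule inverse_matrix_gram[OF A K(2) As L(2) s0 G inv])
    moreover have "represents Asharp (mat_op G \<circ> mat_op (mat_star A))"
      unfolding represents_def using bounded_range_of_lp sharp_op by auto
    moreover have "Asharp \<in> Sigma_class (1 / \<alpha>) (poly_weight s)"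
      using sharp Sigma_class_iff_slanted[OF \<alpha>] by blast
    ultimately show "\<exists>G Asharp. inverse_matrix (mat_op (mat_star A) \<circ> mat_op A) G \<and>
        represents Asharp (mat_op G \<circ> mat_op (mat_star A)) \<and>
        Asharp \<in> Sigma_class (1 / \<alpha>) (poly_weight s) \<and>
        (\<forall>q\<ge>1. lp_left_inverse q (mat_op A) (mat_op Asharp))"
      using left by blast
  next
    assume below: "bounded_below p (mat_star A)"
    obtain G where G: "slanted id s G"
      and inv: "\<And>x. bounded (range x) \<Longrightarrow> mat_op G (mat_op A (mat_op (mat_star A) x)) = x"
        "\<And>x. bounded (range x) \<Longrightarrow> mat_op A (mat_op (mat_star A) (mat_op G x)) = x"
      using gram_inverse[OF L(2,1) K(2) As _ s assms(6) below] A unfolding star by blast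
    define Aflat where "Aflat = mat_mult (mat_star A) G"
    have flat: "slanted (floor_map (1 / \<alpha>)) s Aflat"
      unfolding Aflat_def by (rule slanted_mult[OF As G s0])
    have flat_op: "mat_op Aflat y = mat_op (mat_star A) (mat_op G y)" if "bounded (range y)" for y
      unfolding Aflat_def by (rule mat_op_mult_slanted[OF As G s0 that])
    have right: "lp_right_inverse q (mat_op A) (mat_op Aflat)" if q: "1 \<le> q" for q
      unfolding lp_right_inverse_def
    proof (intro conjI ballI)
      show "lp_operator q (mat_op A)" by (rule lp_operator_slanted[OF A s0 K(2) q])
      show "lp_operator q (mat_op Aflat)" by (rule lp_operator_slanted[OF flat s0 L(2) q])
      show "mat_op A (mat_op Aflat y) = y" if "y \<in> lp q" for y
        using bounded_range_of_lp[OF q that] by (simp add: flat_op inv(2))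
    qed
    then show "\<forall>q\<ge>1. lp_right_invertible q (mat_op A)" unfolding lp_right_invertible_def by blast
    have "inverse_matrix (mat_op (mat_star (mat_star A)) \<circ> mat_op (mat_star A)) G"
      by (rule inverse_matrix_gram[OF As L(2) _ K(2) s0 G]) (use A inv in \<open>simp_all add: star\<close>)
    then have "inverse_matrix (mat_op A \<circ> mat_op (mat_star A)) G" by (simp only: star)
    moreover have "represents Aflat (mat_op (mat_star A) \<circ> mat_op G)"
      unfolding represents_def using bounded_range_of_lp flat_op by auto
    moreover have "Aflat \<in> Sigma_class (1 / \<alpha>) (poly_weight s)"
      using flat Sigma_class_iff_slanted[OF \<alpha>] by blast
    ultimately show "\<exists>G Aflat. inverse_matrix (mat_op A \<circ> mat_op (mat_star A)) G \<and>
        represents Aflat (mat_op (mat_star A) \<circ> mat_op G) \<and>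
        Aflat \<in> Sigma_class (1 / \<alpha>) (poly_weight s) \<and>
        (\<forall>q\<ge>1. lp_right_inverse q (mat_op A) (mat_op Aflat))"
      using right by blast
  qed
qed

end
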